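(* Let $d=2$, let $\ell\in\mathbb{R}^2\setminus\{0\}$, and let $\mathbb{P}$ be a probability measure on $\Omega$ under which the random vectors $\omega(x,\cdot)=(\omega(x,x+e))_{|e|=1}$, $x\in\mathbb{Z}^2$, are independent and identically distributed and under which the environment is $\mathbb{P}$-almost surely elliptic, i.e. $\mathbb{P}$-a.s. $\omega(x,x+e)>0$ for all $x,e\in\mathbb{Z}^2$ with $|e|=1$. Then the annealed probability of the event $A_\ell=\{\lim_{n\to\infty}X_n\cdot\ell=\infty\}$ satisfies $$P_0[A_\ell]\in\{0,1\}.$$
   Context: Let $\mathcal{P}$ be the set of $4$-dimensional probability vectors and let $\Omega=\mathcal{P}^{\mathbb{Z}^2}$, endowed with the canonical product $\sigma$-algebra. An element $\omega\in\Omega$, called an environment, is written $\omega=((\omega(x,x+e))_{|e|=1})_{x\in\mathbb{Z}^2}$, where $e$ ranges over the four unit vectors of $\mathbb{Z}^2$; thus $\omega(x,x+e)\ge 0$ and $\sum_{|e|=1}\omega(x,x+e)=1$ for each $x$. For an environment $\omega$ and $z\in\mathbb{Z}^2$, the quenched measure $P_{z,\omega}$ is the probability measure on $(\mathbb{Z}^2)^{\mathbb{N}}$ (with $\mathbb{N}=\{0,1,2,\dots\}$ as index set) under which the canonical projections $(X_n)_{n\ge 0}$ satisfy $P_{z,\omega}[X_0=z]=1$ and $P_{z,\omega}[X_{n+1}=X_n+e\mid X_0,\dots,X_n]=\omega(X_n,X_n+e)$ $P_{z,\omega}$-a.s. for all $n\ge 0$ and all $e\in\mathbb{Z}^2$ with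 $|e|=1$. That is, $(X_n)$ is the Markov chain started at $z$ with transition probabilities $\omega(x,x+e)$. Given a probability measure $\mathbb{P}$ on $\Omega$ with expectation $\mathbb{E}$, the annealed measure $P_z$ is the semi-direct product $\mathbb{P}\times P_{z,\omega}$ on $\Omega\times(\mathbb{Z}^2)^{\mathbb{N}}$, so that $P_z[\cdot]=\mathbb{E}[P_{z,\omega}[\cdot]]$. The product $x\cdot\ell$ is the Euclidean inner product. *)

theory Defs
  imports "HOL-Probability.Probability"
begin

definition lattice_vec :: "int \<times> int \<Rightarrow> real \<times> real" where
  "lattice_vec x = (real_of_int (fst x), real_of_int (snd x))"

definition unit_steps :: "(int \<times> int) set" where
  "unit_steps = {e. norm (lattice_vec e) = 1}"

text \<open>
  An environment \<^term>\<open>\<omega> :: int \<times> int \<Rightarrow> int \<times> int \<Rightarrow> real\<close> is indexed by site and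
  step: \<^term>\<open>\<omega> x e\<close> is the probability of jumping from \<^term>\<open>x\<close> to \<^term>\<open>x + e\<close>. The vector
  at a site is extensional, i.e. \<^term>\<open>undefined\<close> outside the four unit steps, so that it
  carries no information beyond its four entries.
\<close>

definition prob_vec_space :: "(int \<times> int \<Rightarrow> real) measure" where
  "prob_vec_space = restrict_space (\<Pi>\<^sub>M e\<in>unit_steps. borel)
     {p. (\<forall>e\<in>unit_steps. 0 \<le> p e) \<and> (\<Sum>e\<in>unit_steps. p e) = 1}"

definition env_space :: "(int \<times> int \<Rightarrow> int \<times> int \<Rightarrow> real) measure" where
  "env_space = (\<Pi>\<^sub>M x\<in>UNIV. prob_vec_space)"

definition path_space :: "(nat \<Rightarrow> int \<times> int) measure" where
  "path_space = (\<Pi>\<^sub>M n\<in>UNIV. count_space UNIV)"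

text \<open>The sub-\<open>\<sigma>\<close>-algebra on paths generated by the first projections \<open>X\<^sub>0, \<dots>, X\<^sub>n\<close>.\<close>

definition history :: "nat \<Rightarrow> (nat \<Rightarrow> int \<times> int) measure" where
  "history n = vimage_algebra UNIV (\<lambda>X. restrict X {..n}) (\<Pi>\<^sub>M i\<in>{..n}. count_space UNIV)"

definition is_quenched_law ::
  "(int \<times> int \<Rightarrow> int \<times> int \<Rightarrow> real) \<Rightarrow> int \<times> int \<Rightarrow> (nat \<Rightarrow> int \<times> int) measure \<Rightarrow> bool" where
  "is_quenched_law \<omega> z Q \<longleftrightarrow>
     prob_space Q \<and> sets Q = sets path_space \<and>
     measure Q {X. X 0 = z} = 1 \<and>
     (\<forall>n. \<forall>e\<in>unit_steps. AE X in Q.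
        real_cond_exp Q (history n) (indicator {X. X (Suc n) = X n + e}) X = \<omega> (X n) e)"

text \<open>
  Existence and uniqueness for every \<^term>\<open>\<omega> \<in> space env_space\<close>, measurability in
  \<^term>\<open>\<omega>\<close>, and the formula for the annealed law as an expectation are established below.
\<close>

definition quenched_law ::
  "(int \<times> int \<Rightarrow> int \<times> int \<Rightarrow> real) \<Rightarrow> int \<times> int \<Rightarrow> (nat \<Rightarrow> int \<times> int) measure" where
  "quenched_law \<omega> z = (THE Q. is_quenched_law \<omega> z Q)"

definition annealed_law ::
  "(int \<times> int \<Rightarrow> int \<times> int \<Rightarrow> real) measure \<Rightarrow> int \<times> int \<Rightarrow>
     ((int \<times> int \<Rightarrow> int \<times> int \<Rightarrow> real) \<times> (nat \<Rightarrow> int \<times> int)) measure" where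
  "annealed_law P z =
     P \<bind> (\<lambda>\<omega>. distr (quenched_law \<omega> z) (env_space \<Otimes>\<^sub>M path_space) (\<lambda>X. (\<omega>, X)))"

definition iid_env :: "(int \<times> int \<Rightarrow> int \<times> int \<Rightarrow> real) measure \<Rightarrow> bool" where
  "iid_env P \<longleftrightarrow>
     prob_space.indep_vars P (\<lambda>_. prob_vec_space) (\<lambda>x \<omega>. \<omega> x) UNIV \<and>
     (\<forall>x y. distr P prob_vec_space (\<lambda>\<omega>. \<omega> x) = distr P prob_vec_space (\<lambda>\<omega>. \<omega> y))"

definition elliptic_env :: "(int \<times> int \<Rightarrow> int \<times> int \<Rightarrow> real) measure \<Rightarrow> bool" where
  "elliptic_env P \<longleftrightarrow> (AE \<omega> in P. \<forall>x. \<forall>e\<in>unit_steps. 0 < \<omega> x e)"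

definition transience_event ::
  "real \<times> real \<Rightarrow> ((int \<times> int \<Rightarrow> int \<times> int \<Rightarrow> real) \<times> (nat \<Rightarrow> int \<times> int)) set" where
  "transience_event l = {(\<omega>, X). \<omega> \<in> space env_space \<and>
     filterlim (\<lambda>n. lattice_vec (X n) \<bullet> l) at_top sequentially}"


lemma unit_steps_eq: "unit_steps = {(1, 0), (-1, 0), (0, 1), (0, -1)}"
proof -
  have *: "a\<^sup>2 + b\<^sup>2 = 1 \<longleftrightarrow> (a, b) \<in> {(1, 0), (-1, 0), (0, 1), (0, -1)}" for a b :: int
  proof
    assume h: "a\<^sup>2 + b\<^sup>2 = 1"
    have "a\<^sup>2 \<le> 1" "b\<^sup>2 \<le> 1" using h zero_le_power2[of a] zero_le_power2[of b] by linarith+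
    then have "\<bar>a\<bar> \<le> 1" "\<bar>b\<bar> \<le> 1" by (simp_all add: abs_square_le_1)
    then have "a = -1 \<or> a = 0 \<or> a = 1" "b = -1 \<or> b = 0 \<or> b = 1" by arith+
    with h show "(a, b) \<in> {(1, 0), (-1, 0), (0, 1), (0, -1)}" by auto
  qed auto
  have "norm (lattice_vec (a, b)) = 1 \<longleftrightarrow> a\<^sup>2 + b\<^sup>2 = 1" for a b
  proof -
    have "norm (lattice_vec (a, b)) = 1 \<longleftrightarrow> real_of_int (a\<^sup>2 + b\<^sup>2) = 1"
      by (simp add: lattice_vec_def norm_Pair)
    then show ?thesis by linarith
  qed
  with * show ?thesis unfolding unit_steps_def by auto
qed

lemma finite_unit_steps [simp]: "finite unit_steps"
  by (simp add: unit_steps_eq)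

lemma space_path_space [simp]: "space path_space = UNIV"
  by (simp add: path_space_def space_PiM)

lemma measurable_path_component [measurable]: "(\<lambda>X. X n) \<in> measurable path_space (count_space UNIV)"
  unfolding path_space_def by measurable

lemma sets_history_eq:
  "sets (history n) =
     (\<lambda>B. {X. restrict X {..n} \<in> B}) ` sets (\<Pi>\<^sub>M i\<in>{..n}. count_space (UNIV :: (int \<times> int) set))"
  unfolding history_def
  by (subst sets_vimage_algebra2) (auto simp: space_PiM vimage_def)

lemma space_history [simp]: "space (history n) = UNIV"
  by (simp add: history_def)

lemma subalgebra_history:
  assumes "sets Q = sets path_space" shows "subalgebra Q (history n)"
proof -
  have "space Q = UNIV" using sets_eq_imp_space_eq[OF assms] by simp
  moreover have "sets (history n) \<subseteq> sets path_space"
  proof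
    fix A assume "A \<in> sets (history n)"
    then obtain B where B: "B \<in> sets (\<Pi>\<^sub>M i\<in>{..n}. count_space (UNIV :: (int \<times> int) set))"
      and A: "A = {X. restrict X {..n} \<in> B}" unfolding sets_history_eq by auto
    have "(\<lambda>X. restrict X {..n}) \<in> measurable path_space (\<Pi>\<^sub>M i\<in>{..n}. count_space (UNIV :: (int \<times> int) set))"
      unfolding path_space_def by (rule measurable_restrict_subset) simp
    from measurable_sets[OF this B] show "A \<in> sets path_space"
      by (simp add: A vimage_def)
  qed
  ultimately show ?thesis by (simp add: subalgebra_def assms)
qed

lemma measurable_history: "i \<le> n \<Longrightarrow> (\<lambda>X. X i) \<in> measurable (history n) (count_space UNIV)"
proof -
  assume i: "i \<le> n"
  have "(\<lambda>X. restrict X {..n}) \<in> measurable (history n) (\<Pi>\<^sub>M i\<in>{..n}. count_space (UNIV :: (int \<times> int) set))"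
    unfolding history_def by (rule measurable_vimage_algebra1) (auto simp: space_PiM)
  from measurable_compose[OF this measurable_component_singleton[of i]] i show ?thesis by simp
qed

lemma env_nonneg: "\<omega> \<in> space env_space \<Longrightarrow> e \<in> unit_steps \<Longrightarrow> 0 \<le> \<omega> x e"
  by (simp add: env_space_def prob_vec_space_def space_PiM space_restrict_space PiE_iff
      del: split_paired_All)

lemma env_sum: "\<omega> \<in> space env_space \<Longrightarrow> (\<Sum>e\<in>unit_steps. \<omega> x e) = 1"
  by (simp add: env_space_def prob_vec_space_def space_PiM space_restrict_space PiE_iff
      del: split_paired_All)


text \<open>Existence: the Ionescu-Tulcea extension of the one-step transition laws.\<close>

definition step_pmf :: "(int \<times> int \<Rightarrow> int \<times> int \<Rightarrow> real) \<Rightarrow> int \<times> int \<Rightarrow> (int \<times> int) pmf" where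
  "step_pmf \<omega> x = map_pmf (\<lambda>e. x + e) (embed_pmf (\<lambda>e. if e \<in> unit_steps then \<omega> x e else 0))"

lemma pmf_step_pmf:
  assumes \<omega>: "\<omega> \<in> space env_space" and e: "e \<in> unit_steps"
  shows "pmf (step_pmf \<omega> x) (x + e) = \<omega> x e"
proof -
  let ?f = "\<lambda>e. if e \<in> unit_steps then \<omega> x e else 0"
  have nn: "\<And>e. 0 \<le> ?f e" using env_nonneg[OF \<omega>] by simp
  have "(\<integral>\<^sup>+ e. ennreal (?f e) \<partial>count_space UNIV) = (\<integral>\<^sup>+ e. ennreal (\<omega> x e) \<partial>count_space unit_steps)"
    by (subst nn_integral_count_space_indicator) (auto intro!: nn_integral_cong simp: indicator_def)
  also have "\<dots> = ennreal (\<Sum>e\<in>unit_steps. \<omega> x e)"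
    by (simp add: nn_integral_count_space_finite env_nonneg[OF \<omega>] flip: sum_ennreal)
  finally have 1: "(\<integral>\<^sup>+ e. ennreal (?f e) \<partial>count_space UNIV) = 1"
    by (simp add: env_sum[OF \<omega>])
  have "pmf (step_pmf \<omega> x) (x + e) = pmf (embed_pmf ?f) e"
    unfolding step_pmf_def by (rule pmf_map_inj') simp
  then show ?thesis using e by (simp add: pmf_embed_pmf[OF nn 1])
qed

definition walk_kernel ::
  "(int \<times> int \<Rightarrow> int \<times> int \<Rightarrow> real) \<Rightarrow> int \<times> int \<Rightarrow> nat \<Rightarrow> (nat \<Rightarrow> int \<times> int) \<Rightarrow> (int \<times> int) measure" where
  "walk_kernel \<omega> z n X =
     measure_pmf (if n = 0 then return_pmf z else step_pmf \<omega> (X (n - 1)))"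

lemma Ionescu_Tulcea_walk: "Ionescu_Tulcea (walk_kernel \<omega> z) (\<lambda>_. count_space UNIV)"
proof (rule Ionescu_Tulcea.intro)
  fix n
  show "walk_kernel \<omega> z n \<in> measurable (Pi\<^sub>M {0..<n} (\<lambda>_. count_space UNIV)) (subprob_algebra (count_space UNIV))"
  proof (cases n)
    case 0
    then show ?thesis
      by (simp add: walk_kernel_def[abs_def] measure_pmf_in_subprob_algebra)
  next
    case (Suc m)
    have "(\<lambda>X. X m) \<in> measurable (Pi\<^sub>M {0..<n} (\<lambda>_. count_space (UNIV :: (int \<times> int) set))) (count_space UNIV)"
      using Suc by (intro measurable_component_singleton) auto
    moreover have "(\<lambda>x. measure_pmf (step_pmf \<omega> x)) \<in> measurable (count_space UNIV) (subprob_algebra (count_space UNIV))"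
      by (simp add: measure_pmf_in_subprob_algebra)
    ultimately show ?thesis
      using Suc by (simp add: walk_kernel_def[abs_def] measurable_compose)
  qed
qed (simp only: walk_kernel_def prob_space_measure_pmf)

lemma ex_quenched_law:
  assumes \<omega>: "\<omega> \<in> space env_space"
  shows "\<exists>Q. is_quenched_law \<omega> z Q"
proof -
  let ?M = "\<lambda>_::nat. count_space (UNIV :: (int \<times> int) set)"
  interpret IT: Ionescu_Tulcea "walk_kernel \<omega> z" ?M by (rule Ionescu_Tulcea_walk)
  let ?C = "\<lambda>n. IT.C 0 n (\<lambda>_. undefined)"
  define Q where "Q = IT.PF.lim"
  have sQ: "sets Q = sets path_space" by (simp add: Q_def path_space_def)
  have spQ: "space Q = UNIV" using sets_eq_imp_space_eq[OF sQ] by simp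
  note [measurable_cong] = sQ
  have x0 [simp]: "(\<lambda>_. undefined) \<in> space (Pi\<^sub>M {0..<0} ?M)" by (simp add: space_PiM)
  have spC: "space (?C n) = space (Pi\<^sub>M {0..<n} ?M)" for n using IT.space_C[OF x0, of n] by simp
  have stC [measurable_cong]: "sets (?C n) = sets (Pi\<^sub>M {0..<n} ?M)" for n using IT.sets_C[OF x0, of n] by simp
  have up: "IT.up_to {0..<n} = n" for n :: nat
  proof (rule antisym)
    show "IT.up_to {0..<n} \<le> n" by (simp add: IT.up_to_iff_Ico)
    show "n \<le> IT.up_to {0..<n}" using IT.up_to[of "{0..<n}"] by auto
  qed
  have distr: "distr Q (Pi\<^sub>M {0..<n} ?M) (\<lambda>X. restrict X {0..<n}) = ?C n" for n
  proof -
    have "distr Q (Pi\<^sub>M {0..<n} ?M) (\<lambda>X. restrict X {0..<n}) = IT.CI {0..<n}"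
      unfolding Q_def by (rule IT.distr_lim) simp
    also have "\<dots> = distr (?C n) (Pi\<^sub>M {0..<n} ?M) (\<lambda>X. restrict X {0..<n})"
      by (simp add: IT.CI_def up)
    also have "\<dots> = ?C n" using IT.distr_C[of n n "\<lambda>_. undefined" 0] by simp
    finally show ?thesis .
  qed
  have restr [measurable]: "(\<lambda>X. restrict X {0..<n}) \<in> measurable path_space (Pi\<^sub>M {0..<n} ?M)" for n
    unfolding path_space_def by (rule measurable_restrict_subset) simp
  have em: "emeasure Q {X. restrict X {0..<n} \<in> A} = emeasure (?C n) A"
    if "A \<in> sets (Pi\<^sub>M {0..<n} ?M)" for A n
    using that by (subst distr[symmetric], subst emeasure_distr) (auto simp: vimage_def spQ)
  have nn: "(\<integral>\<^sup>+X. f (restrict X {0..<n}) \<partial>Q) = (\<integral>\<^sup>+X. f X \<partial>?C n)"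
    if "f \<in> borel_measurable (Pi\<^sub>M {0..<n} ?M)" for f n
    using that by (subst distr[symmetric], subst nn_integral_distr) auto
  have "prob_space Q"
  proof (rule prob_space_distrD)
    show "(\<lambda>X. restrict X {0..<0}) \<in> measurable Q (Pi\<^sub>M {0..<0} ?M)" by measurable
    show "prob_space (distr Q (Pi\<^sub>M {0..<0} ?M) (\<lambda>X. restrict X {0..<0}))"
      unfolding distr by (rule IT.prob_space_C) simp
  qed
  then interpret Q: prob_space Q .

  have start: "measure Q {X. X 0 = z} = 1"
  proof -
    let ?A = "{f \<in> space (Pi\<^sub>M {0..<Suc 0} ?M). f 0 = z}"
    have A: "?A \<in> sets (Pi\<^sub>M {0..<Suc 0} ?M)" by measurable
    have "emeasure Q {X. X 0 = z} = emeasure Q {X. restrict X {0..<Suc 0} \<in> ?A}"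
      by (simp add: space_PiM)
    also have "\<dots> = emeasure (?C (Suc 0)) ?A" by (rule em[OF A])
    also have "?C (Suc 0) = IT.eP 0 (\<lambda>_. undefined)"
      using bind_return[OF IT.measurable_eP[of 0] x0] by simp
    also have "emeasure (IT.eP 0 (\<lambda>_. undefined)) ?A =
        emeasure (walk_kernel \<omega> z 0 (\<lambda>_. undefined)) ((\<lambda>x. (\<lambda>_. undefined)(0 := x)) -` ?A \<inter> space (?M 0))"
      by (rule IT.emeasure_eP[OF x0 A])
    also have "(\<lambda>x. (\<lambda>_. undefined)(0 := x)) -` ?A \<inter> space (?M 0) = {z}"
      by (auto simp: space_PiM PiE_iff extensional_def)
    also have "emeasure (walk_kernel \<omega> z 0 (\<lambda>_. undefined)) {z} = 1"
      by (simp add: walk_kernel_def emeasure_pmf_single)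
    finally show ?thesis by (simp add: measure_def)
  qed

  have step: "emeasure Q {X. restrict X {0..<Suc n} \<in> B \<and> X (Suc n) = X n + e} =
      (\<integral>\<^sup>+X. indicator B (restrict X {0..<Suc n}) * ennreal (\<omega> (X n) e) \<partial>Q)"
    if B [measurable]: "B \<in> sets (Pi\<^sub>M {0..<Suc n} ?M)" and e: "e \<in> unit_steps" for n B e
  proof -
    let ?S = "Pi\<^sub>M {0..<Suc (Suc n)} ?M"
    let ?A = "{f \<in> space ?S. restrict f {0..<Suc n} \<in> B \<and> f (Suc n) = f n + e}"
    have [measurable]: "(\<lambda>f. restrict f {0..<Suc n}) \<in> measurable ?S (Pi\<^sub>M {0..<Suc n} ?M)"
      by (rule measurable_restrict_subset) auto
    have c [measurable]: "(\<lambda>f. f n) \<in> measurable ?S (count_space UNIV)"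
      "(\<lambda>f. f (Suc n)) \<in> measurable ?S (count_space UNIV)"
      by (rule measurable_component_singleton, simp)+
    have A: "?A \<in> sets ?S" by measurable
    have "emeasure Q {X. restrict X {0..<Suc n} \<in> B \<and> X (Suc n) = X n + e} =
        emeasure Q {X. restrict X {0..<Suc (Suc n)} \<in> ?A}"
      by (simp add: space_PiM Int_absorb1 min_def ivl_subset)
    also have "\<dots> = emeasure (?C (Suc (Suc n))) ?A" by (rule em[OF A])
    also have "\<dots> = (\<integral>\<^sup>+y. emeasure (IT.eP (Suc n) y) ?A \<partial>?C (Suc n))"
    proof -
      have eq: "?C (Suc (Suc n)) = ?C (Suc n) \<bind> IT.eP (Suc n)" by simp
      have k: "IT.eP (Suc n) \<in> measurable (?C (Suc n)) (subprob_algebra ?S)" by measurable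
      have ne: "space (?C (Suc n)) \<noteq> {}" unfolding spC by (simp add: space_PiM PiE_eq_empty_iff)
      show ?thesis unfolding eq by (rule emeasure_bind[OF ne k A])
    qed
    also have "\<dots> = (\<integral>\<^sup>+y. indicator B y * ennreal (\<omega> (y n) e) \<partial>?C (Suc n))"
    proof (rule nn_integral_cong)
      fix y assume "y \<in> space (?C (Suc n))"
      then have y: "y \<in> space (Pi\<^sub>M {0..<Suc n} ?M)" by (simp only: spC)
      then have ext: "y \<in> extensional {0..<Suc n}" by (simp add: space_PiM PiE_iff)
      have r: "restrict (y(Suc n := x)) {0..<Suc n} = y" for x
        using ext by (auto simp: fun_eq_iff restrict_def extensional_def)
      have "(\<lambda>x. y(Suc n := x)) -` ?A \<inter> space (?M (Suc n)) = (if y \<in> B then {y n + e} else {})"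
        using ext unfolding vimage_def mem_Collect_eq r by (auto simp: space_PiM PiE_iff extensional_def)
      then have "emeasure (IT.eP (Suc n) y) ?A =
          emeasure (walk_kernel \<omega> z (Suc n) y) (if y \<in> B then {y n + e} else {})"
        by (simp only: IT.emeasure_eP[OF y A])
      also have "\<dots> = indicator B y * ennreal (\<omega> (y n) e)"
        by (simp add: walk_kernel_def emeasure_pmf_single pmf_step_pmf[OF \<omega> e])
      finally show "emeasure (IT.eP (Suc n) y) ?A = indicator B y * ennreal (\<omega> (y n) e)" .
    qed
    also have "\<dots> = (\<integral>\<^sup>+X. indicator B (restrict X {0..<Suc n}) * ennreal (\<omega> (restrict X {0..<Suc n} n) e) \<partial>Q)"
    proof (rule nn[symmetric])
      have [measurable]: "(\<lambda>f. f n) \<in> measurable (Pi\<^sub>M {0..<Suc n} ?M) (count_space UNIV)"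
        by (rule measurable_component_singleton) simp
      show "(\<lambda>y. indicator B y * ennreal (\<omega> (y n) e)) \<in> borel_measurable (Pi\<^sub>M {0..<Suc n} ?M)"
        by measurable
    qed
    finally show ?thesis by simp
  qed

  have "AE X in Q. real_cond_exp Q (history n) (indicator {X. X (Suc n) = X n + e}) X = \<omega> (X n) e"
    if e: "e \<in> unit_steps" for n e
  proof -
    have "finite_measure_subalgebra Q (history n)"
      using subalgebra_history[OF sQ] by (simp add: finite_measure_subalgebra_def
        finite_measure_subalgebra_axioms_def Q.finite_measure_axioms)
    then interpret F: finite_measure_subalgebra Q "history n" .
    have le1: "\<omega> x e \<le> 1" for x
      using member_le_sum[OF e, of "\<omega> x"] env_nonneg[OF \<omega>] env_sum[OF \<omega>, of x] by simp
    have gF: "(\<lambda>X. \<omega> (X n) e) \<in> borel_measurable (history n)"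
      by (rule measurable_compose[OF measurable_history[of n n]]) simp_all
    then have gQ [measurable]: "(\<lambda>X. \<omega> (X n) e) \<in> borel_measurable Q"
      using measurable_from_subalg[OF F.subalg] by blast
    have ev [measurable]: "{X. X (Suc n) = X n + e} \<in> sets Q"
    proof -
      have "{X \<in> space path_space. X (Suc n) = X n + e} \<in> sets path_space" by measurable
      then show ?thesis by (simp add: sQ)
    qed
    show ?thesis
    proof (rule F.real_cond_exp_charact)
      show "integrable Q (indicat_real {X. X (Suc n) = X n + e})"
        by (simp add: integrable_indicator_iff Q.emeasure_eq_measure)
      show ig: "integrable Q (\<lambda>X. \<omega> (X n) e)"
        by (rule Q.integrable_const_bound[of _ 1]) (auto simp: env_nonneg[OF \<omega> e] le1)
      show "(\<lambda>X. \<omega> (X n) e) \<in> borel_measurable (history n)" by (rule gF)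
      fix A assume AF: "A \<in> sets (history n)"
      then have [measurable]: "A \<in> sets Q" using F.subalg by (auto simp: subalgebra_def)
      have I: "{..n} = {0..<Suc n}" by auto
      obtain B where B: "B \<in> sets (Pi\<^sub>M {0..<Suc n} ?M)" and A: "A = {X. restrict X {0..<Suc n} \<in> B}"
        using AF unfolding sets_history_eq I by auto
      have "ennreal (\<integral>X\<in>A. indicator {X. X (Suc n) = X n + e} X \<partial>Q) =
          emeasure Q (A \<inter> {X. X (Suc n) = X n + e})"
        by (simp add: set_lebesgue_integral_def spQ Q.emeasure_eq_measure flip: indicator_inter_arith)
      also have "A \<inter> {X. X (Suc n) = X n + e} = {X. restrict X {0..<Suc n} \<in> B \<and> X (Suc n) = X n + e}"
        by (auto simp: A)
      also have "emeasure Q \<dots> = (\<integral>\<^sup>+X. ennreal (indicator A X * \<omega> (X n) e) \<partial>Q)"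
        unfolding step[OF B e] by (intro nn_integral_cong) (auto simp: A indicator_def)
      also have "\<dots> = ennreal (\<integral>X\<in>A. \<omega> (X n) e \<partial>Q)"
        unfolding set_lebesgue_integral_def real_scaleR_def
        by (rule nn_integral_eq_integral)
          (auto intro!: integrable_real_mult_indicator ig simp: env_nonneg[OF \<omega> e] mult.commute[of "indicator A _"])
      finally show "(\<integral>X\<in>A. indicator {X. X (Suc n) = X n + e} X \<partial>Q) = (\<integral>X\<in>A. \<omega> (X n) e \<partial>Q)"
        by (subst (asm) ennreal_inj)
          (auto simp: set_lebesgue_integral_def env_nonneg[OF \<omega> e] intro!: integral_nonneg_AE)
    qed
  qed
  with start sQ Q.prob_space_axioms show ?thesis
    unfolding is_quenched_law_def by blast
qed

text \<open>Finite-dimensional distributions, and hence uniqueness and measurability.\<close>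

definition cylinder :: "(int \<times> int) list \<Rightarrow> (nat \<Rightarrow> int \<times> int) set" where
  "cylinder xs = {X. \<forall>i<length xs. X i = xs ! i}"

definition transition :: "(int \<times> int \<Rightarrow> int \<times> int \<Rightarrow> real) \<Rightarrow> int \<times> int \<Rightarrow> int \<times> int \<Rightarrow> real" where
  "transition \<omega> x y = (if y - x \<in> unit_steps then \<omega> x (y - x) else 0)"

definition path_weight :: "(int \<times> int \<Rightarrow> int \<times> int \<Rightarrow> real) \<Rightarrow> int \<times> int \<Rightarrow> (int \<times> int) list \<Rightarrow> real" where
  "path_weight \<omega> z xs =
     (\<Prod>i<length xs. if i = 0 then of_bool (xs ! 0 = z) else transition \<omega> (xs ! (i - 1)) (xs ! i))"

lemma cylinder_snoc: "cylinder (xs @ [y]) = cylinder xs \<inter> {X. X (length xs) = y}"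
  by (auto simp: cylinder_def nth_append less_Suc_eq)

lemma path_weight_snoc:
  "xs \<noteq> [] \<Longrightarrow> path_weight \<omega> z (xs @ [y]) = path_weight \<omega> z xs * transition \<omega> (last xs) y"
proof -
  assume xs: "xs \<noteq> []"
  let ?t = "\<lambda>ys i. if i = 0 then of_bool (ys ! 0 = z) else transition \<omega> (ys ! (i - 1)) (ys ! i)"
  have "(\<Prod>i<length xs. ?t (xs @ [y]) i) = (\<Prod>i<length xs. ?t xs i)"
    by (rule prod.cong) (auto simp: nth_append)
  with xs show ?thesis
    by (simp add: path_weight_def last_conv_nth nth_append_left del: of_bool_eq_iff cong: if_cong)
qed

lemma cylinder_in_history: "xs \<noteq> [] \<Longrightarrow> cylinder xs \<in> sets (history (length xs - 1))"
proof -
  assume "xs \<noteq> []"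
  have "{X \<in> space (history (length xs - 1)). \<forall>i\<in>{..<length xs}. X i = xs ! i} \<in> sets (history (length xs - 1))"
  proof (rule sets.sets_Collect_finite_All)
    fix i assume "i \<in> {..<length xs}"
    then have "(\<lambda>X. X i) \<in> measurable (history (length xs - 1)) (count_space UNIV)"
      by (intro measurable_history) auto
    from measurable_sets[OF this, of "{xs ! i}"]
    show "{X \<in> space (history (length xs - 1)). X i = xs ! i} \<in> sets (history (length xs - 1))"
      by (simp add: vimage_def)
  qed simp
  then show ?thesis by (simp add: cylinder_def Ball_def)
qed

lemma cylinder_in_path [measurable]: "cylinder xs \<in> sets path_space"
  by (cases "xs = []")
    (use subalgebra_history[OF refl] cylinder_in_history sets.top[of path_space]
      in \<open>auto simp: subalgebra_def cylinder_def simp del: sets.top\<close>)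

lemma sets_path_space: "sets path_space = sigma_sets UNIV (insert {} (range cylinder))"
proof (rule antisym)
  show "sigma_sets UNIV (insert {} (range cylinder)) \<subseteq> sets path_space"
    using sets.sigma_sets_subset[of "insert {} (range cylinder)" path_space]
    by (simp add: image_subset_iff)
  interpret S: sigma_algebra UNIV "sigma_sets UNIV (insert {} (range cylinder))"
    by (rule sigma_algebra_sigma_sets) simp
  have "{X. X n \<in> A} \<in> sigma_sets UNIV (insert {} (range cylinder))" for n and A :: "(int \<times> int) set"
  proof -
    have "{X. X n \<in> A} = (\<Union>xs\<in>{xs. length xs = Suc n \<and> xs ! n \<in> A}. cylinder xs)"
    proof (intro equalityI subsetI)
      fix X assume "X \<in> {X. X n \<in> A}"
      then show "X \<in> (\<Union>xs\<in>{xs. length xs = Suc n \<and> xs ! n \<in> A}. cylinder xs)"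
        by (intro UN_I[of "map X [0..<Suc n]"]) (auto simp: cylinder_def simp del: upt_Suc)
    qed (auto simp: cylinder_def)
    moreover have "countable {xs :: (int \<times> int) list. length xs = Suc n \<and> xs ! n \<in> A}" by simp
    ultimately show ?thesis by (auto intro!: S.countable_UN')
  qed
  then have "{{f \<in> UNIV \<rightarrow>\<^sub>E UNIV. f i \<in> A} |i A. i \<in> (UNIV :: nat set) \<and> A \<in> sets (count_space (UNIV :: (int \<times> int) set))}
      \<subseteq> sigma_sets UNIV (insert {} (range cylinder))"
    by (auto simp: PiE_UNIV_domain)
  then show "sets path_space \<subseteq> sigma_sets UNIV (insert {} (range cylinder))"
    unfolding path_space_def sets_PiM_single
    using S.sigma_sets_subset by (simp add: PiE_UNIV_domain)
qed

lemma Int_stable_cylinders: "Int_stable (insert {} (range cylinder))"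
proof -
  have *: "cylinder xs \<inter> cylinder ys \<in> insert {} (range cylinder)" if "length xs \<le> length ys" for xs ys
  proof (cases "\<forall>i<length xs. xs ! i = ys ! i")
    case True
    then have "cylinder xs \<inter> cylinder ys = cylinder ys" using that by (auto simp: cylinder_def)
    then show ?thesis by simp
  next
    case False
    then have "cylinder xs \<inter> cylinder ys = {}" using that
      by (auto simp: cylinder_def)
    then show ?thesis by simp
  qed
  show ?thesis
    unfolding Int_stable_def
  proof (intro ballI)
    fix A B assume AB: "A \<in> insert {} (range cylinder)" "B \<in> insert {} (range cylinder)"
    show "A \<inter> B \<in> insert {} (range cylinder)"
    proof (cases "A = {} \<or> B = {}")
      case False
      then obtain xs ys where "A = cylinder xs" "B = cylinder ys" using AB by auto
      then show ?thesis
        using *[of xs ys] *[of ys xs] linear[of "length xs" "length ys"] Int_commute[of A B] by metis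
    qed auto
  qed
qed

lemma quenched_law_step:
  assumes \<omega>: "\<omega> \<in> space env_space" and Q: "is_quenched_law \<omega> z Q"
    and xs: "xs \<noteq> []" and e: "e \<in> unit_steps"
  shows "measure Q (cylinder (xs @ [last xs + e])) = measure Q (cylinder xs) * \<omega> (last xs) e"
proof -
  interpret Q: prob_space Q using Q by (simp add: is_quenched_law_def)
  have sQ: "sets Q = sets path_space" using Q by (simp add: is_quenched_law_def)
  have spQ: "space Q = UNIV" using sets_eq_imp_space_eq[OF sQ] by simp
  define n where "n = length xs - 1"
  have "finite_measure_subalgebra Q (history n)"
    using subalgebra_history[OF sQ] by (simp add: finite_measure_subalgebra_def
      finite_measure_subalgebra_axioms_def Q.finite_measure_axioms)
  then interpret F: finite_measure_subalgebra Q "history n" .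
  have AF: "cylinder xs \<in> sets (history n)" unfolding n_def by (rule cylinder_in_history[OF xs])
  have AQ [measurable]: "cylinder xs \<in> sets Q" by (simp add: sQ)
  have ev [measurable]: "{X. X (Suc n) = X n + e} \<in> sets Q"
  proof -
    have "{X \<in> space path_space. X (Suc n) = X n + e} \<in> sets path_space" by measurable
    then show ?thesis by (simp add: sQ)
  qed
  have Xn: "X n = last xs" if "X \<in> cylinder xs" for X
    using that xs by (simp add: cylinder_def n_def last_conv_nth)
  have "measure Q (cylinder (xs @ [last xs + e])) = measure Q (cylinder xs \<inter> {X. X (Suc n) = X n + e})"
    using Xn xs by (auto intro!: arg_cong[where f="measure Q"] simp: cylinder_snoc n_def)
  also have "\<dots> = (\<integral>X\<in>cylinder xs. indicator {X. X (Suc n) = X n + e} X \<partial>Q)"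
    by (simp add: set_lebesgue_integral_def spQ flip: indicator_inter_arith)
  also have "\<dots> = (\<integral>X\<in>cylinder xs. real_cond_exp Q (history n) (indicator {X. X (Suc n) = X n + e}) X \<partial>Q)"
    by (rule F.real_cond_exp_intA[OF _ AF]) (simp add: integrable_indicator_iff Q.emeasure_eq_measure)
  also have "\<dots> = (\<integral>X. indicator (cylinder xs) X * \<omega> (last xs) e \<partial>Q)"
  proof -
    have "AE X in Q. real_cond_exp Q (history n) (indicator {X. X (Suc n) = X n + e}) X = \<omega> (X n) e"
      using Q e by (simp add: is_quenched_law_def)
    then have "AE X in Q. indicator (cylinder xs) X * real_cond_exp Q (history n) (indicator {X. X (Suc n) = X n + e}) X
        = indicator (cylinder xs) X * \<omega> (last xs) e"
      by eventually_elim (auto simp: indicator_def Xn)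
    moreover have "real_cond_exp Q (history n) (indicator {X. X (Suc n) = X n + e}) \<in> borel_measurable Q"
      by (rule borel_measurable_cond_exp2)
    ultimately show ?thesis
      unfolding set_lebesgue_integral_def real_scaleR_def by (intro integral_cong_AE) measurable
  qed
  also have "\<dots> = measure Q (cylinder xs) * \<omega> (last xs) e" by (simp add: spQ)
  finally show ?thesis .
qed

lemma measure_quenched_cylinder:
  assumes \<omega>: "\<omega> \<in> space env_space" and Q: "is_quenched_law \<omega> z Q"
  shows "measure Q (cylinder xs) = path_weight \<omega> z xs"
proof (induction xs rule: rev_induct)
  interpret Q: prob_space Q using Q by (simp add: is_quenched_law_def)
  have sQ: "sets Q = sets path_space" using Q by (simp add: is_quenched_law_def)
  have spQ: "space Q = UNIV" using sets_eq_imp_space_eq[OF sQ] by simp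
  have cQ [simp]: "cylinder xs \<in> sets Q" for xs by (simp add: sQ)
  have Ux: "(\<Union>e\<in>A. cylinder (xs @ [last xs + e])) \<in> sets Q" if "finite A" for A xs
    using that by (intro sets.finite_UN cQ) auto
  {
    case Nil
    show ?case using Q.prob_space by (simp add: cylinder_def path_weight_def spQ)
  next
    case (snoc y xs)
    show ?case
    proof (cases "xs = []")
      case True
      have 1: "measure Q (cylinder [z]) = 1" using Q by (simp add: is_quenched_law_def cylinder_def)
      have "measure Q (cylinder [y]) = 0" if "y \<noteq> z"
      proof -
        have "measure Q (cylinder [y]) + measure Q (cylinder [z]) = measure Q (cylinder [y] \<union> cylinder [z])"
          using that by (intro Q.finite_measure_Union[symmetric] cQ) (auto simp: cylinder_def)
        also have "\<dots> \<le> 1" by (rule Q.prob_le_1)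
        finally show ?thesis using 1 measure_nonneg[of Q "cylinder [y]"] by linarith
      qed
      with 1 True show ?thesis by (auto simp: path_weight_def)
    next
      case False
      have "measure Q (cylinder (xs @ [y])) = measure Q (cylinder xs) * transition \<omega> (last xs) y"
      proof (cases "y - last xs \<in> unit_steps")
        case True
        from quenched_law_step[OF \<omega> Q False True] True show ?thesis
          by (simp add: transition_def)
      next
        case not_unit: False
        let ?U = "\<Union>e\<in>unit_steps. cylinder (xs @ [last xs + e])"
        have "measure Q ?U = (\<Sum>e\<in>unit_steps. measure Q (cylinder (xs @ [last xs + e])))"
          proof (rule Q.finite_measure_finite_Union)
          show "disjoint_family_on (\<lambda>e. cylinder (xs @ [last xs + e])) unit_steps"
            by (auto simp: disjoint_family_on_def cylinder_snoc)
        qed (use cQ in \<open>simp_all add: image_subset_iff\<close>)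
        also have "\<dots> = measure Q (cylinder xs)"
          by (simp add: quenched_law_step[OF \<omega> Q False] env_sum[OF \<omega>] flip: sum_distrib_left)
        finally have U: "measure Q ?U = measure Q (cylinder xs)" .
        have "measure Q (cylinder (xs @ [y])) + measure Q ?U = measure Q (cylinder (xs @ [y]) \<union> ?U)"
          using not_unit by (intro Q.finite_measure_Union[symmetric] cQ Ux) (auto simp: cylinder_snoc)
        also have "\<dots> \<le> measure Q (cylinder xs)"
          by (rule Q.finite_measure_mono) (auto simp: cylinder_snoc)
        finally show ?thesis
          using U not_unit measure_nonneg[of Q "cylinder (xs @ [y])"] by (simp add: transition_def)
      qed
      with snoc False show ?thesis by (simp add: path_weight_snoc)
    qed
  }
qed

lemma ex1_quenched_law:
  assumes \<omega>: "\<omega> \<in> space env_space"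
  shows "\<exists>!Q. is_quenched_law \<omega> z Q"
proof (rule ex_ex1I[OF ex_quenched_law[OF \<omega>]])
  fix Q Q' assume Q: "is_quenched_law \<omega> z Q" and Q': "is_quenched_law \<omega> z Q'"
  interpret Q: prob_space Q using Q by (simp add: is_quenched_law_def)
  interpret Q': prob_space Q' using Q' by (simp add: is_quenched_law_def)
  show "Q = Q'"
  proof (rule measure_eqI_generator_eq[OF Int_stable_cylinders, where \<Omega>=UNIV and A="\<lambda>_. cylinder []"])
    fix A assume "A \<in> insert {} (range cylinder)"
    then show "emeasure Q A = emeasure Q' A"
      by (auto simp: Q.emeasure_eq_measure Q'.emeasure_eq_measure
          measure_quenched_cylinder[OF \<omega> Q] measure_quenched_cylinder[OF \<omega> Q'])
  next
    show "sets Q = sigma_sets UNIV (insert {} (range cylinder))"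
      "sets Q' = sigma_sets UNIV (insert {} (range cylinder))"
      using Q Q' by (simp_all add: is_quenched_law_def sets_path_space)
    show "(\<Union>i::nat. cylinder []) = UNIV" by (simp add: cylinder_def)
  qed auto
qed

lemma quenched_law: "\<omega> \<in> space env_space \<Longrightarrow> is_quenched_law \<omega> z (quenched_law \<omega> z)"
  unfolding quenched_law_def by (rule theI'[OF ex1_quenched_law])

lemma measurable_env_entry:
  "e \<in> unit_steps \<Longrightarrow> (\<lambda>\<omega>. \<omega> x e) \<in> borel_measurable env_space"
proof -
  assume e: "e \<in> unit_steps"
  have "(\<lambda>\<omega>. \<omega> x) \<in> measurable env_space prob_vec_space" unfolding env_space_def by measurable
  moreover have "(\<lambda>p. p e) \<in> borel_measurable prob_vec_space"
    unfolding prob_vec_space_def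
    by (intro measurable_restrict_space1 measurable_component_singleton e)
  ultimately show ?thesis by (rule measurable_compose)
qed

lemma measurable_quenched_law [measurable]:
  "(\<lambda>\<omega>. quenched_law \<omega> z) \<in> measurable env_space (prob_algebra path_space)"
proof (rule measurable_prob_algebra_generated[OF _ Int_stable_cylinders, where \<Omega>=UNIV])
  show "sets path_space = sigma_sets UNIV (insert {} (range cylinder))" by (rule sets_path_space)
  fix \<omega> assume \<omega>: "\<omega> \<in> space env_space"
  show "prob_space (quenched_law \<omega> z)" "sets (quenched_law \<omega> z) = sets path_space"
    using quenched_law[OF \<omega>, of z] by (simp_all add: is_quenched_law_def)
next
  fix A assume A: "A \<in> insert {} (range cylinder)"
  show "(\<lambda>\<omega>. emeasure (quenched_law \<omega> z) A) \<in> borel_measurable env_space"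
  proof (cases "A = {}")
    case False
    then obtain xs where xs: "A = cylinder xs" using A by auto
    have "(\<lambda>\<omega>. transition \<omega> x y) \<in> borel_measurable env_space" for x y
      by (cases "y - x \<in> unit_steps") (simp_all add: transition_def measurable_env_entry)
    then have "(\<lambda>\<omega>. ennreal (path_weight \<omega> z xs)) \<in> borel_measurable env_space"
      unfolding path_weight_def by (intro measurable_compose[OF _ measurable_ennreal] borel_measurable_prod) simp
    moreover have "emeasure (quenched_law \<omega> z) A = ennreal (path_weight \<omega> z xs)"
      if "\<omega> \<in> space env_space" for \<omega>
    proof -
      interpret prob_space "quenched_law \<omega> z"
        using quenched_law[OF that, of z] by (simp add: is_quenched_law_def)
      show ?thesis
        by (simp add: xs emeasure_eq_measure measure_quenched_cylinder[OF that quenched_law[OF that]])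
    qed
    ultimately show ?thesis by (simp cong: measurable_cong)
  qed simp
qed simp

lemma emeasure_annealed_law:
  assumes P: "prob_space P" "sets P = sets env_space"
    and A: "A \<in> sets (env_space \<Otimes>\<^sub>M path_space)"
  shows "emeasure (annealed_law P z) A =
    (\<integral>\<^sup>+\<omega>. emeasure (quenched_law \<omega> z) {X. (\<omega>, X) \<in> A} \<partial>P)"
proof -
  let ?K = "\<lambda>\<omega>. distr (quenched_law \<omega> z) (env_space \<Otimes>\<^sub>M path_space) (\<lambda>X. (\<omega>, X))"
  have spP: "space P = space env_space" using sets_eq_imp_space_eq[OF P(2)] .
  have "?K \<in> measurable env_space (subprob_algebra (env_space \<Otimes>\<^sub>M path_space))"
    by (rule measurable_distr2[OF _ measurable_prob_algebraD[OF measurable_quenched_law]]) simp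
  then have K: "?K \<in> measurable P (subprob_algebra (env_space \<Otimes>\<^sub>M path_space))"
    by (simp add: measurable_cong_sets[OF P(2) refl])
  have "emeasure (annealed_law P z) A = (\<integral>\<^sup>+\<omega>. emeasure (?K \<omega>) A \<partial>P)"
    unfolding annealed_law_def by (rule emeasure_bind[OF prob_space.not_empty[OF P(1)] K A])
  also have "\<dots> = (\<integral>\<^sup>+\<omega>. emeasure (quenched_law \<omega> z) {X. (\<omega>, X) \<in> A} \<partial>P)"
  proof (rule nn_integral_cong)
    fix \<omega> assume "\<omega> \<in> space P"
    then have \<omega>: "\<omega> \<in> space env_space" by (simp add: spP)
    then have sQ: "sets (quenched_law \<omega> z) = sets path_space"
      using quenched_law[OF \<omega>, of z] by (simp add: is_quenched_law_def)
    have "(\<lambda>X. (\<omega>, X)) \<in> measurable (quenched_law \<omega> z) (env_space \<Otimes>\<^sub>M path_space)"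
      using \<omega> by (simp add: measurable_cong_sets[OF sQ refl])
    then show "emeasure (?K \<omega>) A = emeasure (quenched_law \<omega> z) {X. (\<omega>, X) \<in> A}"
      using A sets_eq_imp_space_eq[OF sQ] by (simp add: emeasure_distr vimage_def)
  qed
  finally show ?thesis .
qed

lemma prob_space_annealed_law:
  assumes P: "prob_space P" "sets P = sets env_space"
  shows "prob_space (annealed_law P z)"
proof -
  have "(\<lambda>\<omega>. distr (quenched_law \<omega> z) (env_space \<Otimes>\<^sub>M path_space) (\<lambda>X. (\<omega>, X)))
      \<in> measurable env_space (subprob_algebra (env_space \<Otimes>\<^sub>M path_space))"
    by (rule measurable_distr2[OF _ measurable_prob_algebraD[OF measurable_quenched_law]]) simp
  then have K: "(\<lambda>\<omega>. distr (quenched_law \<omega> z) (env_space \<Otimes>\<^sub>M path_space) (\<lambda>X. (\<omega>, X)))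
      \<in> measurable P (subprob_algebra (env_space \<Otimes>\<^sub>M path_space))"
    by (simp add: measurable_cong_sets[OF P(2) refl])
  show ?thesis
    unfolding annealed_law_def
  proof (rule prob_space.prob_space_bind[OF P(1) _ K], rule AE_I2)
    fix \<omega> assume "\<omega> \<in> space P"
    then have \<omega>: "\<omega> \<in> space env_space" using sets_eq_imp_space_eq[OF P(2)] by simp
    have sQ: "sets (quenched_law \<omega> z) = sets path_space" and pQ: "prob_space (quenched_law \<omega> z)"
      using quenched_law[OF \<omega>, of z] by (simp_all add: is_quenched_law_def)
    show "prob_space (distr (quenched_law \<omega> z) (env_space \<Otimes>\<^sub>M path_space) (\<lambda>X. (\<omega>, X)))"
      using \<omega> by (intro prob_space.prob_space_distr[OF pQ]) (simp add: measurable_cong_sets[OF sQ refl])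
  qed
qed

lemma transience_event_measurable [measurable]:
  "transience_event l \<in> sets (env_space \<Otimes>\<^sub>M path_space)"
proof -
  let ?S = "env_space \<Otimes>\<^sub>M path_space"
  have [measurable]: "(\<lambda>p. lattice_vec (snd p n) \<bullet> l) \<in> borel_measurable ?S" for n
    by (rule measurable_compose[OF measurable_compose[OF measurable_snd measurable_path_component]]) simp
  have eq: "filterlim f at_top sequentially \<longleftrightarrow> (\<forall>k. \<exists>N. \<forall>n\<ge>N. real k \<le> f n)" for f :: "nat \<Rightarrow> real"
  proof
    assume "filterlim f at_top sequentially"
    then show "\<forall>k. \<exists>N. \<forall>n\<ge>N. real k \<le> f n"
      by (simp add: filterlim_at_top eventually_sequentially)
  next
    assume *: "\<forall>k. \<exists>N. \<forall>n\<ge>N. real k \<le> f n"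
    show "filterlim f at_top sequentially"
      unfolding filterlim_at_top eventually_sequentially
    proof
      fix c :: real
      obtain k :: nat where "c \<le> real k" using real_arch_simple by blast
      with * show "\<exists>N. \<forall>n\<ge>N. c \<le> f n" by (meson order_trans)
    qed
  qed
  have "transience_event l =
      {p \<in> space ?S. \<forall>k. \<exists>N. \<forall>n\<ge>N. real k \<le> lattice_vec (snd p n) \<bullet> l}"
    by (auto simp: transience_event_def eq space_pair_measure)
  also have "\<dots> \<in> sets ?S"
    by measurable
  finally show ?thesis .
qed

end

theory Submission
  imports Defs
begin

text \<open>
  Dividing \<open>x \<bullet> l\<close> by the larger modulus of the two coordinates of \<open>l\<close> gives a height \<open>v\<close> that every
  step changes by at most one and that one particular step \<open>e\<close> raises by exactly one. The walk escapes if
  \<open>v (X n) \<longlonglongrightarrow> \<infinity>\<close>. Two facts make the annealed probability of escaping zero or one.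

  A walk that escapes with positive probability almost surely escapes upwards or downwards
  (\<open>AE_escapes_or_escapes_back\<close>). Whenever it visits a set of sites infinitely often, it also visits
  every translate of this set by a unit step infinitely often: either it returns to one site for ever, and
  ellipticity acts in the fixed environment, or it finds infinitely many fresh sites, whose environments are
  independent of the past. Hence either every level of the height is visited finitely often, and the walk
  escapes in one of the two directions, or every level is visited infinitely often. The second alternative is
  excluded because at every record height the walk sees a fresh half-plane ahead, in which it has a fixed
  positive probability of never coming back down.

  The walk cannot escape with positive probability in both directions (\<open>not_both_directions\<close>). Suppose that
  it does, and let \<open>c\<^sub>1\<close> and \<open>c\<^sub>2\<close> be the positive probabilities of escaping upwards while staying above the
  start, and downwards while staying below it. Run two walks in the same environment, conditionally
  independent, one from the origin and one from a remote site \<open>z\<close> far above. The environments around the two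
  starting points are nearly independent, so the first walk escapes upwards and the second downwards, in this
  sense, with probability close to \<open>c\<^sub>1 * c\<^sub>2\<close> (\<open>distant_walks_decouple\<close>). The two paths hardly ever meet:
  along a walk that escapes, the quenched probability of escaping tends to one, and a meeting point is far
  from one of the two starting points, so that the other walk would do something very unlikely there
  (\<open>quenched_two_walks_bound\<close>). But walks that do not meet use disjoint parts of the environment, so they may
  as well live in independent environments (\<open>non_crossing_pairs_bound\<close>). The site \<open>z\<close> is a median, on its
  level, of the place where the first walk reaches this level. In the plane, two paths that do not meet have
  to pass each other on matching sides (\<open>disjoint_crossings_dichotomy\<close>), and by the choice of \<open>z\<close> this has
  probability at most about \<open>c\<^sub>1 * c\<^sub>2 / 2\<close>. The inequality \<open>c\<^sub>1 * c\<^sub>2 \<le> c\<^sub>1 * c\<^sub>2 / 2\<close> is the contradiction.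

  The almost sure statements on paths all rest on \<open>recurrent_trials\<close>, which plays the part of the zero-one law
  of Levy: an event that exposes itself infinitely often to a fixed chance of being ruled out has
  probability zero.
\<close>

section \<open>Events on path space\<close>

type_synonym site = "int \<times> int"
type_synonym path = "nat \<Rightarrow> site"
type_synonym environment = "site \<Rightarrow> site \<Rightarrow> real"

lemma path_pred_event: "Measurable.pred path_space R \<Longrightarrow> {X. R X} \<in> sets path_space"
  by (simp add: pred_def)

definition path_prefix :: "nat \<Rightarrow> path \<Rightarrow> site list" where
  "path_prefix n X = map X [0..<n]"

lemma length_path_prefix [simp]: "length (path_prefix n X) = n"
  by (simp add: path_prefix_def)

lemma nth_path_prefix [simp]: "i < n \<Longrightarrow> path_prefix n X ! i = X i"
  by (simp add: path_prefix_def)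

lemma take_path_prefix: "m \<le> n \<Longrightarrow> take m (path_prefix n X) = path_prefix m X"
  by (simp add: path_prefix_def take_map min_def)

lemma path_prefix_Suc: "path_prefix (Suc n) X = path_prefix n X @ [X n]"
  by (simp add: path_prefix_def)

lemma set_path_prefix: "set (path_prefix n X) = X ` {..<n}"
  by (auto simp: path_prefix_def)

lemma mem_cylinder_iff: "X \<in> cylinder xs \<longleftrightarrow> path_prefix (length xs) X = xs"
  by (auto simp: cylinder_def list_eq_iff_nth_eq)

lemma mem_cylinder_path_prefix [simp]: "X \<in> cylinder (path_prefix n X)"
  by (simp add: mem_cylinder_iff)

lemma cylinder_eqD: "X \<in> cylinder xs \<Longrightarrow> i < length xs \<Longrightarrow> X i = xs ! i"
  by (simp add: cylinder_def)

lemma path_prefix_event_measurable [measurable]: "{X. path_prefix n X \<in> B} \<in> sets path_space"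
proof -
  have "{X. path_prefix n X \<in> B} = (\<Union>xs\<in>{xs\<in>B. length xs = n}. cylinder xs)"
    by (auto simp: mem_cylinder_iff)
  then show ?thesis
    by (simp add: sets.countable_UN'' )
qed

text \<open>
  A stopping time, encoded by the finite paths at which it stops: their cylinders are disjoint.
\<close>

definition first_times :: "nat \<Rightarrow> (site list \<Rightarrow> bool) \<Rightarrow> site list set" where
  "first_times N \<phi> = {\<pi>. N \<le> length \<pi> \<and> \<phi> \<pi> \<and> (\<forall>m. N \<le> m \<longrightarrow> m < length \<pi> \<longrightarrow> \<not> \<phi> (take m \<pi>))}"

lemma disjoint_first_times: "disjoint_family_on cylinder (first_times N \<phi>)"
proof -
  have *: "\<pi> = \<rho>" if "\<pi> \<in> first_times N \<phi>" "\<rho> \<in> first_times N \<phi>" "length \<pi> \<le> length \<rho>"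
    "X \<in> cylinder \<pi>" "X \<in> cylinder \<rho>" for \<pi> \<rho> X
  proof -
    have 1: "path_prefix (length \<pi>) X = \<pi>" and 2: "path_prefix (length \<rho>) X = \<rho>"
      using that(4,5) by (simp_all only: mem_cylinder_iff)
    have "take (length \<pi>) \<rho> = \<pi>"
      using take_path_prefix[OF that(3), of X] unfolding 1 2 .
    moreover have "N \<le> length \<pi>" "\<phi> \<pi>" using that(1) by (simp_all add: first_times_def)
    moreover have "\<not> \<phi> (take m \<rho>)" if "N \<le> m" "m < length \<rho>" for m
      using \<open>\<rho> \<in> first_times N \<phi>\<close> that by (simp add: first_times_def)
    ultimately have "\<not> length \<pi> < length \<rho>" by metis
    with \<open>take (length \<pi>) \<rho> = \<pi>\<close> that(3) show ?thesis by simp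
  qed
  show ?thesis
    unfolding disjoint_family_on_def using * by (metis disjoint_iff linorder_le_cases)
qed

lemma first_times_cover:
  assumes "\<exists>n\<ge>N. \<phi> (path_prefix n X)"
  shows "\<exists>\<pi>\<in>first_times N \<phi>. X \<in> cylinder \<pi>"
proof -
  let ?n = "LEAST n. N \<le> n \<and> \<phi> (path_prefix n X)"
  have "N \<le> ?n \<and> \<phi> (path_prefix ?n X)" by (rule LeastI_ex) (rule assms)
  moreover have "\<not> \<phi> (take m (path_prefix ?n X))" if "N \<le> m" "m < ?n" for m
  proof -
    have "take m (path_prefix ?n X) = path_prefix m X" using that(2) by (intro take_path_prefix) simp
    then show ?thesis using not_less_Least[OF that(2)] that(1) by simp
  qed
  ultimately show ?thesis
    by (intro bexI[of _ "path_prefix ?n X"]) (auto simp: first_times_def)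
qed

locale path_measure = prob_space Q for Q :: "path measure" +
  assumes sets_Q [measurable_cong]: "sets Q = sets path_space"
begin

lemma space_Q [simp]: "space Q = UNIV"
  using sets_eq_imp_space_eq[OF sets_Q] by simp

definition approximable :: "path set \<Rightarrow> bool" where
  "approximable A \<longleftrightarrow> A \<in> sets Q \<and>
     (\<forall>\<epsilon>>0. \<exists>n B. measure Q (sym_diff A {X. path_prefix n X \<in> B}) < \<epsilon>)"

lemma prefix_event_in_sets [simp]: "{X. path_prefix n X \<in> B} \<in> sets Q"
  by (simp add: sets_Q)

lemma approximable_Un:
  assumes A: "approximable A" and B: "approximable B"
  shows "approximable (A \<union> B)"
  unfolding approximable_def
proof (intro conjI allI impI)
  have [measurable, simp]: "A \<in> sets Q" "B \<in> sets Q" using A B by (auto simp: approximable_def)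
  show "A \<union> B \<in> sets Q" by simp
  fix \<epsilon> :: real assume "\<epsilon> > 0"
  then obtain n C m D
    where C: "measure Q (sym_diff A {X. path_prefix n X \<in> C}) < \<epsilon>/2"
      and D: "measure Q (sym_diff B {X. path_prefix m X \<in> D}) < \<epsilon>/2"
    using A B half_gt_zero unfolding approximable_def by metis
  let ?A = "{X. path_prefix n X \<in> C}" and ?B = "{X. path_prefix m X \<in> D}"
  let ?E = "{X. path_prefix (max n m) X \<in> {xs. take n xs \<in> C \<or> take m xs \<in> D}}"
  have E: "?E = ?A \<union> ?B" by (auto simp: take_path_prefix)
  have "measure Q (sym_diff (A \<union> B) ?E) \<le> measure Q (sym_diff A ?A \<union> sym_diff B ?B)"
    unfolding E by (intro finite_measure_mono) auto
  also have "\<dots> \<le> measure Q (sym_diff A ?A) + measure Q (sym_diff B ?B)"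
    by (intro measure_Un_le) auto
  also have "\<dots> < \<epsilon>" using C D by simp
  finally show "\<exists>n F. measure Q (sym_diff (A \<union> B) {X. path_prefix n X \<in> F}) < \<epsilon>" by blast
qed

lemma approximable_prefix_event: "approximable {X. path_prefix n X \<in> B}"
  unfolding approximable_def
proof (intro conjI allI impI)
  fix \<epsilon> :: real assume "\<epsilon> > 0"
  then have "measure Q (sym_diff {X. path_prefix n X \<in> B} {X. path_prefix n X \<in> B}) < \<epsilon>" by simp
  then show "\<exists>m C. measure Q (sym_diff {X. path_prefix n X \<in> B} {X. path_prefix m X \<in> C}) < \<epsilon>" by blast
qed simp

text \<open>
  The approximable events are closed under complements and finite unions, and countable unions are limits of
  finite ones; since they contain the cylinders, they are all events.
\<close>

lemma event_approximable:
  assumes "A \<in> sets Q"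
  shows "approximable A"
proof -
  have "A \<in> sigma_sets UNIV (insert {} (range cylinder))"
    using assms by (simp add: sets_Q sets_path_space)
  then show ?thesis
  proof induction
    case (Basic a)
    have "approximable {}" using approximable_prefix_event[of 0 "{}"] by simp
    moreover have "approximable (cylinder xs)" for xs
    proof -
      have "cylinder xs = {X. path_prefix (length xs) X \<in> {xs}}"
        by (auto simp: mem_cylinder_iff)
      then show ?thesis by (simp only: approximable_prefix_event)
    qed
    ultimately show ?case using Basic by auto
  next
    case Empty
    show ?case using approximable_prefix_event[of 0 "{}"] by simp
  next
    case (Compl A)
    show ?case unfolding approximable_def
    proof (intro conjI allI impI)
      have [simp]: "A \<in> sets Q" using Compl by (simp add: approximable_def)
      show "UNIV - A \<in> sets Q" using sets.compl_sets[of A Q] by simp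
      fix \<epsilon> :: real assume "\<epsilon> > 0"
      then obtain n C where C: "measure Q (sym_diff A {X. path_prefix n X \<in> C}) < \<epsilon>"
        using Compl unfolding approximable_def by blast
      have "sym_diff (UNIV - A) {X. path_prefix n X \<in> - C} = sym_diff A {X. path_prefix n X \<in> C}" by auto
      with C show "\<exists>n F. measure Q (sym_diff (UNIV - A) {X. path_prefix n X \<in> F}) < \<epsilon>" by metis
    qed
  next
    case (Union a)
    have a [simp]: "a i \<in> sets Q" for i using Union by (simp add: approximable_def)
    have fin: "approximable (\<Union>i<N. a i)" for N
    proof (induction N)
      case 0
      show ?case using approximable_prefix_event[of 0 "{}"] by simp
    next
      case (Suc N)
      then show ?case using approximable_Un[OF Union.IH[of N] Suc] by (simp add: lessThan_Suc)
    qed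
    show ?case unfolding approximable_def
    proof (intro conjI allI impI)
      show "(\<Union>i. a i) \<in> sets Q" by auto
      fix \<epsilon> :: real assume eps: "\<epsilon> > 0"
      have "(\<lambda>N. measure Q (\<Union>i<N. a i)) \<longlonglongrightarrow> measure Q (\<Union>N. \<Union>i<N. a i)"
        by (intro finite_Lim_measure_incseq monoI UN_mono) (auto intro!: sets.finite_UN)
      also have "(\<Union>N. \<Union>i<N. a i) = (\<Union>i. a i)" by auto
      finally have "\<forall>\<^sub>F N in sequentially. measure Q (\<Union>i. a i) - \<epsilon>/2 < measure Q (\<Union>i<N. a i)"
        using eps by (intro order_tendstoD(1)) auto
      then obtain N where N: "measure Q (\<Union>i. a i) - \<epsilon>/2 < measure Q (\<Union>i<N. a i)"
        by (auto simp: eventually_sequentially)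
      let ?F = "\<Union>i<N. a i" and ?U = "\<Union>i. a i"
      have F: "?F \<in> sets Q" "?U \<in> sets Q" by (intro sets.finite_UN, auto)
      have "?F \<subseteq> ?U" by auto
      from finite_measure_Diff[OF F(2,1) this] N have rest: "measure Q (?U - ?F) < \<epsilon>/2"
        by linarith
      obtain n C where C: "measure Q (sym_diff ?F {X. path_prefix n X \<in> C}) < \<epsilon>/2"
        using fin[of N] eps half_gt_zero unfolding approximable_def by metis
      let ?C = "{X. path_prefix n X \<in> C}"
      have "measure Q (sym_diff ?U ?C) \<le> measure Q ((?U - ?F) \<union> sym_diff ?F ?C)"
        using F by (intro finite_measure_mono) auto
      also have "\<dots> \<le> measure Q (?U - ?F) + measure Q (sym_diff ?F ?C)"
        using F by (intro measure_Un_le) auto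
      also have "\<dots> < \<epsilon>" using rest C by simp
      finally show "\<exists>n F. measure Q (sym_diff ?U {X. path_prefix n X \<in> F}) < \<epsilon>" by blast
    qed
  qed
qed

lemma obtain_prefix_approximation:
  assumes "A \<in> sets Q" "\<epsilon> > 0"
  obtains n B where "measure Q (sym_diff A {X. path_prefix n X \<in> B}) < \<epsilon>"
  using event_approximable[OF assms(1)] assms(2) unfolding approximable_def by blast

lemma emeasure_UN_cylinders:
  assumes disj: "disjoint_family_on cylinder T" and H: "\<And>\<pi>. \<pi> \<in> T \<Longrightarrow> H \<pi> \<in> sets Q"
  shows "emeasure Q (\<Union>\<pi>\<in>T. cylinder \<pi> \<inter> H \<pi>) = (\<integral>\<^sup>+\<pi>. emeasure Q (cylinder \<pi> \<inter> H \<pi>) \<partial>count_space T)"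
  by (rule emeasure_UN_countable)
     (use disj H in \<open>auto simp: sets_Q disjoint_family_on_def\<close>)

text \<open>
  Each finite path satisfying \<open>\<phi>\<close> announces a trial, which succeeds (\<open>H\<close>) with conditional probability at
  least \<open>\<kappa>\<close>; on \<open>A\<close> there are infinitely many trials, and those after time \<open>N\<^sub>0\<close> all fail. Approximate \<open>A\<close> by an
  event decided at a time \<open>n\<close> and wait for the first trial after \<open>n\<close>. Its success has at least \<open>\<kappa>\<close> times the
  probability of the approximating event, but happens outside \<open>A\<close>, so it is covered by the error of the
  approximation.
\<close>

lemma recurrent_trials:
  assumes A: "A \<in> sets Q"
    and often: "\<And>X N. X \<in> A \<Longrightarrow> \<exists>n\<ge>N. \<phi> (path_prefix n X)"
    and H: "\<And>\<pi>. \<phi> \<pi> \<Longrightarrow> H \<pi> \<in> sets Q"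
    and \<kappa>: "\<kappa> > 0" "\<And>\<pi>. \<phi> \<pi> \<Longrightarrow> N\<^sub>0 \<le> length \<pi> \<Longrightarrow> \<kappa> * measure Q (cylinder \<pi>) \<le> measure Q (cylinder \<pi> \<inter> H \<pi>)"
    and avoid: "\<And>X \<pi>. X \<in> A \<Longrightarrow> \<phi> \<pi> \<Longrightarrow> N\<^sub>0 \<le> length \<pi> \<Longrightarrow> X \<in> cylinder \<pi> \<Longrightarrow> X \<notin> H \<pi>"
  shows "measure Q A = 0"
proof -
  have "measure Q A \<le> \<delta> / \<kappa> + \<delta>" if \<delta>: "\<delta> > 0" for \<delta>
  proof -
    obtain n B where B: "measure Q (sym_diff A {X. path_prefix n X \<in> B}) < \<delta>"
      using obtain_prefix_approximation[OF A \<delta>] by blast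
    let ?B = "{X. path_prefix n X \<in> B}"
    define N where "N = max n N\<^sub>0"
    define T where "T = {\<pi> \<in> first_times N \<phi>. take n \<pi> \<in> B}"
    have T: "\<phi> \<pi>" "N \<le> length \<pi>" "N\<^sub>0 \<le> length \<pi>" if "\<pi> \<in> T" for \<pi>
      using that by (auto simp: T_def first_times_def N_def)
    have disj: "disjoint_family_on cylinder T"
      by (rule disjoint_family_on_mono[OF _ disjoint_first_times[of N \<phi>]]) (auto simp: T_def)
    let ?U = "\<Union>\<pi>\<in>T. cylinder \<pi> \<inter> UNIV" and ?V = "\<Union>\<pi>\<in>T. cylinder \<pi> \<inter> H \<pi>"
    have cyl: "cylinder \<pi> \<in> sets Q" for \<pi> by (simp add: sets_Q)
    have U: "?U \<in> sets Q" by (rule sets.countable_UN'') (auto simp: cyl)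
    have V: "?V \<in> sets Q" by (rule sets.countable_UN'') (auto simp: cyl H T)
    have in_B: "X \<in> ?B" if "\<pi> \<in> T" "X \<in> cylinder \<pi>" for X \<pi>
      using that take_path_prefix[of n "length \<pi>" X] T(2)[OF that(1)]
      by (auto simp: T_def mem_cylinder_iff N_def)
    have "ennreal \<kappa> * emeasure Q ?U = (\<integral>\<^sup>+\<pi>. ennreal \<kappa> * emeasure Q (cylinder \<pi> \<inter> UNIV) \<partial>count_space T)"
      by (subst emeasure_UN_cylinders[OF disj]) (auto simp: nn_integral_cmult sets.top[of Q, simplified])
    also have "\<dots> \<le> (\<integral>\<^sup>+\<pi>. emeasure Q (cylinder \<pi> \<inter> H \<pi>) \<partial>count_space T)"
      using \<kappa> T by (intro nn_integral_mono) (simp add: emeasure_eq_measure flip: ennreal_mult)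
    also have "\<dots> = emeasure Q ?V"
      by (rule emeasure_UN_cylinders[OF disj, symmetric]) (auto simp: H T)
    \<comment> \<open>summing over the disjoint cylinders at which the first trial takes place\<close>
    finally have UV: "\<kappa> * measure Q ?U \<le> measure Q ?V"
      using \<kappa>(1) by (simp add: emeasure_eq_measure flip: ennreal_mult)
    have "measure Q ?V \<le> measure Q (sym_diff A ?B)"
      using in_B avoid T A by (intro finite_measure_mono) auto
    with B UV have "\<kappa> * measure Q ?U < \<delta>" by simp
    then have 1: "measure Q ?U \<le> \<delta> / \<kappa>" using \<kappa>(1) by (simp add: field_simps)
    have "A \<subseteq> ?U \<union> sym_diff A ?B"
    proof
      fix X assume X: "X \<in> A"
      show "X \<in> ?U \<union> sym_diff A ?B"
      proof (cases "X \<in> ?B")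
        case True
        obtain \<pi> where \<pi>: "\<pi> \<in> first_times N \<phi>" "X \<in> cylinder \<pi>"
          using first_times_cover[of N \<phi> X] often[OF X] by blast
        then have "N \<le> length \<pi>" by (simp add: first_times_def)
        then have "take n \<pi> = path_prefix n X"
          using \<pi>(2) take_path_prefix[of n "length \<pi>" X] by (simp add: mem_cylinder_iff N_def)
        with True \<pi> show ?thesis by (auto simp: T_def)
      qed (use X in auto)
    qed
    then have "measure Q A \<le> measure Q (?U \<union> sym_diff A ?B)"
      using U A by (intro finite_measure_mono) auto
    also have "\<dots> \<le> measure Q ?U + measure Q (sym_diff A ?B)"
      using U A by (intro measure_Un_le) auto
    finally show ?thesis using 1 B by simp
  qed
  then have *: "measure Q A \<le> \<delta> * (1 / \<kappa> + 1)" if "\<delta> > 0" for \<delta>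
    using that by (simp add: algebra_simps)
  have pos: "1 / \<kappa> + 1 > 0" using \<kappa>(1) by (simp add: add_pos_pos)
  have "measure Q A \<le> 0"
  proof (rule field_le_epsilon)
    fix \<epsilon> :: real assume "\<epsilon> > 0"
    with pos have "measure Q A \<le> \<epsilon> / (1 / \<kappa> + 1) * (1 / \<kappa> + 1)" by (intro *) simp
    also have "\<dots> = \<epsilon>" using pos by simp
    finally show "measure Q A \<le> 0 + \<epsilon>" by simp
  qed
  then show ?thesis by (simp add: measure_le_0_iff)
qed

end

section \<open>Path weights and the Markov property of the quenched walk\<close>

lemma path_measure_eqI:
  assumes "path_measure Q" "path_measure Q'"
    and eq: "\<And>xs. measure Q (cylinder xs) = measure Q' (cylinder xs)"
  shows "Q = Q'"
proof -
  interpret Q: path_measure Q by fact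
  interpret Q': path_measure Q' by fact
  show ?thesis
  proof (rule measure_eqI_generator_eq[OF Int_stable_cylinders, where \<Omega>=UNIV and A="\<lambda>_. cylinder []"])
    fix A assume "A \<in> insert {} (range cylinder)"
    then show "emeasure Q A = emeasure Q' A"
      by (auto simp: Q.emeasure_eq_measure Q'.emeasure_eq_measure eq)
  next
    show "sets Q = sigma_sets UNIV (insert {} (range cylinder))"
      "sets Q' = sigma_sets UNIV (insert {} (range cylinder))"
      by (simp_all add: Q.sets_Q Q'.sets_Q sets_path_space)
    show "(\<Union>i::nat. cylinder []) = UNIV" by (simp add: cylinder_def)
  qed (auto simp: Q.emeasure_eq_measure)
qed

context path_measure begin

lemma AE_path_prefix_notin:
  assumes "\<And>\<pi>. \<pi> \<in> B \<Longrightarrow> length \<pi> = n \<Longrightarrow> measure Q (cylinder \<pi>) = 0"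
  shows "AE X in Q. path_prefix n X \<notin> B"
proof -
  have "AE X in Q. \<forall>\<pi>\<in>{\<pi>\<in>B. length \<pi> = n}. X \<notin> cylinder \<pi>"
  proof (subst AE_ball_countable)
    show "\<forall>\<pi>\<in>{\<pi>\<in>B. length \<pi> = n}. AE X in Q. X \<notin> cylinder \<pi>"
      using assms by (auto intro!: AE_not_in null_setsI simp: emeasure_eq_measure sets_Q)
  qed simp
  then show ?thesis by eventually_elim auto
qed

end

text \<open>
  The probability of the steps of a path, without the constraint on its starting point that
  \<^const>\<open>path_weight\<close> contains. In this form it splits along concatenations.
\<close>

fun weight :: "environment \<Rightarrow> site list \<Rightarrow> real" where
  "weight \<omega> (x # y # xs) = transition \<omega> x y * weight \<omega> (y # xs)"
| "weight \<omega> _ = 1"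

lemma weight_append: "xs \<noteq> [] \<Longrightarrow> weight \<omega> (xs @ ys) = weight \<omega> xs * weight \<omega> (last xs # ys)"
  by (induction \<omega> xs rule: weight.induct) auto

lemma path_weight_eq: "xs \<noteq> [] \<Longrightarrow> path_weight \<omega> z xs = of_bool (hd xs = z) * weight \<omega> xs"
proof (induction xs rule: rev_induct)
  case (snoc y xs)
  show ?case
  proof (cases "xs = []")
    case True
    then show ?thesis by (simp add: path_weight_def)
  next
    case False
    then show ?thesis using snoc by (simp add: path_weight_snoc weight_append)
  qed
qed simp

lemma path_weight_Nil [simp]: "path_weight \<omega> z [] = 1"
  by (simp add: path_weight_def)

lemma transition_nonneg: "\<omega> \<in> space env_space \<Longrightarrow> 0 \<le> transition \<omega> x y"
  by (simp add: transition_def env_nonneg)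

lemma transition_le_1:
  assumes "\<omega> \<in> space env_space"
  shows "transition \<omega> x y \<le> 1"
proof (cases "y - x \<in> unit_steps")
  case True
  then have "\<omega> x (y - x) \<le> (\<Sum>e\<in>unit_steps. \<omega> x e)"
    using env_nonneg[OF assms] by (intro member_le_sum) auto
  then show ?thesis using True env_sum[OF assms] by (simp add: transition_def)
qed (simp add: transition_def)

lemma weight_nonneg: "\<omega> \<in> space env_space \<Longrightarrow> 0 \<le> weight \<omega> xs"
  by (induction \<omega> xs rule: weight.induct) (auto simp: transition_nonneg)

lemma weight_le_1: "\<omega> \<in> space env_space \<Longrightarrow> weight \<omega> xs \<le> 1"
  by (induction \<omega> xs rule: weight.induct) (auto simp: transition_le_1 weight_nonneg transition_nonneg intro!: mult_le_one)

lemma measurable_transition [measurable]: "(\<lambda>\<omega>. transition \<omega> x y) \<in> borel_measurable env_space"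
  by (cases "y - x \<in> unit_steps") (simp_all add: transition_def measurable_env_entry)

lemma measurable_weight [measurable]: "(\<lambda>\<omega>. weight \<omega> xs) \<in> borel_measurable env_space"
proof (induction xs)
  case (Cons x xs)
  then show ?case by (cases xs) simp_all
qed simp

lemma weight_cong:
  "(\<And>x. x \<in> set (butlast xs) \<Longrightarrow> \<omega> x = \<omega>' x) \<Longrightarrow> weight \<omega> xs = weight \<omega>' xs"
proof (induction \<omega> xs rule: weight.induct)
  case (1 \<omega> x y xs)
  then show ?case by (auto simp: transition_def)
qed auto

definition path_shift :: "nat \<Rightarrow> path \<Rightarrow> path" where
  "path_shift n X = (\<lambda>i. X (n + i))"

lemma path_shift_apply: "path_shift n X i = X (n + i)"
  by (simp add: path_shift_def)

lemma path_map_measurable: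
  assumes "\<And>i. (\<lambda>X. f X i) \<in> measurable path_space (count_space UNIV)"
  shows "f \<in> measurable path_space path_space"
  unfolding path_space_def using assms[unfolded path_space_def]
  by (intro measurable_PiM_single') (auto simp: space_PiM)

lemma path_shift_measurable [measurable]: "path_shift n \<in> measurable path_space path_space"
  by (rule path_map_measurable) (simp add: path_shift_apply)

lemma path_event_measurable:
  assumes "f \<in> measurable path_space path_space" "A \<in> sets path_space"
  shows "{X. f X \<in> A} \<in> sets path_space"
  using measurable_sets[OF assms] by (simp add: vimage_def)

lemma cylinder_append:
  assumes "xs \<noteq> []"
  shows "X \<in> cylinder (xs @ ys) \<longleftrightarrow> X \<in> cylinder xs \<and> path_shift (length xs - 1) X \<in> cylinder (last xs # ys)"
proof
  assume X: "X \<in> cylinder (xs @ ys)"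
  have nth: "X i = (xs @ ys) ! i" if "i < length xs + length ys" for i
    using X that by (simp add: cylinder_def)
  have "X i = xs ! i" if "i < length xs" for i
    using nth[of i] that by (simp add: nth_append)
  moreover have "X (length xs - 1 + i) = (last xs # ys) ! i" if "i < Suc (length ys)" for i
  proof (cases i)
    case 0
    have "length xs - 1 < length xs" using assms by simp
    with nth[OF trans_less_add1[OF this]] have "X (length xs - 1) = xs ! (length xs - 1)"
      by (simp only: nth_append if_True)
    with 0 show ?thesis using assms by (simp add: last_conv_nth)
  next
    case (Suc j)
    then have eq: "length xs - 1 + i = length xs + j" using assms by (cases xs) auto
    have "X (length xs + j) = ys ! j" using nth[of "length xs + j"] that Suc by (simp add: nth_append)
    then show ?thesis unfolding eq using Suc by simp
  qed
  ultimately show "X \<in> cylinder xs \<and> path_shift (length xs - 1) X \<in> cylinder (last xs # ys)"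
    by (simp add: cylinder_def path_shift_apply)
next
  assume X: "X \<in> cylinder xs \<and> path_shift (length xs - 1) X \<in> cylinder (last xs # ys)"
  show "X \<in> cylinder (xs @ ys)"
    unfolding cylinder_def
  proof (intro CollectI allI impI)
    fix i assume i: "i < length (xs @ ys)"
    show "X i = (xs @ ys) ! i"
    proof (cases "i < length xs")
      case True
      then show ?thesis using X by (simp add: nth_append cylinder_def)
    next
      case False
      then obtain j where j: "i = length xs + j" "j < length ys"
        using i by (metis add_less_cancel_left le_Suc_ex length_append not_less)
      have eq: "length xs - 1 + Suc j = length xs + j" using assms by (cases xs) auto
      have "path_shift (length xs - 1) X (Suc j) = (last xs # ys) ! Suc j"
        using cylinder_eqD[OF conjunct2[OF X], of "Suc j"] j(2) by simp
      then show ?thesis unfolding path_shift_apply eq using j by (simp add: nth_append)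
    qed
  qed
qed

abbreviation qprob :: "environment \<Rightarrow> site \<Rightarrow> path set \<Rightarrow> real" where
  "qprob \<omega> z A \<equiv> measure (quenched_law \<omega> z) A"

lemma quenched_path_measure: "\<omega> \<in> space env_space \<Longrightarrow> path_measure (quenched_law \<omega> z)"
  using quenched_law[of \<omega> z]
  by (simp add: is_quenched_law_def path_measure_def path_measure_axioms_def)

lemma measure_quenched_law_cylinder:
  "\<omega> \<in> space env_space \<Longrightarrow> qprob \<omega> z (cylinder xs) = path_weight \<omega> z xs"
  by (rule measure_quenched_cylinder[OF _ quenched_law])

text \<open>
  For cylinders \<open>A\<close> this is the multiplicativity of the weights; the general case follows by Dynkin's lemma.
\<close>

lemma quenched_Markov:
  assumes \<omega>: "\<omega> \<in> space env_space" and \<pi>: "\<pi> \<noteq> []" and A: "A \<in> sets path_space"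
  shows "qprob \<omega> z (cylinder \<pi> \<inter> {X. path_shift (length \<pi> - 1) X \<in> A}) =
    path_weight \<omega> z \<pi> * qprob \<omega> (last \<pi>) A"
proof -
  interpret Q: path_measure "quenched_law \<omega> z" by (rule quenched_path_measure[OF \<omega>])
  interpret Q': path_measure "quenched_law \<omega> (last \<pi>)" by (rule quenched_path_measure[OF \<omega>])
  let ?s = "\<lambda>A. {X. path_shift (length \<pi> - 1) X \<in> A}"
  have s [simp]: "cylinder \<pi> \<inter> ?s A \<in> sets (quenched_law \<omega> z)" if "A \<in> sets path_space" for A
    using path_event_measurable[OF path_shift_measurable that] by (simp add: Q.sets_Q)
  note cyl = measure_quenched_law_cylinder[OF \<omega>]
  have sA: "A \<in> sigma_sets UNIV (insert {} (range cylinder))" using A by (simp add: sets_path_space)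
  show ?thesis
  proof (rule sigma_sets_induct_disjoint[OF Int_stable_cylinders _ sA])
    fix A assume "A \<in> insert {} (range cylinder)"
    then consider "A = {}" | "A = cylinder []" | y ys where "A = cylinder (y # ys)"
      by (metis imageE insertE list.exhaust)
    then show "qprob \<omega> z (cylinder \<pi> \<inter> ?s A) = path_weight \<omega> z \<pi> * qprob \<omega> (last \<pi>) A"
    proof cases
      case 2
      then have "A = UNIV" by (auto simp: cylinder_def)
      then show ?thesis using Q'.prob_space by (simp add: cyl)
    next
      case 3
      show ?thesis
      proof (cases "y = last \<pi>")
        case True
        have "cylinder \<pi> \<inter> ?s A = cylinder (\<pi> @ ys)"
          using cylinder_append[OF \<pi>, of _ ys] by (auto simp: 3 True)
        then show ?thesis using \<pi> by (simp add: cyl 3 True path_weight_eq weight_append)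
      next
        case False
        have "cylinder \<pi> \<inter> ?s A = {}"
        proof -
          have False if "X \<in> cylinder \<pi>" "path_shift (length \<pi> - 1) X \<in> cylinder (y # ys)" for X
            using that(2) cylinder_eqD[OF that(1), of "length \<pi> - 1"] \<pi> False
              cylinder_eqD[OF that(2), of 0] by (simp add: last_conv_nth path_shift_apply)
          then show ?thesis by (auto simp: 3)
        qed
        moreover have "path_weight \<omega> (last \<pi>) (y # ys) = 0" using False by (simp add: path_weight_eq)
        ultimately show ?thesis by (simp add: cyl 3)
      qed
    qed simp
  next
    fix A assume A: "A \<in> sigma_sets UNIV (insert {} (range cylinder))"
      and IH: "qprob \<omega> z (cylinder \<pi> \<inter> ?s A) = path_weight \<omega> z \<pi> * qprob \<omega> (last \<pi>) A"
    have A': "A \<in> sets path_space" using A by (simp add: sets_path_space)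
    have "cylinder \<pi> \<inter> ?s (UNIV - A) = cylinder \<pi> - (cylinder \<pi> \<inter> ?s A)" by auto
    then have "qprob \<omega> z (cylinder \<pi> \<inter> ?s (UNIV - A)) =
        path_weight \<omega> z \<pi> - path_weight \<omega> z \<pi> * qprob \<omega> (last \<pi>) A"
      using A' by (simp add: Q.finite_measure_Diff Q.sets_Q IH cyl del: One_nat_def)
    also have "\<dots> = path_weight \<omega> z \<pi> * (1 - qprob \<omega> (last \<pi>) A)"
      by (simp add: right_diff_distrib)
    also have "1 - qprob \<omega> (last \<pi>) A = qprob \<omega> (last \<pi>) (UNIV - A)"
      using A' Q'.prob_compl[of A] by (simp add: Q'.sets_Q)
    finally show "qprob \<omega> z (cylinder \<pi> \<inter> ?s (UNIV - A)) =
        path_weight \<omega> z \<pi> * qprob \<omega> (last \<pi>) (UNIV - A)" .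
  next
    fix A :: "nat \<Rightarrow> _"
    assume disj: "disjoint_family A" and A: "range A \<subseteq> sigma_sets UNIV (insert {} (range cylinder))"
      and IH: "\<And>i. qprob \<omega> z (cylinder \<pi> \<inter> ?s (A i)) = path_weight \<omega> z \<pi> * qprob \<omega> (last \<pi>) (A i)"
    have A': "A i \<in> sets path_space" for i using A by (auto simp: sets_path_space)
    have "(\<lambda>i. qprob \<omega> z (cylinder \<pi> \<inter> ?s (A i))) sums
        qprob \<omega> z (\<Union>i. cylinder \<pi> \<inter> ?s (A i))"
      by (rule Q.finite_measure_UNION) (use A' s disj in \<open>auto simp: disjoint_family_on_def\<close>)
    moreover have "(\<lambda>i. path_weight \<omega> z \<pi> * qprob \<omega> (last \<pi>) (A i)) sums
        (path_weight \<omega> z \<pi> * qprob \<omega> (last \<pi>) (\<Union>i. A i))"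
      by (intro sums_mult Q'.finite_measure_UNION) (use A' disj in \<open>auto simp: Q'.sets_Q\<close>)
    moreover have "(\<Union>i. cylinder \<pi> \<inter> ?s (A i)) = cylinder \<pi> \<inter> ?s (\<Union>i. A i)" by auto
    ultimately show "qprob \<omega> z (cylinder \<pi> \<inter> ?s (\<Union>i. A i)) =
        path_weight \<omega> z \<pi> * qprob \<omega> (last \<pi>) (\<Union>i. A i)"
      unfolding IH by (auto intro: sums_unique2)
  next
    have "cylinder \<pi> \<inter> ?s {} = {}" by simp
    then show "qprob \<omega> z (cylinder \<pi> \<inter> ?s {}) =
        path_weight \<omega> z \<pi> * qprob \<omega> (last \<pi>) {}"
      by (simp only: measure_empty mult_zero_right)
  qed simp
qed

definition walk :: "site \<Rightarrow> path \<Rightarrow> bool" where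
  "walk z X \<longleftrightarrow> X 0 = z \<and> (\<forall>n. X (Suc n) - X n \<in> unit_steps)"

lemma walk_measurable [measurable]: "{X. walk z X} \<in> sets path_space"
proof -
  have "{X \<in> space path_space. X 0 = z \<and> (\<forall>n. X (Suc n) - X n \<in> unit_steps)} \<in> sets path_space"
    by measurable
  then show ?thesis by (simp add: walk_def)
qed

lemma AE_quenched_walk:
  assumes \<omega>: "\<omega> \<in> space env_space"
  shows "AE X in quenched_law \<omega> z. walk z X"
proof -
  interpret Q: path_measure "quenched_law \<omega> z" by (rule quenched_path_measure[OF \<omega>])
  note cyl = measure_quenched_law_cylinder[OF \<omega>]
  have "AE X in quenched_law \<omega> z. path_prefix 1 X \<notin> {\<pi>. hd \<pi> \<noteq> z}"
    by (rule Q.AE_path_prefix_notin) (auto simp: cyl path_weight_eq length_Suc_conv)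
  then have 1: "AE X in quenched_law \<omega> z. X 0 = z"
    by eventually_elim (simp add: path_prefix_def)
  have "AE X in quenched_law \<omega> z. path_prefix (Suc (Suc n)) X \<notin> {\<pi>. \<pi> ! Suc n - \<pi> ! n \<notin> unit_steps}" for n
  proof (rule Q.AE_path_prefix_notin)
    fix \<pi> :: "site list"
    assume \<pi>: "\<pi> \<in> {\<pi>. \<pi> ! Suc n - \<pi> ! n \<notin> unit_steps}" "length \<pi> = Suc (Suc n)"
    then obtain \<rho> y where \<rho>: "\<pi> = \<rho> @ [y]" "length \<rho> = Suc n" by (metis length_Suc_conv_rev)
    then have "\<rho> \<noteq> []" by auto
    moreover from this have "last \<rho> = \<rho> ! n" using \<rho>(2) by (simp add: last_conv_nth)
    ultimately show "qprob \<omega> z (cylinder \<pi>) = 0"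
      using \<pi> \<rho> by (simp add: cyl path_weight_snoc transition_def nth_append)
  qed
  then have "AE X in quenched_law \<omega> z. \<forall>n. path_prefix (Suc (Suc n)) X \<notin> {\<pi>. \<pi> ! Suc n - \<pi> ! n \<notin> unit_steps}"
    by (subst AE_all_countable) blast
  with 1 show ?thesis
    by eventually_elim (simp add: walk_def)
qed

definition shift_env :: "site \<Rightarrow> environment \<Rightarrow> environment" where
  "shift_env z \<omega> = (\<lambda>x. \<omega> (x + z))"

lemma shift_env_measurable [measurable]: "shift_env z \<in> measurable env_space env_space"
  unfolding env_space_def shift_env_def
  by (intro measurable_PiM_single') (auto simp: space_PiM PiE_iff)

lemma space_shift_env: "\<omega> \<in> space env_space \<Longrightarrow> shift_env z \<omega> \<in> space env_space"
  using measurable_space[OF shift_env_measurable] .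

lemma weight_shift_env: "weight (shift_env z \<omega>) xs = weight \<omega> (map (\<lambda>x. x + z) xs)"
  by (induction \<omega> xs rule: weight.induct) (simp_all add: transition_def shift_env_def)

lemma quenched_law_translate:
  assumes \<omega>: "\<omega> \<in> space env_space" and A: "A \<in> sets path_space"
  shows "qprob \<omega> (y + z) {X. (\<lambda>n. X n - z) \<in> A} = qprob (shift_env z \<omega>) y A"
proof -
  interpret Q: path_measure "quenched_law \<omega> (y + z)" by (rule quenched_path_measure[OF \<omega>])
  let ?f = "\<lambda>X n. X n - z"
  have [measurable]: "?f \<in> measurable path_space path_space" by (rule path_map_measurable) measurable
  have f: "?f \<in> measurable (quenched_law \<omega> (y + z)) path_space"
    by (simp add: measurable_cong_sets[OF Q.sets_Q refl])
  have m: "measure (distr (quenched_law \<omega> (y + z)) path_space ?f) A = qprob \<omega> (y + z) {X. ?f X \<in> A}"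
    if "A \<in> sets path_space" for A
    using that by (simp add: measure_distr[OF f] vimage_def)
  have "distr (quenched_law \<omega> (y + z)) path_space ?f = quenched_law (shift_env z \<omega>) y"
  proof (rule path_measure_eqI)
    show "path_measure (distr (quenched_law \<omega> (y + z)) path_space ?f)"
      by (intro path_measure.intro Q.prob_space_distr f) (simp add: path_measure_axioms_def)
    show "path_measure (quenched_law (shift_env z \<omega>) y)"
      by (intro quenched_path_measure space_shift_env \<omega>)
    fix xs
    have "{X. ?f X \<in> cylinder xs} = cylinder (map (\<lambda>x. x + z) xs)"
      by (auto simp: cylinder_def algebra_simps)
    then have "measure (distr (quenched_law \<omega> (y + z)) path_space ?f) (cylinder xs) = path_weight \<omega> (y + z) (map (\<lambda>x. x + z) xs)"
      by (simp add: m measure_quenched_law_cylinder[OF \<omega>])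
    also have "\<dots> = path_weight (shift_env z \<omega>) y xs"
      by (cases "xs = []") (simp_all add: path_weight_eq weight_shift_env hd_map)
    finally show "measure (distr (quenched_law \<omega> (y + z)) path_space ?f) (cylinder xs) =
        qprob (shift_env z \<omega>) y (cylinder xs)"
      by (simp add: measure_quenched_law_cylinder[OF space_shift_env[OF \<omega>]])
  qed
  with m[OF A] show ?thesis by simp
qed

section \<open>Independence and stationarity under the annealed law\<close>

definition determined_by :: "(environment \<Rightarrow> real) \<Rightarrow> site set \<Rightarrow> bool" where
  "determined_by f S \<longleftrightarrow>
     (\<forall>\<omega>\<in>space env_space. \<forall>\<omega>'\<in>space env_space. (\<forall>x\<in>S. \<omega> x = \<omega>' x) \<longrightarrow> f \<omega> = f \<omega>')"

lemma determined_by_path_weight: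
  assumes "set (butlast xs) \<subseteq> S"
  shows "determined_by (\<lambda>\<omega>. path_weight \<omega> z xs) S"
  unfolding determined_by_def
proof (intro ballI impI)
  fix \<omega> \<omega>' :: "environment"
  assume "\<forall>x\<in>S. \<omega> x = \<omega>' x"
  then have "weight \<omega> xs = weight \<omega>' xs" by (intro weight_cong) (use assms in blast)
  then show "path_weight \<omega> z xs = path_weight \<omega>' z xs"
    by (cases "xs = []") (simp_all add: path_weight_eq)
qed

text \<open>
  The last site of a path is excluded by \<^const>\<open>butlast\<close> because no step departs from it.
\<close>

lemma determined_by_prefix_event:
  assumes B: "\<And>\<pi>. \<pi> \<in> B \<Longrightarrow> length \<pi> = n \<Longrightarrow> hd \<pi> = z \<Longrightarrow> set (butlast \<pi>) \<subseteq> S"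
  shows "determined_by (\<lambda>\<omega>. qprob \<omega> z {X. path_prefix n X \<in> B}) S"
  unfolding determined_by_def
proof (intro ballI impI)
  fix \<omega> \<omega>' assume \<omega>: "\<omega> \<in> space env_space" "\<omega>' \<in> space env_space" and eq: "\<forall>x\<in>S. \<omega> x = \<omega>' x"
  let ?T = "{\<pi>\<in>B. length \<pi> = n}"
  have disj: "disjoint_family_on cylinder ?T"
    by (auto simp: disjoint_family_on_def mem_cylinder_iff)
  have U: "{X. path_prefix n X \<in> B} = (\<Union>\<pi>\<in>?T. cylinder \<pi> \<inter> UNIV)"
    by (auto simp: mem_cylinder_iff)
  have em: "emeasure (quenched_law \<omega> z) {X. path_prefix n X \<in> B} =
      (\<integral>\<^sup>+\<pi>. ennreal (path_weight \<omega> z \<pi>) \<partial>count_space ?T)" if "\<omega> \<in> space env_space" for \<omega>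
  proof -
    interpret Q: path_measure "quenched_law \<omega> z" by (rule quenched_path_measure[OF that])
    show ?thesis
      unfolding U
      by (subst Q.emeasure_UN_cylinders[OF disj])
         (use sets.top[of "quenched_law \<omega> z"] in \<open>simp_all add: Q.emeasure_eq_measure measure_quenched_law_cylinder[OF that]\<close>)
  qed
  have "path_weight \<omega> z \<pi> = path_weight \<omega>' z \<pi>" if "\<pi> \<in> ?T" for \<pi>
  proof (cases "\<pi> \<noteq> [] \<and> hd \<pi> = z")
    case True
    have "weight \<omega> \<pi> = weight \<omega>' \<pi>"
      by (rule weight_cong) (use B[of \<pi>] that True eq in blast)
    then show ?thesis by (cases "\<pi> = []") (simp_all add: path_weight_eq)
  next
    case False
    then show ?thesis by (cases "\<pi> = []") (simp_all add: path_weight_eq)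
  qed
  then have "emeasure (quenched_law \<omega> z) {X. path_prefix n X \<in> B} = emeasure (quenched_law \<omega>' z) {X. path_prefix n X \<in> B}"
    by (auto simp: em \<omega> intro!: nn_integral_cong)
  then show "qprob \<omega> z {X. path_prefix n X \<in> B} = qprob \<omega>' z {X. path_prefix n X \<in> B}"
    by (simp add: measure_def)
qed

lemma measurable_quenched_kernel:
  "(\<lambda>\<omega>. quenched_law \<omega> z) \<in> measurable env_space (subprob_algebra path_space)"
  by (rule measurable_prob_algebraD[OF measurable_quenched_law])

lemma measurable_quenched_measure [measurable]:
  "A \<in> sets path_space \<Longrightarrow> (\<lambda>\<omega>. qprob \<omega> z A) \<in> borel_measurable env_space"
  by (rule measurable_compose[OF measurable_quenched_kernel measurable_measure_subprob_algebra])

lemma quenched_measure_bounds: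
  assumes "\<omega> \<in> space env_space"
  shows "0 \<le> qprob \<omega> z A" "qprob \<omega> z A \<le> 1"
proof -
  interpret path_measure "quenched_law \<omega> z" by (rule quenched_path_measure[OF assms])
  show "0 \<le> qprob \<omega> z A" "qprob \<omega> z A \<le> 1" by simp_all
qed

locale iid_environment = prob_space P
  for P :: "environment measure" +
  assumes sets_P [measurable_cong]: "sets P = sets env_space" and iid: "iid_env P"
begin

lemma space_P: "space P = space env_space"
  by (rule sets_eq_imp_space_eq[OF sets_P])

lemma borel_measurable_P: "borel_measurable P = borel_measurable env_space"
  by (rule measurable_cong_sets[OF sets_P refl])

lemma integrable_bounded:
  assumes "f \<in> borel_measurable env_space" "\<And>\<omega>. \<omega> \<in> space env_space \<Longrightarrow> 0 \<le> f \<omega> \<and> f \<omega> \<le> (1::real)"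
  shows "integrable P f"
  by (rule integrable_const_bound[of _ 1]) (use assms in \<open>auto simp: borel_measurable_P space_P\<close>)

lemma integrable_weight: "integrable P (\<lambda>\<omega>. weight \<omega> xs)"
  by (rule integrable_bounded) (auto simp: weight_nonneg weight_le_1)

lemma integrable_path_weight: "integrable P (\<lambda>\<omega>. path_weight \<omega> z xs)"
  by (cases "xs = []") (auto simp: path_weight_eq integrable_weight)

lemma integrable_quenched_measure:
  "A \<in> sets path_space \<Longrightarrow> integrable P (\<lambda>\<omega>. qprob \<omega> z A)"
  by (rule integrable_bounded) (auto simp: quenched_measure_bounds)

text \<open>
  Outside \<open>S\<close> the environment may be replaced by a fixed one without changing \<open>f\<close>, and likewise for \<open>g\<close> and
  \<open>S'\<close>. This turns \<open>f\<close> and \<open>g\<close> into functions of two independent restrictions of the environment.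
\<close>

lemma integral_mult_determined_by:
  fixes f g :: "_ \<Rightarrow> real"
  assumes f: "f \<in> borel_measurable env_space" "integrable P f" "determined_by f S"
    and g: "g \<in> borel_measurable env_space" "integrable P g" "determined_by g S'"
    and disj: "S \<inter> S' = {}"
  shows "(\<integral>\<omega>. f \<omega> * g \<omega> \<partial>P) = (\<integral>\<omega>. f \<omega> \<partial>P) * (\<integral>\<omega>. g \<omega> \<partial>P)"
proof -
  obtain \<omega>\<^sub>0 where \<omega>\<^sub>0: "\<omega>\<^sub>0 \<in> space env_space" using not_empty space_P by auto
  \<comment> \<open>completes a partial environment by the fixed environment \<open>\<omega>\<^sub>0\<close>\<close>
  define ext where "ext = (\<lambda>S \<eta> x. if x \<in> S then \<eta> x else \<omega>\<^sub>0 x :: site \<Rightarrow> real)"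
  have ext: "ext S \<in> measurable (Pi\<^sub>M S (\<lambda>_. prob_vec_space)) env_space" for S
    unfolding env_space_def ext_def
  proof (rule measurable_PiM_single')
    fix x
    show "(\<lambda>\<eta>. if x \<in> S then \<eta> x else \<omega>\<^sub>0 x) \<in> measurable (Pi\<^sub>M S (\<lambda>_. prob_vec_space)) prob_vec_space"
      using \<omega>\<^sub>0 by (cases "x \<in> S") (simp_all add: env_space_def space_PiM PiE_iff del: split_paired_All)
  qed (use \<omega>\<^sub>0 in \<open>auto simp: env_space_def space_PiM PiE_iff simp del: split_paired_All\<close>)
  have "indep_vars (\<lambda>_. prob_vec_space) (\<lambda>x \<omega>. \<omega> x) UNIV" using iid by (simp add: iid_env_def)
  then have "indep_var (Pi\<^sub>M S (\<lambda>_. prob_vec_space)) (\<lambda>\<omega>. restrict \<omega> S) (Pi\<^sub>M S' (\<lambda>_. prob_vec_space)) (\<lambda>\<omega>. restrict \<omega> S')"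
    using indep_var_restrict[of "\<lambda>_. prob_vec_space" "\<lambda>x \<omega>. \<omega> x" UNIV S S'] disj by simp
  then have ind: "indep_var borel ((f \<circ> ext S) \<circ> (\<lambda>\<omega>. restrict \<omega> S)) borel ((g \<circ> ext S') \<circ> (\<lambda>\<omega>. restrict \<omega> S'))"
    by (rule indep_var_compose) (auto intro!: measurable_comp[OF ext] f g)
  have eq: "h (ext S (restrict \<omega> S)) = h \<omega>" if h: "determined_by h S" and \<omega>: "\<omega> \<in> space P" for h :: "_ \<Rightarrow> real" and S \<omega>
  proof -
    have "ext S (restrict \<omega> S) \<in> space env_space"
      using \<omega> by (intro measurable_space[OF ext]) (auto simp: space_P env_space_def space_PiM)
    moreover have "\<forall>x\<in>S. ext S (restrict \<omega> S) x = \<omega> x" by (simp add: ext_def)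
    ultimately show ?thesis
      using h \<omega> unfolding determined_by_def space_P by blast
  qed
  have int: "integrable P ((h \<circ> ext S) \<circ> (\<lambda>\<omega>. restrict \<omega> S))" if "determined_by h S" "integrable P h" for h :: "_ \<Rightarrow> real" and S
    by (subst Bochner_Integration.integrable_cong[OF refl, of _ _ h]) (simp_all add: eq[OF that(1)] that(2))
  have "(\<integral>\<omega>. f \<omega> * g \<omega> \<partial>P) = (\<integral>\<omega>. ((f \<circ> ext S) \<circ> (\<lambda>\<omega>. restrict \<omega> S)) \<omega> * ((g \<circ> ext S') \<circ> (\<lambda>\<omega>. restrict \<omega> S')) \<omega> \<partial>P)"
    by (intro Bochner_Integration.integral_cong) (simp_all add: eq f g)
  also have "\<dots> = (\<integral>\<omega>. ((f \<circ> ext S) \<circ> (\<lambda>\<omega>. restrict \<omega> S)) \<omega> \<partial>P) * (\<integral>\<omega>. ((g \<circ> ext S') \<circ> (\<lambda>\<omega>. restrict \<omega> S')) \<omega> \<partial>P)"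
    by (rule indep_var_lebesgue_integral[OF ind]) (intro int f g)+
  also have "\<dots> = (\<integral>\<omega>. f \<omega> \<partial>P) * (\<integral>\<omega>. g \<omega> \<partial>P)"
    by (intro arg_cong2[where f="(*)"] Bochner_Integration.integral_cong) (simp_all add: eq f g)
  finally show ?thesis .
qed

text \<open>
  Independence and equality of the one-site laws make the law of the environment a product of copies of one
  measure, which is invariant under reindexing.
\<close>

lemma distr_shift_env: "distr P env_space (shift_env z) = P"
proof -
  have rv: "(\<lambda>\<omega>. \<omega> x) \<in> measurable P prob_vec_space" for x
    unfolding measurable_cong_sets[OF sets_P refl] env_space_def by measurable
  define \<nu> where "\<nu> = distr P prob_vec_space (\<lambda>\<omega>. \<omega> 0)"
  have \<nu>: "distr P prob_vec_space (\<lambda>\<omega>. \<omega> x) = \<nu>" for x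
    using iid unfolding iid_env_def \<nu>_def by blast
  interpret \<nu>: prob_space \<nu> unfolding \<nu>_def by (rule prob_space_distr[OF rv])
  have "indep_vars (\<lambda>_. prob_vec_space) (\<lambda>x \<omega>. \<omega> x) UNIV" using iid by (simp add: iid_env_def)
  then have "distr P (\<Pi>\<^sub>M i\<in>UNIV. prob_vec_space) (\<lambda>\<omega>. \<lambda>i\<in>UNIV. \<omega> i) = (\<Pi>\<^sub>M i\<in>UNIV. \<nu>)"
    using indep_vars_iff_distr_eq_PiM[where M'="\<lambda>_. prob_vec_space" and X="\<lambda>x \<omega>. \<omega> x" and I=UNIV] rv by (simp add: \<nu>)
  then have P: "P = (\<Pi>\<^sub>M i\<in>UNIV. \<nu>)"
    using distr_id2[OF sets_P[symmetric]] by (simp add: env_space_def restrict_def)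
  have "distr (\<Pi>\<^sub>M i\<in>UNIV. \<nu>) (\<Pi>\<^sub>M i\<in>UNIV. \<nu>) (\<lambda>\<omega>. \<lambda>n\<in>UNIV. \<omega> (n + z)) = (\<Pi>\<^sub>M i\<in>UNIV. \<nu>)"
    using distr_PiM_reindex[of UNIV "\<lambda>_. \<nu>" "\<lambda>n. n + z" UNIV] \<nu>.prob_space_axioms by simp
  then have "distr P P (shift_env z) = P"
    unfolding P[symmetric] by (simp add: shift_env_def[abs_def] restrict_def)
  then show ?thesis using sets_P by (metis distr_cong)
qed

lemma integral_shift_env:
  fixes f :: "_ \<Rightarrow> real"
  assumes "f \<in> borel_measurable env_space"
  shows "(\<integral>\<omega>. f (shift_env z \<omega>) \<partial>P) = (\<integral>\<omega>. f \<omega> \<partial>P)"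
proof -
  have "(\<integral>\<omega>. f \<omega> \<partial>P) = (\<integral>\<omega>. f \<omega> \<partial>distr P env_space (shift_env z))" by (simp add: distr_shift_env)
  also have "\<dots> = (\<integral>\<omega>. f (shift_env z \<omega>) \<partial>P)"
    by (rule integral_distr) (use assms in \<open>simp_all add: measurable_cong_sets[OF sets_P refl]\<close>)
  finally show ?thesis by simp
qed

text \<open>
  The annealed law of the path alone. It is not Markovian, but its cylinder probabilities are the mean weights.
\<close>

definition walk_law :: "site \<Rightarrow> path measure" where
  "walk_law z = P \<bind> (\<lambda>\<omega>. quenched_law \<omega> z)"

abbreviation aprob :: "site \<Rightarrow> path set \<Rightarrow> real" where
  "aprob z A \<equiv> measure (walk_law z) A"

lemma kernel_P: "(\<lambda>\<omega>. quenched_law \<omega> z) \<in> measurable P (subprob_algebra path_space)"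
  using measurable_quenched_kernel by (simp add: measurable_cong_sets[OF sets_P refl])

lemma walk_law_path_measure: "path_measure (walk_law z)"
proof (intro path_measure.intro)
  show "prob_space (walk_law z)"
    unfolding walk_law_def
  proof (rule prob_space_bind[OF _ kernel_P], rule AE_I2)
    fix \<omega> assume "\<omega> \<in> space P"
    then show "prob_space (quenched_law \<omega> z)"
      using quenched_path_measure[of \<omega> z] by (simp add: space_P path_measure_def)
  qed
  show "path_measure_axioms (walk_law z)"
    unfolding walk_law_def path_measure_axioms_def
    by (intro sets_bind[OF sets_kernel[OF kernel_P]] not_empty)
qed

lemma emeasure_walk_law:
  "A \<in> sets path_space \<Longrightarrow> emeasure (walk_law z) A = (\<integral>\<^sup>+\<omega>. emeasure (quenched_law \<omega> z) A \<partial>P)"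
  unfolding walk_law_def by (rule emeasure_bind[OF not_empty kernel_P])

lemma measure_walk_law:
  assumes "A \<in> sets path_space"
  shows "aprob z A = (\<integral>\<omega>. qprob \<omega> z A \<partial>P)"
proof -
  have "emeasure (walk_law z) A = (\<integral>\<^sup>+\<omega>. ennreal (qprob \<omega> z A) \<partial>P)"
    unfolding emeasure_walk_law[OF assms]
  proof (rule nn_integral_cong)
    fix \<omega> assume "\<omega> \<in> space P"
    then interpret Q: path_measure "quenched_law \<omega> z" by (simp add: quenched_path_measure space_P)
    show "emeasure (quenched_law \<omega> z) A = ennreal (qprob \<omega> z A)"
      by (rule Q.emeasure_eq_measure)
  qed
  also have "\<dots> = ennreal (\<integral>\<omega>. qprob \<omega> z A \<partial>P)"
    by (rule nn_integral_eq_integral) (simp_all add: integrable_quenched_measure assms)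
  finally show ?thesis by (simp add: measure_def)
qed

lemma measure_walk_law_cylinder: "aprob z (cylinder xs) = (\<integral>\<omega>. path_weight \<omega> z xs \<partial>P)"
  unfolding measure_walk_law[OF cylinder_in_path]
  by (intro Bochner_Integration.integral_cong) (simp_all add: space_P measure_quenched_law_cylinder)

lemma walk_law_null:
  assumes A: "A \<in> sets path_space" and "AE \<omega> in P. qprob \<omega> z A = 0"
  shows "aprob z A = 0"
  unfolding measure_walk_law[OF A] using assms(2) by (rule integral_eq_zero_AE)

lemma AE_walk_law_walk: "AE X in walk_law z. walk z X"
proof -
  interpret W: path_measure "walk_law z" by (rule walk_law_path_measure)
  have "aprob z {X. walk z X} = (\<integral>\<omega>. 1 \<partial>P)"
    unfolding measure_walk_law[OF walk_measurable]
  proof (intro Bochner_Integration.integral_cong refl)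
    fix \<omega> assume "\<omega> \<in> space P"
    then have \<omega>: "\<omega> \<in> space env_space" by (simp add: space_P)
    interpret Q: path_measure "quenched_law \<omega> z" by (rule quenched_path_measure[OF \<omega>])
    show "qprob \<omega> z {X. walk z X} = 1"
      by (subst Q.prob_eq_1) (use AE_quenched_walk[OF \<omega>] in \<open>simp_all add: Q.sets_Q\<close>)
  qed
  then have "aprob z {X. walk z X} = 1" by (simp add: prob_space)
  then show ?thesis by (subst (asm) W.prob_eq_1) (simp_all add: W.sets_Q)
qed

lemma walk_law_translate:
  assumes A: "A \<in> sets path_space"
  shows "aprob (y + z) {X. (\<lambda>n. X n - z) \<in> A} = aprob y A"
proof -
  have m: "{X. (\<lambda>n. X n - z) \<in> A} \<in> sets path_space"
    by (rule path_event_measurable[OF path_map_measurable A]) simp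
  have "aprob (y + z) {X. (\<lambda>n. X n - z) \<in> A} = (\<integral>\<omega>. qprob (shift_env z \<omega>) y A \<partial>P)"
    unfolding measure_walk_law[OF m]
    by (intro Bochner_Integration.integral_cong) (simp_all add: space_P quenched_law_translate A)
  also have "\<dots> = aprob y A"
    unfolding measure_walk_law[OF A] by (rule integral_shift_env) (rule measurable_quenched_measure[OF A])
  finally show ?thesis .
qed

lemma walk_law_fresh_prefix:
  assumes \<pi>: "\<pi> \<noteq> []"
    and fresh: "\<And>\<rho>. \<rho> \<in> B \<Longrightarrow> length \<rho> = n \<Longrightarrow> hd \<rho> = last \<pi> \<Longrightarrow> set (butlast \<rho>) \<inter> set (butlast \<pi>) = {}"
  shows "aprob z (cylinder \<pi> \<inter> {X. path_shift (length \<pi> - 1) X \<in> {X. path_prefix n X \<in> B}}) =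
    aprob z (cylinder \<pi>) * aprob (last \<pi>) {X. path_prefix n X \<in> B}"
proof -
  let ?A = "{X. path_prefix n X \<in> B}"
  have m: "cylinder \<pi> \<inter> {X. path_shift (length \<pi> - 1) X \<in> ?A} \<in> sets path_space"
    by (intro sets.Int cylinder_in_path path_event_measurable[OF path_shift_measurable]) simp
  have "aprob z (cylinder \<pi> \<inter> {X. path_shift (length \<pi> - 1) X \<in> ?A}) =
      (\<integral>\<omega>. path_weight \<omega> z \<pi> * qprob \<omega> (last \<pi>) ?A \<partial>P)"
    unfolding measure_walk_law[OF m]
    by (intro Bochner_Integration.integral_cong refl quenched_Markov \<pi>) (simp_all add: space_P)
  also have "\<dots> = (\<integral>\<omega>. path_weight \<omega> z \<pi> \<partial>P) * (\<integral>\<omega>. qprob \<omega> (last \<pi>) ?A \<partial>P)"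
  proof (rule integral_mult_determined_by)
    show "determined_by (\<lambda>\<omega>. path_weight \<omega> z \<pi>) (set (butlast \<pi>))"
      by (rule determined_by_path_weight) simp
    show "determined_by (\<lambda>\<omega>. qprob \<omega> (last \<pi>) ?A) (- set (butlast \<pi>))"
      by (rule determined_by_prefix_event) (use fresh in blast)
    show "(\<lambda>\<omega>. path_weight \<omega> z \<pi>) \<in> borel_measurable env_space" using \<pi> by (simp add: path_weight_eq)
  qed (auto simp: integrable_path_weight integrable_quenched_measure)
  finally show ?thesis by (simp add: measure_walk_law_cylinder measure_walk_law)
qed

text \<open>
  The annealed walk forgets its past at the end of \<open>\<pi>\<close> as far as futures are concerned that never leave from a
  site that \<open>\<pi>\<close> has left: the weights of the past and of the future then depend on disjoint sets of sites. Such
  a future is described by its finite prefixes, over which one passes to the limit.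
\<close>

lemma walk_law_regeneration:
  assumes \<pi>: "\<pi> \<noteq> []"
    and fresh: "\<And>n \<rho>. \<rho> \<in> B n \<Longrightarrow> length \<rho> = n \<Longrightarrow> hd \<rho> = last \<pi> \<Longrightarrow> set (butlast \<rho>) \<inter> set (butlast \<pi>) = {}"
    and dec: "\<And>n X. path_prefix (Suc n) X \<in> B (Suc n) \<Longrightarrow> path_prefix n X \<in> B n"
  shows "aprob z (cylinder \<pi> \<inter> {X. path_shift (length \<pi> - 1) X \<in> {X. \<forall>n. path_prefix n X \<in> B n}}) =
    aprob z (cylinder \<pi>) * aprob (last \<pi>) {X. \<forall>n. path_prefix n X \<in> B n}"
proof -
  interpret W: path_measure "walk_law z" by (rule walk_law_path_measure)
  interpret W': path_measure "walk_law (last \<pi>)" by (rule walk_law_path_measure)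
  let ?A = "\<lambda>n. {X. path_prefix n X \<in> B n}"
  let ?C = "\<lambda>n. cylinder \<pi> \<inter> {X. path_shift (length \<pi> - 1) X \<in> ?A n}"
  have C: "?C n \<in> sets path_space" for n
    by (intro sets.Int cylinder_in_path path_event_measurable[OF path_shift_measurable]) simp
  have dA: "decseq ?A" by (rule decseq_SucI) (use dec in auto)
  have dC: "decseq ?C" by (rule decseq_SucI) (use dec in auto)
  have "(\<lambda>n. aprob z (?C n)) \<longlonglongrightarrow> aprob z (\<Inter>n. ?C n)"
    by (rule W.finite_Lim_measure_decseq[OF _ dC]) (use C in \<open>auto simp: W.sets_Q\<close>)
  moreover have "(\<lambda>n. aprob z (cylinder \<pi>) * aprob (last \<pi>) (?A n)) \<longlonglongrightarrow>
      aprob z (cylinder \<pi>) * aprob (last \<pi>) (\<Inter>n. ?A n)"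
    by (intro tendsto_mult_left W'.finite_Lim_measure_decseq[OF _ dA]) auto
  moreover have "aprob z (?C n) = aprob z (cylinder \<pi>) * aprob (last \<pi>) (?A n)" for n
    by (rule walk_law_fresh_prefix[OF \<pi> fresh])
  ultimately have "aprob z (\<Inter>n. ?C n) =
      aprob z (cylinder \<pi>) * aprob (last \<pi>) (\<Inter>n. ?A n)"
    by (simp add: LIMSEQ_unique)
  moreover have "(\<Inter>n. ?C n) = cylinder \<pi> \<inter> {X. path_shift (length \<pi> - 1) X \<in> {X. \<forall>n. path_prefix n X \<in> B n}}" by auto
  moreover have "(\<Inter>n. ?A n) = {X. \<forall>n. path_prefix n X \<in> B n}" by auto
  ultimately show ?thesis by simp
qed

end

section \<open>Recurrence to a set and to its translates\<close>

context path_measure begin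

lemma AE_notin_of_measure_zero: "A \<in> sets Q \<Longrightarrow> measure Q A = 0 \<Longrightarrow> AE X in Q. X \<notin> A"
  by (rule AE_not_in) (simp add: null_setsI emeasure_eq_measure)

end

lemma cylinder_snoc_step: "\<pi> \<noteq> [] \<Longrightarrow> cylinder \<pi> \<inter> {X. X (length \<pi>) = y} = cylinder (\<pi> @ [y])"
  by (simp add: cylinder_snoc)

lemma frequently_nat_iff: "(\<exists>\<^sub>\<infinity>n::nat. R n) \<longleftrightarrow> (\<forall>N. \<exists>n\<ge>N. R n)"
  by (rule INFM_nat_le)

locale elliptic_environment = iid_environment +
  assumes elliptic: "elliptic_env P"
begin

lemma AE_env_positive: "AE \<omega> in P. \<forall>x. \<forall>e\<in>unit_steps. 0 < \<omega> x e"
  using elliptic by (simp add: elliptic_env_def)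

definition mean_step :: "site \<Rightarrow> real" where
  "mean_step e = (\<integral>\<omega>. \<omega> 0 e \<partial>P)"

lemma integral_transition: "e \<in> unit_steps \<Longrightarrow> (\<integral>\<omega>. transition \<omega> y (y + e) \<partial>P) = mean_step e"
  using integral_shift_env[where f="\<lambda>\<omega>. \<omega> 0 e" and z=y]
    measurable_env_entry[where e=e and x=0]
  by (simp add: transition_def mean_step_def shift_env_def)

lemma integral_pos_of_AE_pos:
  fixes f :: "_ \<Rightarrow> real"
  assumes "integrable P f" "AE \<omega> in P. 0 < f \<omega>"
  shows "0 < (\<integral>\<omega>. f \<omega> \<partial>P)"
  using integral_less_AE_space[of "\<lambda>_. 0" f] assms by (simp add: emeasure_space_1)

lemma mean_step_pos:
  assumes e: "e \<in> unit_steps"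
  shows "mean_step e > 0"
proof -
  have "AE \<omega> in P. 0 < transition \<omega> 0 (0 + e)"
    using AE_env_positive by eventually_elim (use e in \<open>simp add: transition_def del: split_paired_All\<close>)
  then have "0 < (\<integral>\<omega>. transition \<omega> 0 (0 + e) \<partial>P)"
    by (intro integral_pos_of_AE_pos integrable_bounded) (simp_all add: transition_nonneg transition_le_1)
  then show ?thesis by (simp only: integral_transition[OF e])
qed

text \<open>
  Every visit to \<open>y\<close> is a trial with the same success probability \<open>\<omega> y e\<close>.
\<close>

lemma quenched_visits_neighbour:
  assumes \<omega>: "\<omega> \<in> space env_space" and pos: "0 < \<omega> y e" and e: "e \<in> unit_steps"
  shows "qprob \<omega> z {X. (\<forall>N. \<exists>n\<ge>N. X n = y) \<and> (\<forall>n\<ge>m. X n \<noteq> y + e)} = 0"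
proof -
  interpret Q: path_measure "quenched_law \<omega> z" by (rule quenched_path_measure[OF \<omega>])
  let ?O = "{X. (\<forall>N. \<exists>n\<ge>N. X n = y) \<and> (\<forall>n\<ge>m. X n \<noteq> y + e)}"
  show ?thesis
  proof (rule Q.recurrent_trials[where \<phi>="\<lambda>\<pi>. \<pi> \<noteq> [] \<and> last \<pi> = y" and H="\<lambda>\<pi>. {X. X (length \<pi>) = y + e}"
        and N\<^sub>0=m and \<kappa>="\<omega> y e"])
    show "?O \<in> sets (quenched_law \<omega> z)" unfolding Q.sets_Q by (rule path_pred_event) measurable
    fix X N assume "X \<in> ?O"
    then obtain n where "n \<ge> N" "X n = y" by blast
    then show "\<exists>n\<ge>N. path_prefix n X \<noteq> [] \<and> last (path_prefix n X) = y"
      by (intro exI[of _ "Suc n"]) (simp add: path_prefix_Suc)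
  next
    fix \<pi> :: "site list"
    show "{X. X (length \<pi>) = y + e} \<in> sets (quenched_law \<omega> z)" unfolding Q.sets_Q by (rule path_pred_event) measurable
  next
    fix \<pi> :: "site list" assume \<pi>: "\<pi> \<noteq> [] \<and> last \<pi> = y"
    have "qprob \<omega> z (cylinder \<pi> \<inter> {X. X (length \<pi>) = y + e}) = path_weight \<omega> z \<pi> * \<omega> y e"
      using \<pi> e by (simp add: cylinder_snoc_step measure_quenched_law_cylinder[OF \<omega>] path_weight_snoc transition_def)
    then show "\<omega> y e * qprob \<omega> z (cylinder \<pi>) \<le>
        qprob \<omega> z (cylinder \<pi> \<inter> {X. X (length \<pi>) = y + e})"
      by (simp add: measure_quenched_law_cylinder[OF \<omega>])
  qed (use pos in auto)
qed

lemma AE_recurrent_site_neighbour: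
  assumes e: "e \<in> unit_steps"
  shows "AE X in walk_law z. (\<exists>\<^sub>\<infinity>n. X n = y) \<longrightarrow> (\<exists>\<^sub>\<infinity>n. X n = y + e)"
proof -
  interpret W: path_measure "walk_law z" by (rule walk_law_path_measure)
  let ?O = "\<lambda>m. {X. (\<forall>N. \<exists>n\<ge>N. X n = y) \<and> (\<forall>n\<ge>m. X n \<noteq> y + e)}"
  have O: "?O m \<in> sets path_space" for m
    by (rule path_pred_event) measurable
  have "aprob z (?O m) = 0" for m
  proof (rule walk_law_null[OF O])
    show "AE \<omega> in P. qprob \<omega> z (?O m) = 0"
      using AE_env_positive AE_space
    proof eventually_elim
      case (elim \<omega>)
      then have "0 < \<omega> y e" "\<omega> \<in> space env_space" using e space_P by blast+
      then show ?case by (intro quenched_visits_neighbour e)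
    qed
  qed
  then have "AE X in walk_law z. \<forall>m. X \<notin> ?O m"
    by (subst AE_all_countable) (intro allI W.AE_notin_of_measure_zero, simp_all only: W.sets_Q O)
  then show ?thesis
    by eventually_elim (auto simp: frequently_nat_iff)
qed

text \<open>
  At a site visited for the first time the environment is independent of the past, so under the annealed law
  every fresh visit to \<open>S\<close> is a trial with success probability \<open>mean_step e\<close>.
\<close>

lemma AE_fresh_site_neighbour:
  assumes e: "e \<in> unit_steps"
  shows "AE X in walk_law z. (\<exists>\<^sub>\<infinity>n. X n \<in> S \<and> X n \<notin> X ` {..<n}) \<longrightarrow> (\<exists>\<^sub>\<infinity>n. X n - e \<in> S)"
proof -
  interpret W: path_measure "walk_law z" by (rule walk_law_path_measure)
  let ?O = "\<lambda>m. {X. (\<forall>N. \<exists>n\<ge>N. X n \<in> S \<and> (\<forall>i<n. X n \<noteq> X i)) \<and> (\<forall>n\<ge>m. X n - e \<notin> S)}"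
  have O: "?O m \<in> sets path_space" for m
    by (rule path_pred_event) measurable
  have "aprob z (?O m) = 0" for m
  proof (rule W.recurrent_trials[where \<phi>="\<lambda>\<pi>. \<pi> \<noteq> [] \<and> last \<pi> \<in> S \<and> last \<pi> \<notin> set (butlast \<pi>)"
        and H="\<lambda>\<pi>. {X. X (length \<pi>) = last \<pi> + e}" and N\<^sub>0=m and \<kappa>="mean_step e"])
    show "?O m \<in> sets (walk_law z)" using O by (simp add: W.sets_Q)
    fix X N assume "X \<in> ?O m"
    then obtain n where "n \<ge> N" "X n \<in> S" "\<forall>i<n. X n \<noteq> X i" by blast
    then show "\<exists>n\<ge>N. path_prefix n X \<noteq> [] \<and> last (path_prefix n X) \<in> S \<and> last (path_prefix n X) \<notin> set (butlast (path_prefix n X))"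
      by (intro exI[of _ "Suc n"]) (auto simp: path_prefix_Suc set_path_prefix)
  next
    fix \<pi> :: "site list"
    show "{X. X (length \<pi>) = last \<pi> + e} \<in> sets (walk_law z)" unfolding W.sets_Q by (rule path_pred_event) measurable
  next
    fix \<pi> :: "site list"
    assume \<pi>: "\<pi> \<noteq> [] \<and> last \<pi> \<in> S \<and> last \<pi> \<notin> set (butlast \<pi>)"
    have "aprob z (cylinder \<pi> \<inter> {X. X (length \<pi>) = last \<pi> + e}) =
        (\<integral>\<omega>. path_weight \<omega> z \<pi> * transition \<omega> (last \<pi>) (last \<pi> + e) \<partial>P)"
      using \<pi> by (simp add: cylinder_snoc_step measure_walk_law_cylinder path_weight_snoc)
    also have "\<dots> = (\<integral>\<omega>. path_weight \<omega> z \<pi> \<partial>P) * (\<integral>\<omega>. transition \<omega> (last \<pi>) (last \<pi> + e) \<partial>P)"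
    proof (rule integral_mult_determined_by)
      show "determined_by (\<lambda>\<omega>. path_weight \<omega> z \<pi>) (set (butlast \<pi>))"
        by (rule determined_by_path_weight) simp
      show "determined_by (\<lambda>\<omega>. transition \<omega> (last \<pi>) (last \<pi> + e)) {last \<pi>}"
        by (simp add: determined_by_def transition_def)
      show "(\<lambda>\<omega>. path_weight \<omega> z \<pi>) \<in> borel_measurable env_space" using \<pi> by (simp add: path_weight_eq)
      show "integrable P (\<lambda>\<omega>. transition \<omega> (last \<pi>) (last \<pi> + e))"
        by (rule integrable_bounded) (simp_all add: transition_nonneg transition_le_1)
    qed (use \<pi> in \<open>auto simp: integrable_path_weight\<close>)
    finally show "mean_step e * aprob z (cylinder \<pi>) \<le>
        aprob z (cylinder \<pi> \<inter> {X. X (length \<pi>) = last \<pi> + e})"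
      by (simp add: integral_transition[OF e] measure_walk_law_cylinder)
  next
    fix X and \<pi> :: "site list"
    assume X: "X \<in> ?O m" "\<pi> \<noteq> [] \<and> last \<pi> \<in> S \<and> last \<pi> \<notin> set (butlast \<pi>)" "m \<le> length \<pi>"
    then have "X (length \<pi>) - e \<notin> S" by blast
    with X(2) show "X \<notin> {X. X (length \<pi>) = last \<pi> + e}" by auto
  qed (rule mean_step_pos[OF e])
  then have "AE X in walk_law z. \<forall>m. X \<notin> ?O m"
    by (subst AE_all_countable) (intro allI W.AE_notin_of_measure_zero, simp_all only: W.sets_Q O)
  then show ?thesis
  proof eventually_elim
    case (elim X)
    have "(\<exists>i<n. X n = X i) \<longleftrightarrow> X n \<in> X ` {..<n}" for n by auto
    with elim show ?case by (auto simp: frequently_nat_iff)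
  qed
qed

text \<open>
  If no single site of \<open>S\<close> is visited infinitely often, then infinitely many visits to \<open>S\<close> are first visits to
  their sites, since finitely many sites cannot absorb infinitely many visits.
\<close>

lemma AE_visits_translate:
  assumes e: "e \<in> unit_steps"
  shows "AE X in walk_law z. (\<exists>\<^sub>\<infinity>n. X n \<in> S) \<longrightarrow> (\<exists>\<^sub>\<infinity>n. X n - e \<in> S)"
proof -
  have "AE X in walk_law z. \<forall>y. (\<exists>\<^sub>\<infinity>n. X n = y) \<longrightarrow> (\<exists>\<^sub>\<infinity>n. X n = y + e)"
    by (subst AE_all_countable) (use AE_recurrent_site_neighbour[OF e] in blast)
  with AE_fresh_site_neighbour[OF e, of S z] show ?thesis
  proof eventually_elim
    case (elim X)
    show ?case
    proof
      assume inf: "\<exists>\<^sub>\<infinity>n. X n \<in> S"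
      show "\<exists>\<^sub>\<infinity>n. X n - e \<in> S"
      proof (cases "\<exists>y\<in>S. \<exists>\<^sub>\<infinity>n. X n = y")
        case True
        then obtain y where y: "y \<in> S" "\<exists>\<^sub>\<infinity>n. X n = y" by blast
        then have "\<exists>\<^sub>\<infinity>n. X n = y + e" using elim by blast
        then show ?thesis by (rule INFM_mono) (use y in auto)
      next
        case False
        have "\<exists>\<^sub>\<infinity>n. X n \<in> S \<and> X n \<notin> X ` {..<n}"
        proof (rule ccontr)
          assume "\<not> ?thesis"
          then obtain N where N: "\<And>n. n \<ge> N \<Longrightarrow> X n \<in> S \<Longrightarrow> X n \<in> X ` {..<n}"
            by (auto simp: frequently_nat_iff)
          have "X n \<in> X ` {..<N}" if "X n \<in> S" for n
            using that
          proof (induction n rule: less_induct)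
            case (less n)
            then show ?case using N[of n] by (cases "n < N") force+
          qed
          then have "X ` {n. X n \<in> S} \<subseteq> X ` {..<N}" by blast
          then have "finite (X ` {n. X n \<in> S})" by (rule finite_subset) simp
          moreover have "infinite {n. X n \<in> S}" using inf by (simp add: INFM_iff_infinite)
          ultimately obtain m where m: "m \<in> {n. X n \<in> S}" "infinite {n \<in> {n. X n \<in> S}. X n = X m}"
            using pigeonhole_infinite by blast
          then have "infinite {n. X n = X m}" by (rule_tac infinite_super[rotated]) auto
          with m False show False by (auto simp: INFM_iff_infinite)
        qed
        then show ?thesis using elim by blast
      qed
    qed
  qed
qed

end

section \<open>Escape in one of two opposite directions\<close>

text \<open>
  The normalisation \<open>v e = 1\<close> together with \<open>\<bar>v s\<bar> \<le> 1\<close> for all unit steps \<open>s\<close> has two consequences: a walk cannot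
  jump over a level \<open>\<lceil>v x\<rceil> = k\<close>, and the step \<open>e\<close> carries each level onto the next one. Both properties are
  symmetric under \<open>v \<mapsto> - v\<close>, \<open>e \<mapsto> - e\<close>, which reduces statements on downward escape to upward escape.
\<close>

definition coordinate_height :: "(site \<Rightarrow> real) \<Rightarrow> site \<Rightarrow> bool" where
  "coordinate_height v e \<longleftrightarrow> (\<forall>x y. v (x + y) = v x + v y) \<and> e \<in> unit_steps \<and> v e = 1 \<and>
     (\<forall>s\<in>unit_steps. \<bar>v s\<bar> \<le> 1)"

lemma height_add: "coordinate_height v e \<Longrightarrow> v (x + y) = v x + v y"
  unfolding coordinate_height_def by blast

lemma height_zero: "coordinate_height v e \<Longrightarrow> v 0 = 0"
  using height_add[of v e 0 0] by simp

lemma height_diff: "coordinate_height v e \<Longrightarrow> v (x - y) = v x - v y"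
  using height_add[of v e "x - y" y] by simp

lemma height_step: "coordinate_height v e \<Longrightarrow> e \<in> unit_steps" "coordinate_height v e \<Longrightarrow> v e = 1"
  unfolding coordinate_height_def by blast+

lemma height_walk_step: "coordinate_height v e \<Longrightarrow> y - x \<in> unit_steps \<Longrightarrow> \<bar>v y - v x\<bar> \<le> 1"
  using height_diff[of v e y x] unfolding coordinate_height_def by metis

lemma uminus_unit_step: "e \<in> unit_steps \<Longrightarrow> - e \<in> unit_steps"
  by (auto simp: unit_steps_eq)

lemma coordinate_height_uminus: "coordinate_height v e \<Longrightarrow> coordinate_height (\<lambda>x. - v x) (- e)"
  using height_diff[of v e 0 e] height_zero[of v e]
  unfolding coordinate_height_def by (auto simp: uminus_unit_step simp del: split_paired_All)

lemma ceiling_diff_le_1: "\<bar>a - b\<bar> \<le> 1 \<Longrightarrow> \<bar>\<lceil>a\<rceil> - \<lceil>b\<rceil>\<bar> \<le> (1::int)" for a b :: real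
  by linarith

abbreviation escapes :: "(site \<Rightarrow> real) \<Rightarrow> path set" where
  "escapes v \<equiv> {X. filterlim (\<lambda>n. v (X n)) at_top sequentially}"

lemma filterlim_at_top_nat_iff:
  "filterlim f at_top sequentially \<longleftrightarrow> (\<forall>k. \<exists>N. \<forall>n\<ge>N. real k \<le> f n)" for f :: "nat \<Rightarrow> real"
proof
  assume "filterlim f at_top sequentially"
  then show "\<forall>k. \<exists>N. \<forall>n\<ge>N. real k \<le> f n"
    by (simp add: filterlim_at_top eventually_sequentially)
next
  assume *: "\<forall>k. \<exists>N. \<forall>n\<ge>N. real k \<le> f n"
  show "filterlim f at_top sequentially"
    unfolding filterlim_at_top eventually_sequentially
  proof
    fix c :: real
    obtain k :: nat where "c \<le> real k" using real_arch_simple by blast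
    with * show "\<exists>N. \<forall>n\<ge>N. c \<le> f n" by (meson order_trans)
  qed
qed

lemma measurable_height [measurable]:
  fixes v :: "site \<Rightarrow> real"
  shows "(\<lambda>X. v (X n)) \<in> borel_measurable path_space"
  by (rule measurable_compose[OF measurable_path_component]) simp

lemma escapes_measurable [measurable]: "escapes v \<in> sets path_space"
proof -
  have "{X \<in> space path_space. \<forall>k. \<exists>N. \<forall>n\<ge>N. real k \<le> v (X n)} \<in> sets path_space" by measurable
  then show ?thesis by (simp add: filterlim_at_top_nat_iff)
qed

lemma pred_escapes [measurable]:
  fixes v :: "site \<Rightarrow> real"
  shows "Measurable.pred path_space (\<lambda>X. filterlim (\<lambda>n. v (X n)) at_top sequentially)"
  using escapes_measurable[of v] by (simp add: pred_def)

text \<open>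
  If one level is visited infinitely often, then so are all. Otherwise the level leaves every bounded interval,
  and it cannot change sign without visiting level zero.
\<close>

lemma walk_level_trichotomy:
  assumes v: "coordinate_height v e" and X: "walk z X"
    and up: "\<And>k. (\<exists>\<^sub>\<infinity>n. \<lceil>v (X n)\<rceil> = k) \<Longrightarrow> (\<exists>\<^sub>\<infinity>n. \<lceil>v (X n)\<rceil> = k + 1)"
    and down: "\<And>k. (\<exists>\<^sub>\<infinity>n. \<lceil>v (X n)\<rceil> = k) \<Longrightarrow> (\<exists>\<^sub>\<infinity>n. \<lceil>v (X n)\<rceil> = k - 1)"
  shows "X \<in> escapes v \<or> X \<in> escapes (\<lambda>x. - v x) \<or> (\<forall>k. \<exists>\<^sub>\<infinity>n. \<lceil>v (X n)\<rceil> = k)"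
proof (cases "\<exists>k. \<exists>\<^sub>\<infinity>n. \<lceil>v (X n)\<rceil> = k")
  case True
  then obtain k where k: "\<exists>\<^sub>\<infinity>n. \<lceil>v (X n)\<rceil> = k" by blast
  have "\<exists>\<^sub>\<infinity>n. \<lceil>v (X n)\<rceil> = j" for j
  proof (induction j rule: int_induct[of _ k])
    case base
    show ?case by (rule k)
  qed (use up down in blast)+
  then show ?thesis by blast
next
  case False
  let ?L = "\<lambda>n. \<lceil>v (X n)\<rceil>"
  have ev: "\<forall>\<^sub>F n in sequentially. ?L n \<noteq> k" for k
    using False by (auto simp: not_frequently cofinite_eq_sequentially)
  have far: "\<forall>\<^sub>F n in sequentially. ?L n \<notin> {-m..m}" for m
  proof -
    have "\<forall>\<^sub>F n in sequentially. \<forall>k\<in>{-m..m}. ?L n \<noteq> k"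
      using ev by (intro eventually_ball_finite) auto
    then show ?thesis by eventually_elim blast
  qed
  have step_le: "\<bar>?L (Suc n) - ?L n\<bar> \<le> 1" for n
    by (rule ceiling_diff_le_1, rule height_walk_step[OF v]) (use X in \<open>simp add: walk_def\<close>)
  obtain N where N: "\<And>n. n \<ge> N \<Longrightarrow> ?L n \<noteq> 0"
    using ev[of 0] by (auto simp: eventually_sequentially)
  have sign: "(?L N > 0 \<longrightarrow> ?L n > 0) \<and> (?L N < 0 \<longrightarrow> ?L n < 0)" if "n \<ge> N" for n
    using that
  proof (induction n rule: dec_induct)
    case (step n)
    have "?L (Suc n) \<noteq> 0" using N[of "Suc n"] step.hyps by simp
    with step_le[of n] step.IH show ?case by (smt (verit))
  qed simp
  \<comment> \<open>the margin of one absorbs the rounding in \<open>\<lceil>v x\<rceil>\<close>\<close>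
  have far': "\<exists>M. \<forall>n\<ge>M. n \<ge> N \<and> ?L n \<notin> {-int k-1..int k+1}" for k
    using eventually_conj[OF far[of "int k + 1"] eventually_ge_at_top[of N]]
    by (auto simp: eventually_sequentially)
  have "?L N > 0 \<or> ?L N < 0" using N[OF order_refl] by linarith
  then show ?thesis
  proof
    assume pos: "?L N > 0"
    have "\<exists>M. \<forall>n\<ge>M. real k \<le> v (X n)" for k
    proof -
      obtain M where M: "\<forall>n\<ge>M. n \<ge> N \<and> ?L n \<notin> {-int k-1..int k+1}" using far' by blast
      have "real k \<le> v (X n)" if "n \<ge> M" for n
      proof -
        have n: "n \<ge> N" "?L n \<notin> {-int k-1..int k+1}" using M that by blast+
        with sign[OF n(1)] pos have "?L n > int k + 1" unfolding atLeastAtMost_iff by linarith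
        then show ?thesis by linarith
      qed
      then show ?thesis by blast
    qed
    then show ?thesis by (simp add: filterlim_at_top_nat_iff)
  next
    assume neg: "?L N < 0"
    have "\<exists>M. \<forall>n\<ge>M. real k \<le> - v (X n)" for k
    proof -
      obtain M where M: "\<forall>n\<ge>M. n \<ge> N \<and> ?L n \<notin> {-int k-1..int k+1}" using far' by blast
      have "real k \<le> - v (X n)" if "n \<ge> M" for n
      proof -
        have n: "n \<ge> N" "?L n \<notin> {-int k-1..int k+1}" using M that by blast+
        with sign[OF n(1)] neg have "?L n < - int k - 1" unfolding atLeastAtMost_iff by linarith
        then show ?thesis by linarith
      qed
      then show ?thesis by blast
    qed
    then show ?thesis by (simp add: filterlim_at_top_nat_iff)
  qed
qed

text \<open>
  The gap of one, instead of a mere inequality, takes the walk off its initial level at once, so that it meets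
  this level only at its starting point.
\<close>

definition stays_above :: "(site \<Rightarrow> real) \<Rightarrow> path set" where
  "stays_above v = {X. \<forall>n\<ge>1. v (X 0) + 1 \<le> v (X n)}"

lemma stays_above_measurable [measurable]: "stays_above v \<in> sets path_space"
proof -
  have "{X \<in> space path_space. \<forall>n\<ge>1. v (X 0) + 1 \<le> v (X n)} \<in> sets path_space" by measurable
  then show ?thesis by (simp add: stays_above_def)
qed

definition escape_above :: "(site \<Rightarrow> real) \<Rightarrow> path set" where
  "escape_above v = stays_above v \<inter> escapes v"

lemma escape_above_measurable [measurable]: "escape_above v \<in> sets path_space"
  by (simp add: escape_above_def)

context elliptic_environment begin

lemma integrable_bounded_mult:
  fixes f g :: "_ \<Rightarrow> real"
  assumes f: "f \<in> borel_measurable env_space" "\<And>\<omega>. \<omega> \<in> space env_space \<Longrightarrow> 0 \<le> f \<omega> \<and> f \<omega> \<le> 1"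
    and g: "g \<in> borel_measurable env_space" "\<And>\<omega>. \<omega> \<in> space env_space \<Longrightarrow> 0 \<le> g \<omega> \<and> g \<omega> \<le> 1"
  shows "integrable P (\<lambda>\<omega>. f \<omega> * g \<omega>)"
proof (rule integrable_bounded)
  show "(\<lambda>\<omega>. f \<omega> * g \<omega>) \<in> borel_measurable env_space" using f(1) g(1) by measurable
  fix \<omega> assume "\<omega> \<in> space env_space"
  then show "0 \<le> f \<omega> * g \<omega> \<and> f \<omega> * g \<omega> \<le> 1" using f(2) g(2) by (simp add: mult_le_one)
qed

lemma AE_walk_level_trichotomy:
  assumes v: "coordinate_height v e"
  shows "AE X in walk_law z. X \<in> escapes v \<or> X \<in> escapes (\<lambda>x. - v x) \<or> (\<forall>k. \<exists>\<^sub>\<infinity>n. \<lceil>v (X n)\<rceil> = k)"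
proof -
  have e: "e \<in> unit_steps" "- e \<in> unit_steps" using height_step[OF v] uminus_unit_step by auto
  have "AE X in walk_law z. \<forall>k. (\<exists>\<^sub>\<infinity>n. X n \<in> {x. \<lceil>v x\<rceil> = k}) \<longrightarrow> (\<exists>\<^sub>\<infinity>n. X n - e \<in> {x. \<lceil>v x\<rceil> = k})"
    by (subst AE_all_countable) (intro allI AE_visits_translate e)
  moreover have "AE X in walk_law z. \<forall>k. (\<exists>\<^sub>\<infinity>n. X n \<in> {x. \<lceil>v x\<rceil> = k}) \<longrightarrow> (\<exists>\<^sub>\<infinity>n. X n - (- e) \<in> {x. \<lceil>v x\<rceil> = k})"
    by (subst AE_all_countable) (intro allI AE_visits_translate e)
  moreover note AE_walk_law_walk
  ultimately show ?thesis
  proof eventually_elim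
    case (elim X)
    have up: "\<lceil>v (x - e)\<rceil> = k \<longleftrightarrow> \<lceil>v x\<rceil> = k + 1" for x k
      using height_diff[OF v] height_step[OF v] by simp linarith
    have down: "\<lceil>v (x - (- e))\<rceil> = k \<longleftrightarrow> \<lceil>v x\<rceil> = k - 1" for x k
      using height_add[OF v] height_step[OF v] by simp linarith
    show ?case
      by (rule walk_level_trichotomy[OF v elim(3)]) (use elim(1,2) in \<open>simp_all only: mem_Collect_eq up down\<close>)
  qed
qed

lemma measure_stays_above:
  assumes v: "coordinate_height v e"
  shows "aprob x (stays_above v) = aprob 0 (stays_above v)"
proof -
  have "{X. (\<lambda>n. X n - x) \<in> stays_above v} = stays_above v"
    by (simp add: stays_above_def height_diff[OF v])
  then show ?thesis using walk_law_translate[of "stays_above v" 0 x] by simp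
qed

text \<open>
  The trials are the records of the height: all sites left so far lie strictly below the current one, and a
  future that stays above the record never leaves from them, so that it is independent of the past. A success
  contradicts the return to low levels.
\<close>

lemma no_oscillation:
  assumes v: "coordinate_height v e" and pos: "aprob 0 (stays_above v) > 0"
  shows "AE X in walk_law 0. \<not> (\<forall>k. \<exists>\<^sub>\<infinity>n. \<lceil>v (X n)\<rceil> = k)"
proof -
  interpret W: path_measure "walk_law 0" by (rule walk_law_path_measure)
  let ?O = "{X. \<forall>k. \<forall>N. \<exists>n\<ge>N. \<lceil>v (X n)\<rceil> = k}"
  let ?\<phi> = "\<lambda>\<pi>. \<pi> \<noteq> [] \<and> (\<forall>x\<in>set (butlast \<pi>). v x < v (last \<pi>))"
  let ?H = "\<lambda>\<pi>. {X. path_shift (length \<pi> - 1) X \<in> stays_above v}"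
  have O: "?O \<in> sets path_space"
    by (rule path_pred_event) measurable
  have "aprob 0 ?O = 0"
  proof (rule W.recurrent_trials[where \<phi>="?\<phi>" and H="?H" and N\<^sub>0=0 and \<kappa>="aprob 0 (stays_above v)"])
    show "?O \<in> sets (walk_law 0)" using O by (simp only: W.sets_Q)
    fix X :: "path" and N :: nat assume X: "X \<in> ?O"
    \<comment> \<open>the first time after \<open>N\<close> at which the maximum \<open>b\<close> up to time \<open>N\<close> is exceeded is a record\<close>
    define b where "b = Max ((\<lambda>i. v (X i)) ` {..N})"
    have b: "v (X i) \<le> b" if "i \<le> N" for i
      unfolding b_def using that by (intro Max_ge) auto
    have "\<exists>n. b < v (X n)"
    proof -
      obtain n where "\<lceil>v (X n)\<rceil> = \<lceil>b\<rceil> + 1" using X by blast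
      then have "b < v (X n)" by linarith
      then show ?thesis by blast
    qed
    then obtain n where n: "b < v (X n)" and least: "\<And>m. m < n \<Longrightarrow> \<not> b < v (X m)"
      using exists_least_iff[of "\<lambda>n. b < v (X n)"] by blast
    have "n > N" using b[of n] n by (cases "n \<le> N") auto
    moreover have "v (X i) < v (X n)" if "i < n" for i using least[OF that] n by linarith
    ultimately show "\<exists>n\<ge>N. ?\<phi> (path_prefix n X)"
      by (intro exI[of _ "Suc n"]) (auto simp: path_prefix_Suc set_path_prefix)
  next
    fix \<pi> :: "site list"
    show "?H \<pi> \<in> sets (walk_law 0)"
      unfolding W.sets_Q by (rule path_event_measurable[OF path_shift_measurable]) simp
  next
    fix \<pi> :: "site list" assume \<pi>: "?\<phi> \<pi>"
    let ?B = "\<lambda>n. {\<rho>. \<forall>i. 1 \<le> i \<longrightarrow> i < length \<rho> \<longrightarrow> v (\<rho> ! 0) + 1 \<le> v (\<rho> ! i)}"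
    have eq: "stays_above v = {X. \<forall>n. path_prefix n X \<in> ?B n}"
    proof (intro equalityI subsetI)
      fix X assume X: "X \<in> {X. \<forall>n. path_prefix n X \<in> ?B n}"
      have "v (X 0) + 1 \<le> v (X n)" if "n \<ge> 1" for n
      proof -
        have "path_prefix (Suc n) X \<in> ?B (Suc n)" using X by blast
        then have "v (path_prefix (Suc n) X ! 0) + 1 \<le> v (path_prefix (Suc n) X ! n)" using that by auto
        then show ?thesis by simp
      qed
      then show "X \<in> stays_above v" by (simp add: stays_above_def)
    qed (auto simp: stays_above_def)
    have "aprob 0 (cylinder \<pi> \<inter> {X. path_shift (length \<pi> - 1) X \<in> {X. \<forall>n. path_prefix n X \<in> ?B n}}) =
      aprob 0 (cylinder \<pi>) * aprob (last \<pi>) {X. \<forall>n. path_prefix n X \<in> ?B n}"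
    proof (rule walk_law_regeneration)
      fix n \<rho> assume \<rho>: "\<rho> \<in> ?B n" "hd \<rho> = last \<pi>"
      show "set (butlast \<rho>) \<inter> set (butlast \<pi>) = {}"
      proof -
        have "v (last \<pi>) \<le> v x" if "x \<in> set \<rho>" for x
        proof -
          obtain i where i: "i < length \<rho>" "x = \<rho> ! i" using \<open>x \<in> set \<rho>\<close> by (auto simp: in_set_conv_nth)
          then have "\<rho> ! 0 = last \<pi>" using \<rho>(2) by (cases \<rho>) auto
          moreover have "i \<noteq> 0 \<Longrightarrow> v (\<rho> ! 0) + 1 \<le> v (\<rho> ! i)" using i \<rho>(1) by auto
          ultimately show ?thesis using i by (cases "i = 0") auto
        qed
        then show ?thesis using \<pi> by (meson disjoint_iff in_set_butlastD not_le)
      qed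
    next
      fix n X assume *: "path_prefix (Suc n) X \<in> ?B (Suc n)"
      show "path_prefix n X \<in> ?B n"
      proof (intro CollectI allI impI)
        fix i assume "1 \<le> i" "i < length (path_prefix n X)"
        moreover have "v (path_prefix (Suc n) X ! 0) + 1 \<le> v (path_prefix (Suc n) X ! i)"
          using * calculation by auto
        ultimately show "v (path_prefix n X ! 0) + 1 \<le> v (path_prefix n X ! i)" by auto
      qed
    qed (use \<pi> in blast)
    then show "aprob 0 (stays_above v) * aprob 0 (cylinder \<pi>) \<le>
        aprob 0 (cylinder \<pi> \<inter> ?H \<pi>)"
      unfolding eq[symmetric] by (simp add: measure_stays_above[OF v, of "last \<pi>"])
  next
    fix X :: "path" and \<pi> :: "site list" assume X: "X \<in> ?O"
    show "X \<notin> ?H \<pi>"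
    proof
      assume "X \<in> ?H \<pi>"
      then have *: "v (X (length \<pi> - 1)) + 1 \<le> v (X (length \<pi> - 1 + n))" if "n \<ge> 1" for n
        using that by (auto simp: stays_above_def path_shift_apply)
      let ?m = "length \<pi> - 1"
      \<comment> \<open>a level well below the record, visited again after it\<close>
      obtain n where n: "n \<ge> ?m + 1" "\<lceil>v (X n)\<rceil> = \<lfloor>v (X ?m)\<rfloor> - 1" using X by blast
      then have "v (X ?m) + 1 \<le> v (X n)" using *[of "n - ?m"] by auto
      with n show False by linarith
    qed
  qed (rule pos)
  from W.AE_notin_of_measure_zero[OF _ this] O have "AE X in walk_law 0. X \<notin> ?O" by (simp only: W.sets_Q)
  then show ?thesis by (simp add: frequently_nat_iff)
qed

text \<open>
  An escaping path attains its minimal height, so with positive probability it stays above its position at some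
  fixed time and fixed site; by translation it may do so from the site \<open>e\<close>, which is entered from the origin with
  positive probability. The initial step \<open>e\<close> provides the gap of one.
\<close>

lemma escape_above_pos:
  assumes v: "coordinate_height v e" and pos: "aprob 0 (escapes v) > 0"
  shows "aprob 0 (escape_above v) > 0"
proof -
  interpret W: path_measure "walk_law 0" by (rule walk_law_path_measure)
  let ?G = "{X. (\<forall>n. v (X 0) \<le> v (X n)) \<and> X \<in> escapes v}"
  have G [measurable]: "?G \<in> sets path_space"
    unfolding mem_Collect_eq by (rule path_pred_event) measurable
  let ?C = "\<lambda>\<pi>. cylinder \<pi> \<inter> {X. path_shift (length \<pi> - 1) X \<in> ?G}"
  have C: "?C \<pi> \<in> sets path_space" for \<pi>
    by (intro sets.Int cylinder_in_path path_event_measurable[OF path_shift_measurable G])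
  have cover: "escapes v \<subseteq> (\<Union>\<pi>\<in>- {[]}. ?C \<pi>)"
  proof
    fix X assume X: "X \<in> escapes v"
    then obtain N where N: "\<And>n. n \<ge> N \<Longrightarrow> v (X 0) \<le> v (X n)"
      by (auto simp: filterlim_at_top eventually_sequentially)
    have "finite {..N}" "{..N} \<noteq> {}" by auto
    then obtain m where m: "m \<le> N" "\<And>n. n \<le> N \<Longrightarrow> v (X m) \<le> v (X n)"
      using ex_min_if_finite[of "(\<lambda>n. v (X n)) ` {..N}"] by (force simp: not_less)
    have min: "v (X m) \<le> v (X n)" for n
      using m(2)[of n] m(2)[of 0] N[of n] by (cases "n \<le> N") auto
    have "filterlim (\<lambda>n. v (X (n + m))) at_top sequentially"
      using X eventually_sequentially_seg[of "\<lambda>n. c \<le> v (X n)" m for c] by (simp add: filterlim_at_top)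
    then have "X \<in> ?C (path_prefix (Suc m) X)"
      using min by (simp add: path_shift_apply add.commute)
    then show "X \<in> (\<Union>\<pi>\<in>- {[]}. ?C \<pi>)"
      by (rule UN_I[rotated]) (simp add: path_prefix_Suc)
  qed
  have "\<exists>\<pi>. \<pi> \<noteq> [] \<and> aprob 0 (?C \<pi>) > 0"
  proof (rule ccontr)
    assume *: "\<nexists>\<pi>. \<pi> \<noteq> [] \<and> aprob 0 (?C \<pi>) > 0"
    have "?C \<pi> \<in> null_sets (walk_law 0)" if "\<pi> \<in> - {[]}" for \<pi>
    proof -
      have "aprob 0 (?C \<pi>) = 0"
        using * that measure_nonneg[of "walk_law 0" "?C \<pi>"]
        by (simp only: Compl_iff singleton_iff) (meson not_less order_antisym)
      then show ?thesis
        using C by (intro null_setsI) (simp_all only: W.emeasure_eq_measure W.sets_Q ennreal_0)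
    qed
    then have null: "(\<Union>\<pi>\<in>- {[]}. ?C \<pi>) \<in> null_sets (walk_law 0)"
      by (rule null_sets_UN'[OF countableI_type])
    have "aprob 0 (\<Union>\<pi>\<in>- {[]}. ?C \<pi>) = 0"
      using null_setsD1[OF null] by (simp only: measure_def enn2real_0)
    moreover note null_setsD2[OF null]
    ultimately show False using W.finite_measure_mono[OF cover] pos by linarith
  qed
  then obtain \<pi> where \<pi>: "\<pi> \<noteq> []" "aprob 0 (?C \<pi>) > 0" by blast
  have translate: "aprob x ?G = aprob 0 ?G" for x
  proof -
    have "filterlim (\<lambda>n. v (X n - x)) at_top sequentially \<longleftrightarrow> X \<in> escapes v" for X
    proof -
      have "filterlim (\<lambda>n. v (X n) + (- v x)) at_top sequentially \<longleftrightarrow> filterlim (\<lambda>n. v (X n)) at_top sequentially"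
        using filterlim_tendsto_add_at_top_iff[of "\<lambda>_. - v x" "- v x" sequentially "\<lambda>n. v (X n)"]
        by (simp add: add.commute)
      then show ?thesis by (simp add: height_diff[OF v])
    qed
    then have "{X. (\<lambda>n. X n - x) \<in> ?G} = ?G" by (simp add: height_diff[OF v])
    then show ?thesis using walk_law_translate[OF G, of 0 x] by simp
  qed
  have "aprob 0 (?C \<pi>) = (\<integral>\<omega>. path_weight \<omega> 0 \<pi> * qprob \<omega> (last \<pi>) ?G \<partial>P)"
    unfolding measure_walk_law[OF C]
    by (intro Bochner_Integration.integral_cong refl quenched_Markov[OF _ \<pi>(1) G]) (simp add: space_P)
  also have "\<dots> \<le> (\<integral>\<omega>. qprob \<omega> (last \<pi>) ?G \<partial>P)"
  proof (rule integral_mono_AE)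
    have b: "0 \<le> path_weight \<omega> 0 \<pi>" "path_weight \<omega> 0 \<pi> \<le> 1" if "\<omega> \<in> space env_space" for \<omega>
      using \<pi>(1) that by (auto simp: path_weight_eq weight_nonneg weight_le_1)
    have m: "(\<lambda>\<omega>. path_weight \<omega> 0 \<pi>) \<in> borel_measurable env_space" using \<pi>(1) by (simp add: path_weight_eq)
    show "integrable P (\<lambda>\<omega>. path_weight \<omega> 0 \<pi> * qprob \<omega> (last \<pi>) ?G)"
      by (rule integrable_bounded_mult[OF m _ measurable_quenched_measure[OF G]]) (simp_all add: b quenched_measure_bounds)
    show "integrable P (\<lambda>\<omega>. qprob \<omega> (last \<pi>) ?G)" by (rule integrable_quenched_measure[OF G])
    show "AE \<omega> in P. path_weight \<omega> 0 \<pi> * qprob \<omega> (last \<pi>) ?G \<le> qprob \<omega> (last \<pi>) ?G"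
      by (rule AE_I2) (auto simp: space_P b quenched_measure_bounds intro!: mult_left_le_one_le)
  qed
  also have "\<dots> = aprob 0 ?G" 
    unfolding measure_walk_law[OF G, symmetric] by (rule translate)
  finally have Gpos: "0 < aprob e ?G" using \<pi>(2) unfolding translate[of e] by linarith
  have e: "e \<in> unit_steps" by (rule height_step[OF v])
  let ?E = "?C [0, e]"
  have "?E \<subseteq> escape_above v"
  proof
    fix X assume X: "X \<in> ?E"
    have X01: "X 0 = 0" "X 1 = e"
      using X cylinder_eqD[of X "[0, e]" 0] cylinder_eqD[of X "[0, e]" 1] by auto
    have "v (X 0) + 1 \<le> v (X n)" if "n \<ge> 1" for n
    proof -
      have "v (X 1) \<le> v (X (1 + (n - 1)))" using X by (auto simp: path_shift_apply)
      then show ?thesis using that X01 height_step[OF v] height_zero[OF v] by simp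
    qed
    moreover have "filterlim (\<lambda>n. v (X (n + 1))) at_top sequentially" using X by (simp add: path_shift_apply)
    then have "X \<in> escapes v" using filterlim_sequentially_Suc[of "\<lambda>n. v (X n)"] by simp
    ultimately show "X \<in> escape_above v" by (simp add: escape_above_def stays_above_def)
  qed
  then have "aprob 0 ?E \<le> aprob 0 (escape_above v)"
    by (intro W.finite_measure_mono) (simp_all add: W.sets_Q)
  moreover have "0 < aprob 0 ?E"
  proof (rule ccontr)
    assume "\<not> 0 < aprob 0 ?E"
    then have "aprob 0 ?E = 0" using measure_nonneg[of "walk_law 0" ?E] by linarith
    moreover have "aprob 0 ?E = (\<integral>\<omega>. path_weight \<omega> 0 [0, e] * qprob \<omega> (last [0, e]) ?G \<partial>P)"
      unfolding measure_walk_law[OF C]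
      by (intro Bochner_Integration.integral_cong refl quenched_Markov[OF _ _ G]) (simp_all add: space_P)
    ultimately have 0: "(\<integral>\<omega>. transition \<omega> 0 e * qprob \<omega> e ?G \<partial>P) = 0"
      by (simp add: path_weight_eq)
    have "AE \<omega> in P. transition \<omega> 0 e * qprob \<omega> e ?G = 0"
    proof (subst integral_nonneg_eq_0_iff_AE[symmetric])
      show "integrable P (\<lambda>\<omega>. transition \<omega> 0 e * qprob \<omega> e ?G)"
        by (rule integrable_bounded_mult[OF measurable_transition _ measurable_quenched_measure[OF G]])
          (simp_all add: transition_nonneg transition_le_1 quenched_measure_bounds)
      show "AE \<omega> in P. 0 \<le> transition \<omega> 0 e * qprob \<omega> e ?G"
        by (rule AE_I2) (simp add: space_P transition_nonneg)
    qed (rule 0)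
    with AE_env_positive have "AE \<omega> in P. qprob \<omega> e ?G = 0"
      by eventually_elim (use e in \<open>auto simp: transition_def simp del: split_paired_All dest!: spec[of _ 0]\<close>)
    then have "aprob e ?G = 0" by (rule walk_law_null[OF G])
    with Gpos show False by simp
  qed
  ultimately show ?thesis by linarith
qed

text \<open>
  The third alternative, oscillation over all levels, is impossible because the walk has a chance to stay above
  its start for ever.
\<close>

lemma AE_escapes_or_escapes_back:
  assumes v: "coordinate_height v e" and pos: "aprob 0 (escapes v) > 0"
  shows "AE X in walk_law 0. X \<in> escapes v \<or> X \<in> escapes (\<lambda>x. - v x)"
proof -
  interpret W: path_measure "walk_law 0" by (rule walk_law_path_measure)
  have "aprob 0 (escape_above v) \<le> aprob 0 (stays_above v)"
    by (intro W.finite_measure_mono) (auto simp: escape_above_def W.sets_Q)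
  with escape_above_pos[OF v pos] have "aprob 0 (stays_above v) > 0" by linarith
  from no_oscillation[OF v this] AE_walk_level_trichotomy[OF v, of 0] show ?thesis
    by eventually_elim blast
qed

end

section \<open>Crossing lattice paths in the plane\<close>

definition adjacent_or_eq :: "site \<Rightarrow> site \<Rightarrow> bool" where
  "adjacent_or_eq x y \<longleftrightarrow> \<bar>fst y - fst x\<bar> + \<bar>snd y - snd x\<bar> \<le> 1"

text \<open>
  The moves of the king in chess. The sites of one level of a slanted height, ordered by their second coordinate,
  form a path of such moves, which a nearest-neighbour path still cannot cross without hitting it.
\<close>

definition king_step :: "site \<Rightarrow> site \<Rightarrow> bool" where
  "king_step x y \<longleftrightarrow> \<bar>fst y - fst x\<bar> \<le> 1 \<and> \<bar>snd y - snd x\<bar> \<le> 1"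

lemma adjacent_or_eq_refl: "adjacent_or_eq x x"
  by (simp add: adjacent_or_eq_def)

lemma king_step_refl: "king_step x x"
  by (simp add: king_step_def)

lemma king_step_if_adjacent: "adjacent_or_eq x y \<Longrightarrow> king_step x y"
  by (auto simp: adjacent_or_eq_def king_step_def)

lemma real_int_endpoint:
  fixes s :: real and p q a :: int
  assumes "0 \<le> s" "s \<le> 1" "\<bar>q - p\<bar> \<le> 1" "real_of_int p + s * (real_of_int q - real_of_int p) = real_of_int a"
  shows "a = p \<or> a = q"
proof -
  consider "q = p" | "q = p + 1" | "q = p - 1" using assms(3) by linarith
  then show ?thesis
  proof cases
    case 2
    then have "real_of_int p \<le> real_of_int a" "real_of_int a \<le> real_of_int p + 1" using assms by auto
    then show ?thesis using 2 by linarith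
  next
    case 3
    then have "real_of_int a \<le> real_of_int p" "real_of_int p - 1 \<le> real_of_int a" using assms by auto
    then show ?thesis using 3 by linarith
  qed (use assms in auto)
qed

lemma int_segments_endpoint:
  fixes s t :: real and p q a b :: int
  assumes s: "0 \<le> s" "s \<le> 1" and t: "0 \<le> t" "t \<le> 1" and "\<bar>q - p\<bar> \<le> 1" "\<bar>b - a\<bar> \<le> 1"
    and eq: "real_of_int p + s * (real_of_int q - real_of_int p) = real_of_int a + t * (real_of_int b - real_of_int a)"
  shows "p = a \<or> p = b \<or> q = a \<or> q = b"
proof -
  consider "q = p" | "q = p + 1" | "q = p - 1" using assms(5) by linarith
  then show ?thesis
  proof cases
    case 1
    then show ?thesis using real_int_endpoint[OF t assms(6), of p] eq by auto
  next
    case 2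
    consider "b = a" | "b = a + 1" | "b = a - 1" using assms(6) by linarith
    then show ?thesis
      using 2 eq s t by cases (simp_all, linarith+)
  next
    case 3
    consider "b = a" | "b = a + 1" | "b = a - 1" using assms(6) by linarith
    then show ?thesis
      using 3 eq s t by cases (simp_all, linarith+)
  qed
qed

lemma horizontal_segment_meets:
  fixes s t :: real and p1 p2 q1 q2 a1 a2 b1 :: int
  assumes s: "0 \<le> s" "s \<le> 1" and t: "0 \<le> t" "t \<le> 1"
    and k: "\<bar>q1 - p1\<bar> \<le> 1" "\<bar>q2 - p2\<bar> \<le> 1" and a: "\<bar>b1 - a1\<bar> \<le> 1"
    and eq1: "real_of_int p1 + s * (real_of_int q1 - real_of_int p1) = real_of_int a1 + t * (real_of_int b1 - real_of_int a1)"
    and eq2: "real_of_int p2 + s * (real_of_int q2 - real_of_int p2) = real_of_int a2"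
  shows "(p2 = a2 \<and> (p1 = a1 \<or> p1 = b1)) \<or> (q2 = a2 \<and> (q1 = a1 \<or> q1 = b1))"
proof (cases "q2 = p2")
  case True
  then show ?thesis using eq2 int_segments_endpoint[OF s t k(1) a eq1] by auto
next
  case False
  then consider "q2 = p2 + 1" | "q2 = p2 - 1" using k(2) by linarith
  then have "(s = 0 \<and> p2 = a2) \<or> (s = 1 \<and> q2 = a2)"
    using real_int_endpoint[OF s k(2) eq2] eq2 by cases auto
  then show ?thesis
    using real_int_endpoint[OF t a, of p1] real_int_endpoint[OF t a, of q1] eq1 by auto
qed

text \<open>
  Only the endpoints of a diagonal have an integer coordinate, so a diagonal can meet an edge of the lattice in a
  lattice point only; overlapping edges share an endpoint as well.
\<close>

lemma lattice_segments_meet: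
  fixes s t :: real
  assumes s: "0 \<le> s" "s \<le> 1" and t: "0 \<le> t" "t \<le> 1"
    and k: "king_step p q" and a: "adjacent_or_eq a b"
    and eq1: "real_of_int (fst p) + s * (real_of_int (fst q) - real_of_int (fst p)) =
      real_of_int (fst a) + t * (real_of_int (fst b) - real_of_int (fst a))"
    and eq2: "real_of_int (snd p) + s * (real_of_int (snd q) - real_of_int (snd p)) =
      real_of_int (snd a) + t * (real_of_int (snd b) - real_of_int (snd a))"
  shows "{p, q} \<inter> {a, b} \<noteq> {}"
proof -
  have k': "\<bar>fst q - fst p\<bar> \<le> 1" "\<bar>snd q - snd p\<bar> \<le> 1" using k by (auto simp: king_step_def)
  have a': "\<bar>fst b - fst a\<bar> \<le> 1" "\<bar>snd b - snd a\<bar> \<le> 1" "fst b = fst a \<or> snd b = snd a"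
    using a by (auto simp: adjacent_or_eq_def)
  from a'(3) show ?thesis
  proof
    assume ab: "snd b = snd a"
    then show ?thesis
      using horizontal_segment_meets[OF s t k' a'(1) eq1, of "snd a"] eq2 by (auto simp: prod_eq_iff)
  next
    assume ab: "fst b = fst a"
    then show ?thesis
      using horizontal_segment_meets[OF s t k'(2,1) a'(2) eq2, of "fst a"] eq1 by (auto simp: prod_eq_iff)
  qed
qed

definition plane_point :: "site \<Rightarrow> real^2" where
  "plane_point x = vector [real_of_int (fst x), real_of_int (snd x)]"

lemma plane_point_nth [simp]:
  "plane_point x $ 1 = real_of_int (fst x)" "plane_point x $ 2 = real_of_int (snd x)"
  by (simp_all add: plane_point_def)

fun polygon :: "site list \<Rightarrow> real \<Rightarrow> real^2" where
  "polygon (x # y # xs) = linepath (plane_point x) (plane_point y) +++ polygon (y # xs)"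
| "polygon [x] = linepath (plane_point x) (plane_point x)"
| "polygon [] = linepath 0 0"

lemma pathstart_polygon: "xs \<noteq> [] \<Longrightarrow> pathstart (polygon xs) = plane_point (hd xs)"
  by (induction xs rule: polygon.induct) auto

lemma pathfinish_polygon: "xs \<noteq> [] \<Longrightarrow> pathfinish (polygon xs) = plane_point (last xs)"
  by (induction xs rule: polygon.induct) auto

lemma path_polygon: "path (polygon xs)"
proof -
  have "path (\<lambda>_. c)" for c :: "real^2" by (simp add: path_def)
  then show ?thesis
    by (induction xs rule: polygon.induct) (auto simp: pathstart_polygon)
qed

lemma mem_path_image_polygon:
  assumes "z \<in> path_image (polygon xs)" "xs \<noteq> []" "successively R xs" "\<And>x. R x x"
  shows "\<exists>p\<in>set xs. \<exists>q\<in>set xs. R p q \<and> z \<in> closed_segment (plane_point p) (plane_point q)"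
  using assms
proof (induction xs rule: polygon.induct)
  case (1 x y xs)
  then have "z \<in> closed_segment (plane_point x) (plane_point y) \<or> z \<in> path_image (polygon (y # xs))"
    by (simp add: path_image_join pathstart_polygon)
  then show ?case using 1 by auto
qed auto

lemma closed_segment_coordinates:
  assumes "z \<in> closed_segment (plane_point p) (plane_point q)"
  obtains s where "0 \<le> s" "s \<le> 1"
    "z $ 1 = real_of_int (fst p) + s * (real_of_int (fst q) - real_of_int (fst p))"
    "z $ 2 = real_of_int (snd p) + s * (real_of_int (snd q) - real_of_int (snd p))"
proof -
  obtain s where s: "0 \<le> s" "s \<le> 1" "z = (1 - s) *\<^sub>R plane_point p + s *\<^sub>R plane_point q"
    using assms by (auto simp: closed_segment_def)
  have "z $ 1 = real_of_int (fst p) + s * (real_of_int (fst q) - real_of_int (fst p))"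
    "z $ 2 = real_of_int (snd p) + s * (real_of_int (snd q) - real_of_int (snd p))"
    unfolding s(3) by (simp_all add: algebra_simps)
  with s that show ?thesis by blast
qed

text \<open>
  The polygons through the two lattice paths meet by the theorem behind Fashoda's puzzle, and segments of the
  two polygons meet only in common lattice points.
\<close>

lemma lattice_paths_cross:
  assumes ne: "xs \<noteq> []" "ys \<noteq> []"
    and xs: "successively adjacent_or_eq xs" and ys: "successively king_step ys"
    and box: "\<And>x. x \<in> set xs \<union> set ys \<Longrightarrow> l \<le> fst x \<and> fst x \<le> r \<and> b \<le> snd x \<and> snd x \<le> t"
    and ends: "fst (hd xs) = l" "fst (last xs) = r" "snd (hd ys) = b" "snd (last ys) = t"
  shows "set xs \<inter> set ys \<noteq> {}"
proof -
  let ?a = "plane_point (l, b)" and ?b = "plane_point (r, t)"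
  have in_box: "path_image (polygon zs) \<subseteq> cbox ?a ?b"
    if zs: "zs \<noteq> []" "set zs \<subseteq> set xs \<union> set ys" for zs
  proof
    fix z assume "z \<in> path_image (polygon zs)"
    then obtain p q where pq: "p \<in> set zs" "q \<in> set zs" "z \<in> closed_segment (plane_point p) (plane_point q)"
      using mem_path_image_polygon[of z zs "\<lambda>_ _. True"] zs(1) by (auto simp: successively_conv_nth simp del: split_paired_Ex)
    have "plane_point x \<in> cbox ?a ?b" if "x \<in> set zs" for x
      using box[of x] zs(2) that by (auto simp: mem_box_cart forall_2)
    with pq have "closed_segment (plane_point p) (plane_point q) \<subseteq> cbox ?a ?b"
      by (intro closed_segment_subset) auto
    with pq(3) show "z \<in> cbox ?a ?b" by blast
  qed
  obtain z where z: "z \<in> path_image (polygon xs)" "z \<in> path_image (polygon ys)"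
  proof (rule fashoda[of "polygon xs" "polygon ys" ?a ?b])
    show "path_image (polygon xs) \<subseteq> cbox ?a ?b" "path_image (polygon ys) \<subseteq> cbox ?a ?b"
      by (intro in_box ne; simp)+
  qed (use ends ne in \<open>simp_all add: path_polygon pathstart_polygon pathfinish_polygon\<close>)
  obtain a b where ab: "a \<in> set xs" "b \<in> set xs" "adjacent_or_eq a b" "z \<in> closed_segment (plane_point a) (plane_point b)"
    using mem_path_image_polygon[OF z(1) ne(1) xs] adjacent_or_eq_refl by blast
  obtain p q where pq: "p \<in> set ys" "q \<in> set ys" "king_step p q" "z \<in> closed_segment (plane_point p) (plane_point q)"
    using mem_path_image_polygon[OF z(2) ne(2) ys] king_step_refl by blast
  obtain s where s: "0 \<le> s" "s \<le> 1"
    "z $ 1 = real_of_int (fst p) + s * (real_of_int (fst q) - real_of_int (fst p))"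
    "z $ 2 = real_of_int (snd p) + s * (real_of_int (snd q) - real_of_int (snd p))"
    using closed_segment_coordinates[OF pq(4)] by blast
  obtain u where u: "0 \<le> u" "u \<le> 1"
    "z $ 1 = real_of_int (fst a) + u * (real_of_int (fst b) - real_of_int (fst a))"
    "z $ 2 = real_of_int (snd a) + u * (real_of_int (snd b) - real_of_int (snd a))"
    using closed_segment_coordinates[OF ab(4)] by blast
  have "{p, q} \<inter> {a, b} \<noteq> {}"
    by (rule lattice_segments_meet[OF s(1,2) u(1,2) pq(3) ab(3)]) (use s u in simp_all)
  with ab pq show ?thesis by auto
qed

lemma successively_map_upto:
  assumes "\<And>i. a \<le> i \<Longrightarrow> i < b \<Longrightarrow> R (f i) (f (i + 1))"
  shows "successively R (map f [a..b])"
  using assms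
proof (induction a b rule: upto.induct)
  case (1 a b)
  show ?case
  proof (cases "a < b")
    case True
    define l where "l = map f [a+1+1..b]"
    have eq: "map f [a..b] = f a # f (a+1) # l" "map f [a+1..b] = f (a+1) # l"
      using True by (simp_all add: upto_rec1 l_def)
    have "successively R (map f [a+1..b])" using 1 True by simp
    moreover have "R (f a) (f (a + 1))" using 1 True by simp
    ultimately show ?thesis unfolding eq by simp
  next
    case False
    then show ?thesis by (cases "a = b") simp_all
  qed
qed

lemma hd_map_upto: "a \<le> b \<Longrightarrow> hd (map f [a..b]) = f a"
  by (simp add: upto_rec1)

lemma last_map_upto: "a \<le> b \<Longrightarrow> last (map f [a..b]) = f b"
  by (simp add: upto_rec2)

lemma finite_int_bound: "finite A \<Longrightarrow> \<exists>B. \<forall>x\<in>A. \<bar>f x\<bar> < (B::int)"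
proof (induction A rule: finite_induct)
  case (insert x A)
  then obtain B where "\<forall>y\<in>A. \<bar>f y\<bar> < B" by blast
  then show ?case by (intro exI[of _ "max B (\<bar>f x\<bar> + 1)"]) auto
qed auto

context
  fixes s :: real
  assumes slope: "\<bar>s\<bar> \<le> 1"
begin

definition level :: "site \<Rightarrow> int" where
  "level x = fst x + \<lceil>s * real_of_int (snd x)\<rceil>"

lemma ceiling_slope_step: "\<bar>\<lceil>s * real_of_int (t + 1)\<rceil> - \<lceil>s * real_of_int t\<rceil>\<bar> \<le> 1"
  using slope by (simp add: algebra_simps) linarith

text \<open>
  The strip between the levels \<open>0\<close> and \<open>L\<close> is embedded into a box. The path \<open>xs\<close> is prolonged by horizontal rays,
  which lie outside the strip; the path \<open>ys\<close> is prolonged downwards along level \<open>L\<close> and upwards along level \<open>0\<close>.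
  The prolonged paths cross the box in the two directions, hence they meet. The assumptions on the end points
  exclude a meeting in the prolongations.
\<close>

lemma strip_paths_cross_above:
  assumes ne: "xs \<noteq> []" "ys \<noteq> []"
    and xs: "successively adjacent_or_eq xs" and ys: "successively adjacent_or_eq ys"
    and lev: "\<And>x. x \<in> set xs \<union> set ys \<Longrightarrow> 0 \<le> level x \<and> level x \<le> L"
    and left: "hd xs = (0, 0)" "\<And>x. x \<in> set xs \<Longrightarrow> level x = 0 \<Longrightarrow> x = (0, 0)"
    and right: "level (last xs) = L" "\<And>x. x \<in> set xs \<Longrightarrow> level x = L \<Longrightarrow> x = last xs"
    and ends: "level (hd ys) = L" "level (last ys) = 0"
    and above: "snd (hd ys) \<le> snd (last xs)" "0 \<le> snd (last ys)"
  shows "set xs \<inter> set ys \<noteq> {}"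
proof -
  define k where "k = snd (hd ys)"
  define J where "J = snd (last ys)"
  define p where "p = fst (last xs)"
  define K where "K = snd (last xs)"
  obtain T where T: "\<forall>x\<in>set xs \<union> set ys. \<bar>snd x\<bar> < T"
    using finite_int_bound[of "set xs \<union> set ys" snd] by auto
  \<comment> \<open>the parts of the two levels that prolong \<open>ys\<close>\<close>
  define lower where "lower = map (\<lambda>t. (L - \<lceil>s * real_of_int t\<rceil>, t)) [-T..k-1]"
  define upper where "upper = map (\<lambda>t. (- \<lceil>s * real_of_int t\<rceil>, t)) [J+1..T]"
  define vs where "vs = lower @ ys @ upper"
  obtain R where R: "\<forall>x\<in>set xs \<union> set vs. \<bar>fst x\<bar> < R"
    using finite_int_bound[of "set xs \<union> set vs" fst] by auto
  \<comment> \<open>the rays that prolong \<open>xs\<close>\<close>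
  define lray where "lray = map (\<lambda>i. (i, 0::int)) [-R..-1]"
  define rray where "rray = map (\<lambda>i. (i, K)) [p+1..R]"
  define hs where "hs = lray @ xs @ rray"
  have kT: "\<bar>k\<bar> < T" "\<bar>J\<bar> < T" using T ne by (auto simp: k_def J_def)
  have "\<bar>fst (last xs)\<bar> < R" "\<bar>snd (last xs)\<bar> < T" using R T ne by simp_all
  then have pR: "\<bar>p\<bar> < R" "0 < R" "\<bar>K\<bar> < T" by (simp_all add: p_def K_def)
  have hdys: "hd ys = (L - \<lceil>s * real_of_int k\<rceil>, k)"
    using ends(1) by (auto simp: level_def k_def prod_eq_iff)
  have lastys: "last ys = (- \<lceil>s * real_of_int J\<rceil>, J)"
    using ends(2) by (auto simp: level_def J_def prod_eq_iff)
  have rays: "lray \<noteq> []" "rray \<noteq> []" "lower \<noteq> []" "upper \<noteq> []"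
    using kT pR by (auto simp: lray_def rray_def lower_def upper_def)
  have "set hs \<inter> set vs \<noteq> {}"
  proof (rule lattice_paths_cross[where l="-R" and r=R and b="-T" and t=T])
    show "successively adjacent_or_eq hs"
      unfolding hs_def
      using xs rays ne pR left(1) last_map_upto[of "-R" "-1" "\<lambda>i. (i, 0::int)"] hd_map_upto[of "p+1" R "\<lambda>i. (i, K)"]
      by (auto simp: successively_append_iff lray_def rray_def adjacent_or_eq_def p_def K_def intro!: successively_map_upto)
    have "successively king_step lower" "successively king_step upper"
      unfolding lower_def upper_def
      by (intro successively_map_upto; use ceiling_slope_step in \<open>simp add: king_step_def\<close>; smt (verit))+
    moreover have "successively king_step ys"
      using ys by (rule successively_mono) (simp add: king_step_if_adjacent)
    moreover have "king_step (last lower) (hd ys)"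
      unfolding lower_def hdys using kT ceiling_slope_step[of "k-1"]
      by (subst last_map_upto) (auto simp: king_step_def)
    moreover have "king_step (last ys) (hd upper)"
      unfolding upper_def lastys using kT ceiling_slope_step[of J]
      by (subst hd_map_upto) (auto simp: king_step_def)
    ultimately show "successively king_step vs"
      using rays ne by (simp add: vs_def successively_append_iff)
    show "fst (hd hs) = - R" "fst (last hs) = R"
      using rays ne pR hd_map_upto[of "-R" "-1" "\<lambda>i. (i, 0::int)"] last_map_upto[of "p+1" R "\<lambda>i. (i, K)"]
      by (simp_all add: hs_def lray_def rray_def)
    show "snd (hd vs) = - T" "snd (last vs) = T"
      using rays ne kT hd_map_upto[of "-T" "k-1" "\<lambda>t. (L - \<lceil>s * real_of_int t\<rceil>, t)"]
        last_map_upto[of "J+1" T "\<lambda>t. (- \<lceil>s * real_of_int t\<rceil>, t)"]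
      by (simp_all add: vs_def lower_def upper_def)
    fix x assume x: "x \<in> set hs \<union> set vs"
    have "\<bar>fst x\<bar> \<le> R"
      using x R pR unfolding hs_def by (auto simp: lray_def rray_def less_imp_le)
    moreover have "\<bar>snd x\<bar> \<le> T"
      using x T kT pR unfolding hs_def vs_def by (auto simp: lray_def rray_def lower_def upper_def less_imp_le)
    ultimately show "- R \<le> fst x \<and> fst x \<le> R \<and> - T \<le> snd x \<and> snd x \<le> T" by auto
  qed (use rays in \<open>auto simp: hs_def vs_def\<close>)
  then obtain x where x: "x \<in> set hs" "x \<in> set vs" by blast
  have "hd xs \<in> set xs" using ne by simp
  then have "0 \<le> L" using lev[of "hd xs"] by force
  with x(2) lev[of x] have "level x \<ge> 0 \<and> level x \<le> L"
    by (auto simp: vs_def lower_def upper_def level_def)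
  moreover have "level x < 0" if "x \<in> set lray" using that by (auto simp: lray_def level_def)
  moreover have "level x > L" if "x \<in> set rray"
    using that right(1) by (auto simp: rray_def level_def p_def K_def)
  ultimately have xxs: "x \<in> set xs" using x(1) by (auto simp: hs_def)
  have "x \<notin> set lower"
  proof
    assume "x \<in> set lower"
    then have "level x = L" "snd x < k" by (auto simp: lower_def level_def)
    then show False using right(2)[OF xxs] above(1) by (simp add: k_def)
  qed
  moreover have "x \<notin> set upper"
  proof
    assume "x \<in> set upper"
    then have "level x = 0" "snd x > J" by (auto simp: upper_def level_def)
    then show False using left(2)[OF xxs] above(2) by (auto simp: J_def)
  qed
  ultimately show ?thesis using x(2) xxs by (auto simp: vs_def)
qed

end

section \<open>Crossings of a slab\<close>

text \<open>
  The reflection in the first axis turns this into the previous situation, with slope \<open>- s\<close>.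
\<close>

lemma strip_paths_cross_below:
  assumes slope: "\<bar>s\<bar> \<le> 1"
    and ne: "xs \<noteq> []" "ys \<noteq> []"
    and xs: "successively adjacent_or_eq xs" and ys: "successively adjacent_or_eq ys"
    and lev: "\<And>x. x \<in> set xs \<union> set ys \<Longrightarrow> 0 \<le> level s x \<and> level s x \<le> L"
    and left: "hd xs = (0, 0)" "\<And>x. x \<in> set xs \<Longrightarrow> level s x = 0 \<Longrightarrow> x = (0, 0)"
    and right: "level s (last xs) = L" "\<And>x. x \<in> set xs \<Longrightarrow> level s x = L \<Longrightarrow> x = last xs"
    and ends: "level s (hd ys) = L" "level s (last ys) = 0"
    and below: "snd (last xs) \<le> snd (hd ys)" "snd (last ys) \<le> 0"
  shows "set xs \<inter> set ys \<noteq> {}"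
proof -
  define m :: "site \<Rightarrow> site" where "m = (\<lambda>x. (fst x, - snd x))"
  have s': "\<bar>- s\<bar> \<le> 1" using slope by simp
  have m: "inj m" "fst (m x) = fst x" "snd (m x) = - snd x" for x by (auto simp: m_def inj_def prod_eq_iff)
  have lev_m: "level (- s) (m x) = level s x" for x
    by (simp add: level_def[OF slope] level_def[OF s'] m)
  have adj: "successively adjacent_or_eq (map m zs)" if "successively adjacent_or_eq zs" for zs
    unfolding successively_map
    by (rule successively_mono[OF that]) (auto simp: adjacent_or_eq_def m)
  have "set (map m xs) \<inter> set (map m ys) \<noteq> {}"
  proof (rule strip_paths_cross_above[OF s'])
    show "successively adjacent_or_eq (map m xs)" "successively adjacent_or_eq (map m ys)"
      using xs ys adj by auto
    show "\<And>x. x \<in> set (map m xs) \<union> set (map m ys) \<Longrightarrow> 0 \<le> level (- s) x \<and> level (- s) x \<le> L"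
      using lev by (auto simp: lev_m)
    show "x = (0, 0)" if x: "x \<in> set (map m xs)" "level (- s) x = 0" for x
    proof -
      obtain y where y: "y \<in> set xs" "x = m y" using x(1) by (metis imageE list.set_map)
      then have "y = (0, 0)" using left(2) x(2) lev_m by metis
      with y show ?thesis by (simp add: m_def)
    qed
    show "x = last (map m xs)" if x: "x \<in> set (map m xs)" "level (- s) x = L" for x
    proof -
      obtain y where y: "y \<in> set xs" "x = m y" using x(1) by (metis imageE list.set_map)
      then have "y = last xs" using right(2) x(2) lev_m by metis
      with y ne show ?thesis by (simp add: last_map)
    qed
    show "level (- s) (last (map m xs)) = L" "level (- s) (hd (map m ys)) = L" "level (- s) (last (map m ys)) = 0"
      using right(1) ends ne by (simp_all add: last_map hd_map lev_m)
    show "hd (map m xs) = (0, 0)" using left(1) ne by (simp add: hd_map m_def)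
    show "snd (hd (map m ys)) \<le> snd (last (map m xs))" "0 \<le> snd (last (map m ys))"
      using below ne by (simp_all add: hd_map last_map m)
  qed (use ne in auto)
  then have "m ` (set xs \<inter> set ys) \<noteq> {}" by (simp add: image_Int[OF m(1)])
  then show ?thesis by simp
qed

lemma additive_int:
  fixes f :: "int \<Rightarrow> real"
  assumes "\<And>a b. f (a + b) = f a + f b"
  shows "f a = of_int a * f 1"
proof -
  have f0: "f 0 = 0" using assms[of 0 0] by simp
  show ?thesis
  proof (induction a rule: int_induct[of _ 0])
    case (step1 i)
    then show ?case using assms[of i 1] by (simp add: algebra_simps)
  next
    case (step2 i)
    then show ?case using assms[of "i - 1" 1] by (simp add: algebra_simps)
  qed (simp add: f0)
qed

lemma height_linear:
  assumes v: "coordinate_height v e"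
  shows "v (a, b) = of_int a * v (1, 0) + of_int b * v (0, 1)"
proof -
  have 1: "v (a, 0) = of_int a * v (1, 0)" using height_add[OF v, of "(_, 0)" "(_, 0)"] by (intro additive_int) simp
  have 2: "v (0, b) = of_int b * v (0, 1)" using height_add[OF v, of "(0, _)" "(0, _)"] by (intro additive_int) simp
  have "v (a, b) = v (a, 0) + v (0, b)" using height_add[OF v, of "(a, 0)" "(0, b)"] by simp
  then show ?thesis by (simp add: 1 2)
qed

text \<open>
  A lattice symmetry makes \<open>e\<close> the first basis vector. In the new coordinates the height is
  \<open>fst x + s * snd x\<close>, and since \<open>fst x\<close> is an integer it can be pulled out of the rounding.
\<close>

lemma height_coordinates:
  assumes v: "coordinate_height v e"
  obtains c :: "site \<Rightarrow> site" and s :: real where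
    "bij c" "c 0 = (0, 0)" "\<bar>s\<bar> \<le> 1" "\<And>x. level s (c x) = \<lceil>v x\<rceil>"
    "\<And>x y. y - x \<in> unit_steps \<Longrightarrow> adjacent_or_eq (c x) (c y)"
proof -
  have bounds: "\<bar>v (1, 0)\<bar> \<le> 1" "\<bar>v (0, 1)\<bar> \<le> 1"
    using v by (auto simp: coordinate_height_def unit_steps_eq)
  have e: "v e = 1" by (rule height_step[OF v])
  have lin: "v x = of_int (fst x) * v (1, 0) + of_int (snd x) * v (0, 1)" for x
    using height_linear[OF v, of "fst x" "snd x"] by simp
  have steps: "y - x \<in> unit_steps \<Longrightarrow>
     (\<bar>fst y - fst x\<bar> + \<bar>snd y - snd x\<bar> \<le> 1)" for x y
    by (cases x, cases y) (auto simp: unit_steps_eq)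
  consider "e = (1, 0)" | "e = (-1, 0)" | "e = (0, 1)" | "e = (0, -1)"
    using height_step(1)[OF v] by (auto simp: unit_steps_eq)
  then show ?thesis
  proof cases
    case 1
    then have "v (1, 0) = 1" using e by simp
    then have "level (v (0, 1)) x = \<lceil>v x\<rceil>" for x
      using lin[of x] by (simp add: level_def[OF bounds(2)] ac_simps) linarith
    then show ?thesis
    proof (rule that[of "\<lambda>x. x" "v (0, 1)", rotated 3])
      show "bij (\<lambda>x :: site. x)" by (rule o_bij[of "\<lambda>x. x"]) (simp_all add: fun_eq_iff)
      show "\<bar>v (0, 1)\<bar> \<le> 1" by (rule bounds(2))
      show "adjacent_or_eq ((\<lambda>x. x) x) ((\<lambda>x. x) y)" if "y - x \<in> unit_steps" for x y
        using steps[OF that] unfolding adjacent_or_eq_def fst_conv snd_conv by linarith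
    qed (simp add: zero_prod_def)
  next
    case 2
    then have v1: "v (1, 0) = - 1" using e lin[of "(-1, 0)"] by simp
    have "level (v (0, 1)) (- fst x, snd x) = \<lceil>v x\<rceil>" for x
      using lin[of x] by (simp add: level_def[OF bounds(2)] v1 ac_simps)
    then show ?thesis
    proof (rule that[of "\<lambda>x. (- fst x, snd x)" "v (0, 1)", rotated 3])
      show "bij (\<lambda>x :: site. (- fst x, snd x))" by (rule o_bij[of "\<lambda>x. (- fst x, snd x)"]) (simp_all add: fun_eq_iff)
      show "\<bar>v (0, 1)\<bar> \<le> 1" by (rule bounds(2))
      show "adjacent_or_eq ((\<lambda>x. (- fst x, snd x)) x) ((\<lambda>x. (- fst x, snd x)) y)" if "y - x \<in> unit_steps" for x y
        using steps[OF that] unfolding adjacent_or_eq_def fst_conv snd_conv by linarith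
    qed (simp add: zero_prod_def)
  next
    case 3
    then have v1: "v (0, 1) = 1" using e by simp
    have "level (v (1, 0)) (snd x, fst x) = \<lceil>v x\<rceil>" for x
      using lin[of x] by (simp add: level_def[OF bounds(1)] v1 ac_simps) linarith
    then show ?thesis
    proof (rule that[of "\<lambda>x. (snd x, fst x)" "v (1, 0)", rotated 3])
      show "bij (\<lambda>x :: site. (snd x, fst x))" by (rule o_bij[of "\<lambda>x. (snd x, fst x)"]) (simp_all add: fun_eq_iff)
      show "\<bar>v (1, 0)\<bar> \<le> 1" by (rule bounds(1))
      show "adjacent_or_eq ((\<lambda>x. (snd x, fst x)) x) ((\<lambda>x. (snd x, fst x)) y)" if "y - x \<in> unit_steps" for x y
        using steps[OF that] unfolding adjacent_or_eq_def fst_conv snd_conv by linarith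
    qed (simp add: zero_prod_def)
  next
    case 4
    then have v1: "v (0, 1) = - 1" using e lin[of "(0, -1)"] by simp
    have "level (v (1, 0)) (- snd x, fst x) = \<lceil>v x\<rceil>" for x
      using lin[of x] by (simp add: level_def[OF bounds(1)] v1 ac_simps)
    then show ?thesis
    proof (rule that[of "\<lambda>x. (- snd x, fst x)" "v (1, 0)", rotated 3])
      show "bij (\<lambda>x :: site. (- snd x, fst x))" by (rule o_bij[of "\<lambda>x. (snd x, - fst x)"]) (simp_all add: fun_eq_iff)
      show "\<bar>v (1, 0)\<bar> \<le> 1" by (rule bounds(1))
      show "adjacent_or_eq ((\<lambda>x. (- snd x, fst x)) x) ((\<lambda>x. (- snd x, fst x)) y)" if "y - x \<in> unit_steps" for x y
        using steps[OF that] unfolding adjacent_or_eq_def fst_conv snd_conv by linarith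
    qed (simp add: zero_prod_def)
  qed
qed

definition nearest_neighbour :: "site list \<Rightarrow> bool" where
  "nearest_neighbour \<pi> \<longleftrightarrow> successively (\<lambda>x y. y - x \<in> unit_steps) \<pi>"

text \<open>
  Paths from the origin up to their first visit to level \<open>L\<close> that satisfy the condition of
  \<^const>\<open>stays_above\<close> so far.
\<close>

definition crossings_up :: "(site \<Rightarrow> real) \<Rightarrow> int \<Rightarrow> site list set" where
  "crossings_up v L = {\<pi>. \<pi> \<noteq> [] \<and> nearest_neighbour \<pi> \<and> hd \<pi> = 0 \<and> (\<forall>x\<in>set (tl \<pi>). 1 \<le> v x) \<and>
     \<lceil>v (last \<pi>)\<rceil> = L \<and> (\<forall>x\<in>set (butlast \<pi>). \<lceil>v x\<rceil> < L)}"

text \<open>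
  The counterpart for a walk from \<open>z\<close> that escapes downwards, stopped at its first visit to level \<open>0\<close>.
\<close>

definition crossings_down :: "(site \<Rightarrow> real) \<Rightarrow> site \<Rightarrow> site list set" where
  "crossings_down v z = {\<rho>. \<rho> \<noteq> [] \<and> nearest_neighbour \<rho> \<and> hd \<rho> = z \<and> (\<forall>x\<in>set (tl \<rho>). v x \<le> v z - 1) \<and>
     \<lceil>v (last \<rho>)\<rceil> = 0 \<and> (\<forall>x\<in>set (butlast \<rho>). 0 < \<lceil>v x\<rceil>)}"

text \<open>
  A path that is stopped at its first visit to a set is not a proper prefix of another such path.
\<close>

lemma disjoint_family_stopped:
  assumes "\<And>\<pi>. \<pi> \<in> T \<Longrightarrow> \<pi> \<noteq> [] \<and> R (last \<pi>) \<and> (\<forall>x\<in>set (butlast \<pi>). \<not> R x)"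
  shows "disjoint_family_on cylinder T"
proof -
  have *: "\<pi> = \<rho>" if T: "\<pi> \<in> T" "\<rho> \<in> T" and le: "length \<pi> \<le> length \<rho>" and X: "X \<in> cylinder \<pi>" "X \<in> cylinder \<rho>" for \<pi> \<rho> X
  proof -
    have 1: "path_prefix (length \<pi>) X = \<pi>" and 2: "path_prefix (length \<rho>) X = \<rho>"
      using X by (simp_all only: mem_cylinder_iff)
    have take: "take (length \<pi>) \<rho> = \<pi>"
      using take_path_prefix[OF le, of X] unfolding 1 2 .
    show ?thesis
    proof (rule ccontr)
      assume "\<pi> \<noteq> \<rho>"
      then have less: "length \<pi> < length \<rho>" using take le by (metis le_neq_implies_less take_all_iff order_refl)
      have ne: "\<pi> \<noteq> []" using assms[OF T(1)] by simp
      have pos: "length \<pi> - 1 < length (butlast \<rho>)" using ne less by (cases \<pi>) auto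
      have "last \<pi> = \<rho> ! (length \<pi> - 1)" using ne take less by (metis diff_less last_conv_nth length_greater_0_conv nth_take zero_less_one)
      also have "\<rho> ! (length \<pi> - 1) = butlast \<rho> ! (length \<pi> - 1)" using nth_butlast[OF pos] by simp
      also have "\<dots> \<in> set (butlast \<rho>)" by (rule nth_mem[OF pos])
      finally show False using assms T by blast
    qed
  qed
  show ?thesis
    unfolding disjoint_family_on_def using * by (metis disjoint_iff linorder_le_cases)
qed

lemma disjoint_crossings_up: "disjoint_family_on cylinder (crossings_up v L)"
  by (rule disjoint_family_stopped[where R="\<lambda>x. \<lceil>v x\<rceil> = L"]) (auto simp: crossings_up_def simp del: split_paired_All)

lemma disjoint_crossings_down: "disjoint_family_on cylinder (crossings_down v z)"
  by (rule disjoint_family_stopped[where R="\<lambda>x. \<lceil>v x\<rceil> = 0"]) (auto simp: crossings_down_def simp del: split_paired_All zero_less_ceiling)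

text \<open>
  The row of a site is its position along its level. Each level has exactly one site in each row. If the upward
  path arrives on one side of \<open>z\<close> and avoids the downward path, then the latter has to arrive on the opposite
  side of the origin.
\<close>

lemma disjoint_crossings_dichotomy:
  assumes v: "coordinate_height v e"
  obtains row :: "site \<Rightarrow> int" where
    "\<And>L k. \<exists>z. \<lceil>v z\<rceil> = L \<and> row z = k"
    "\<And>L z \<pi> \<rho>. \<lceil>v z\<rceil> = L \<Longrightarrow> 1 \<le> L \<Longrightarrow> \<pi> \<in> crossings_up v L \<Longrightarrow> \<rho> \<in> crossings_down v z \<Longrightarrow> set \<pi> \<inter> set \<rho> = {} \<Longrightarrow>
      (row (last \<pi>) < row z \<and> 0 < row (last \<rho>)) \<or> (row z < row (last \<pi>) \<and> row (last \<rho>) < 0)"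
proof -
  obtain c s where c: "bij c" "c 0 = (0, 0)" and slope: "\<bar>s\<bar> \<le> 1" and lev: "\<And>x. level s (c x) = \<lceil>v x\<rceil>"
    and adj: "\<And>x y. y - x \<in> unit_steps \<Longrightarrow> adjacent_or_eq (c x) (c y)"
    using height_coordinates[OF v] by blast
  show ?thesis
  proof (rule that[of "\<lambda>x. snd (c x)"])
    fix L k
    have "level s (L - \<lceil>s * real_of_int k\<rceil>, k) = L" by (simp add: level_def[OF slope])
    moreover obtain z where "c z = (L - \<lceil>s * real_of_int k\<rceil>, k)" using c(1) by (metis bij_pointE)
    ultimately have "\<lceil>v z\<rceil> = L \<and> snd (c z) = k" using lev[of z] by simp
    then show "\<exists>z. \<lceil>v z\<rceil> = L \<and> snd (c z) = k" by blast
  next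
    fix L z \<pi> \<rho>
    assume z: "\<lceil>v z\<rceil> = L" and L: "1 \<le> L" and \<pi>: "\<pi> \<in> crossings_up v L" and \<rho>: "\<rho> \<in> crossings_down v z"
      and disj: "set \<pi> \<inter> set \<rho> = {}"
    have ne: "\<pi> \<noteq> []" "\<rho> \<noteq> []" using \<pi> \<rho> by (auto simp: crossings_up_def crossings_down_def)
    have adjs: "successively adjacent_or_eq (map c \<sigma>)" if "nearest_neighbour \<sigma>" for \<sigma>
      using that unfolding nearest_neighbour_def successively_map by (rule successively_mono) (rule adj)
    have split: "x = hd \<sigma> \<or> x \<in> set (tl \<sigma>)" "x = last \<sigma> \<or> x \<in> set (butlast \<sigma>)"
      if "x \<in> set \<sigma>" for x and \<sigma> :: "site list"
    proof -
      have "\<sigma> \<noteq> []" using that by auto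
      then have "\<sigma> = hd \<sigma> # tl \<sigma>" "\<sigma> = butlast \<sigma> @ [last \<sigma>]" by simp_all
      then have "x \<in> set (hd \<sigma> # tl \<sigma>)" "x \<in> set (butlast \<sigma> @ [last \<sigma>])" using that by metis+
      then show "x = hd \<sigma> \<or> x \<in> set (tl \<sigma>)" "x = last \<sigma> \<or> x \<in> set (butlast \<sigma>)" by auto
    qed
    have up: "(x = 0 \<or> 1 \<le> v x)" "(x = last \<pi> \<or> \<lceil>v x\<rceil> < L)" if "x \<in> set \<pi>" for x
      using split[OF that] \<pi> by (auto simp: crossings_up_def simp del: split_paired_All)
    have down: "(x = z \<or> v x \<le> v z - 1)" "(x = last \<rho> \<or> 0 < \<lceil>v x\<rceil>)" if "x \<in> set \<rho>" for x
      using split[OF that] \<rho> by (auto simp: crossings_down_def simp del: split_paired_All)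
    have lp: "\<lceil>v (last \<pi>)\<rceil> = L" "hd \<pi> = 0" "nearest_neighbour \<pi>" and lr: "\<lceil>v (last \<rho>)\<rceil> = 0" "hd \<rho> = z" "nearest_neighbour \<rho>"
      using \<pi> \<rho> by (auto simp: crossings_up_def crossings_down_def)
    have v0: "v 0 = 0" by (rule height_zero[OF v])
    have lev_up: "0 \<le> \<lceil>v x\<rceil> \<and> \<lceil>v x\<rceil> \<le> L" "\<lceil>v x\<rceil> = 0 \<Longrightarrow> x = 0" "\<lceil>v x\<rceil> = L \<Longrightarrow> x = last \<pi>" if "x \<in> set \<pi>" for x
    proof -
      have "0 \<le> \<lceil>v x\<rceil>" using up(1)[OF that] v0 by auto
      moreover have "\<lceil>v x\<rceil> \<le> L" using up(2)[OF that] lp(1) by auto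
      ultimately show "0 \<le> \<lceil>v x\<rceil> \<and> \<lceil>v x\<rceil> \<le> L" by simp
      show "x = 0" if "\<lceil>v x\<rceil> = 0" using up(1)[OF \<open>x \<in> set \<pi>\<close>] that by linarith
      show "x = last \<pi>" if "\<lceil>v x\<rceil> = L" using up(2)[OF \<open>x \<in> set \<pi>\<close>] that by auto
    qed
    have lev_down: "0 \<le> \<lceil>v x\<rceil> \<and> \<lceil>v x\<rceil> \<le> L" if "x \<in> set \<rho>" for x
    proof
      show "0 \<le> \<lceil>v x\<rceil>" using down(2)[OF that] lr(1) by (metis order_refl less_imp_le)
      show "\<lceil>v x\<rceil> \<le> L" using down(1)[OF that] z by (elim disjE) (simp, linarith)
    qed
    have disj': "set (map c \<pi>) \<inter> set (map c \<rho>) = {}"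
      using disj image_Int[OF bij_is_inj[OF c(1)], of "set \<pi>" "set \<rho>"] by simp
    have lev_all: "0 \<le> level s y \<and> level s y \<le> L" if "y \<in> set (map c \<pi>) \<union> set (map c \<rho>)" for y
      using that lev_up(1) lev_down by (auto simp: lev simp del: split_paired_All)
    have left: "y = (0, 0)" if y: "y \<in> set (map c \<pi>)" "level s y = 0" for y
    proof -
      obtain x where x: "x \<in> set \<pi>" "y = c x" using y(1) by (metis imageE list.set_map)
      then have "x = 0" using y(2) lev_up(2) by (simp only: lev)
      then show ?thesis using x c(2) by simp
    qed
    have right: "y = last (map c \<pi>)" if y: "y \<in> set (map c \<pi>)" "level s y = L" for y
    proof -
      obtain x where x: "x \<in> set \<pi>" "y = c x" using y(1) by (metis imageE list.set_map)
      then have "x = last \<pi>" using y(2) lev_up(3) by (simp only: lev)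
      then show ?thesis using x ne by (simp add: last_map)
    qed
    have ends_c: "hd (map c \<pi>) = (0, 0)" "level s (last (map c \<pi>)) = L" "level s (hd (map c \<rho>)) = L"
      "level s (last (map c \<rho>)) = 0" "snd (hd (map c \<rho>)) = snd (c z)" "snd (last (map c \<pi>)) = snd (c (last \<pi>))"
      "snd (last (map c \<rho>)) = snd (c (last \<rho>))"
      using ne lp lr c(2) z by (simp_all add: hd_map last_map lev)
    have "\<not> (snd (c z) \<le> snd (c (last \<pi>)) \<and> 0 \<le> snd (c (last \<rho>)))"
    proof
      assume rows: "snd (c z) \<le> snd (c (last \<pi>)) \<and> 0 \<le> snd (c (last \<rho>))"
      have "set (map c \<pi>) \<inter> set (map c \<rho>) \<noteq> {}"
      proof (rule strip_paths_cross_above[OF slope])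
        show "successively adjacent_or_eq (map c \<pi>)" "successively adjacent_or_eq (map c \<rho>)"
          by (rule adjs, fact)+
      qed (use ne ends_c rows lev_all left right in \<open>simp_all only: map_is_Nil_conv not_False_eq_True\<close>)
      with disj' show False by simp
    qed
    moreover have "\<not> (snd (c (last \<pi>)) \<le> snd (c z) \<and> snd (c (last \<rho>)) \<le> 0)"
    proof
      assume rows: "snd (c (last \<pi>)) \<le> snd (c z) \<and> snd (c (last \<rho>)) \<le> 0"
      have "set (map c \<pi>) \<inter> set (map c \<rho>) \<noteq> {}"
      proof (rule strip_paths_cross_below[OF slope])
        show "successively adjacent_or_eq (map c \<pi>)" "successively adjacent_or_eq (map c \<rho>)"
          by (rule adjs, fact)+
      qed (use ne ends_c rows lev_all left right in \<open>simp_all only: map_is_Nil_conv not_False_eq_True\<close>)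
      with disj' show False by simp
    qed
    ultimately show "(snd (c (last \<pi>)) < snd (c z) \<and> 0 < snd (c (last \<rho>))) \<or> (snd (c z) < snd (c (last \<pi>)) \<and> snd (c (last \<rho>)) < 0)"
      by linarith
  qed
qed

lemma nearest_neighbour_path_prefix: "walk z X \<Longrightarrow> nearest_neighbour (path_prefix n X)"
  by (simp add: nearest_neighbour_def successively_conv_nth walk_def)

lemma tl_path_prefix_Suc: "tl (path_prefix (Suc n) X) = map X [1..<Suc n]"
  by (simp add: path_prefix_def upt_conv_Cons del: upt_Suc)

lemma butlast_path_prefix_Suc: "butlast (path_prefix (Suc n) X) = path_prefix n X"
  by (simp add: path_prefix_Suc)

lemma ex_crossing_up:
  assumes v: "coordinate_height v e" and X: "walk 0 X" "X \<in> escape_above v" and L: "1 \<le> L"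
  shows "\<exists>\<pi>\<in>crossings_up v L. X \<in> cylinder \<pi>"
proof -
  have "\<exists>n. L \<le> \<lceil>v (X n)\<rceil>"
  proof -
    have "\<forall>\<^sub>F n in sequentially. real_of_int L \<le> v (X n)"
      using X(2) by (simp add: escape_above_def filterlim_at_top)
    then obtain n where "real_of_int L \<le> v (X n)" by (auto simp: eventually_sequentially)
    then show ?thesis by (intro exI[of _ n]) linarith
  qed
  then obtain n where n: "L \<le> \<lceil>v (X n)\<rceil>" and least: "\<And>m. m < n \<Longrightarrow> \<not> L \<le> \<lceil>v (X m)\<rceil>"
    using exists_least_iff[of "\<lambda>n. L \<le> \<lceil>v (X n)\<rceil>"] by blast
  have X0: "X 0 = 0" using X(1) by (simp add: walk_def)
  have "n \<noteq> 0" using n L X0 height_zero[OF v] by (cases n) auto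
  then obtain m where m: "n = Suc m" by (cases n) auto
  have "\<bar>v (X n) - v (X m)\<bar> \<le> 1"
    using X(1) m by (intro height_walk_step[OF v]) (simp add: walk_def)
  then have last: "\<lceil>v (X n)\<rceil> = L" using n least[of m] m by linarith
  have "path_prefix (Suc n) X \<in> crossings_up v L"
    unfolding crossings_up_def mem_Collect_eq tl_path_prefix_Suc butlast_path_prefix_Suc
  proof (intro conjI)
    show "\<forall>x\<in>set (map X [1..<Suc n]). 1 \<le> v x"
      using X(2) X0 height_zero[OF v] by (auto simp: escape_above_def stays_above_def)
    show "\<forall>x\<in>set (path_prefix n X). \<lceil>v x\<rceil> < L"
      using least by (auto simp: set_path_prefix not_le)
    show "hd (path_prefix (Suc n) X) = 0" using X0 by (simp add: hd_conv_nth path_prefix_Suc[symmetric] del: path_prefix_Suc flip: length_greater_0_conv)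
  qed (use last nearest_neighbour_path_prefix[OF X(1), of "Suc n"] in \<open>auto simp: path_prefix_Suc\<close>)
  then show ?thesis by (rule bexI[rotated]) simp
qed

lemma ex_crossing_down:
  assumes v: "coordinate_height v e" and X: "walk z X" "X \<in> escape_above (\<lambda>x. - v x)" and z: "1 \<le> \<lceil>v z\<rceil>"
  shows "\<exists>\<rho>\<in>crossings_down v z. X \<in> cylinder \<rho>"
proof -
  have "\<exists>n. \<lceil>v (X n)\<rceil> \<le> 0"
  proof -
    have "filterlim (\<lambda>n. - v (X n)) at_top sequentially" using X(2) by (simp add: escape_above_def)
    then have "\<forall>\<^sub>F n in sequentially. 0 \<le> - v (X n)" unfolding filterlim_at_top by blast
    then obtain n where "0 \<le> - v (X n)" by (auto simp: eventually_sequentially)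
    then show ?thesis by (intro exI[of _ n]) linarith
  qed
  then obtain n where n: "\<lceil>v (X n)\<rceil> \<le> 0" and least: "\<And>m. m < n \<Longrightarrow> \<not> \<lceil>v (X m)\<rceil> \<le> 0"
    using exists_least_iff[of "\<lambda>n. \<lceil>v (X n)\<rceil> \<le> 0"] by blast
  have X0: "X 0 = z" using X(1) by (simp add: walk_def)
  have "n \<noteq> 0" using n z X0 by (cases n) auto
  then obtain m where m: "n = Suc m" by (cases n) auto
  have "\<bar>v (X n) - v (X m)\<bar> \<le> 1"
    using X(1) m by (intro height_walk_step[OF v]) (simp add: walk_def)
  then have last: "\<lceil>v (X n)\<rceil> = 0" using n least[of m] m by linarith
  have "path_prefix (Suc n) X \<in> crossings_down v z"
    unfolding crossings_down_def mem_Collect_eq tl_path_prefix_Suc butlast_path_prefix_Suc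
  proof (intro conjI)
    show "\<forall>x\<in>set (map X [1..<Suc n]). v x \<le> v z - 1"
      using X(2) X0 by (auto simp: escape_above_def stays_above_def le_diff_eq)
    show "\<forall>x\<in>set (path_prefix n X). 0 < \<lceil>v x\<rceil>"
      using least by (auto simp: set_path_prefix not_le)
    show "hd (path_prefix (Suc n) X) = z" using X0 by (simp add: hd_conv_nth flip: length_greater_0_conv)
  qed (use last nearest_neighbour_path_prefix[OF X(1), of "Suc n"] in \<open>auto simp: path_prefix_Suc\<close>)
  then show ?thesis by (rule bexI[rotated]) simp
qed

section \<open>Two walks in one environment\<close>

lemma escapes_path_shift: "path_shift m X \<in> escapes w \<longleftrightarrow> X \<in> escapes w"
  using eventually_sequentially_seg[of "\<lambda>n. c \<le> w (X n)" m for c]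
  by (simp add: filterlim_at_top path_shift_apply add.commute)

lemma not_escapes_both: "X \<in> escapes v \<Longrightarrow> X \<notin> escapes (\<lambda>x. - v x)"
proof
  assume "X \<in> escapes v" "X \<in> escapes (\<lambda>x. - v x)"
  then have "\<forall>\<^sub>F n in sequentially. 1 \<le> v (X n)" "\<forall>\<^sub>F n in sequentially. 1 \<le> - v (X n)"
    unfolding mem_Collect_eq filterlim_at_top by blast+
  then have "\<forall>\<^sub>F n in sequentially. False" by eventually_elim linarith
  then show False by simp
qed

abbreviation escape_prob :: "(site \<Rightarrow> real) \<Rightarrow> environment \<Rightarrow> site \<Rightarrow> real" where
  "escape_prob v \<omega> x \<equiv> qprob \<omega> x (escapes v)"

text \<open>
  The walk escapes although at some site far from its start the quenched probability of escaping was not yet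
  close to one.
\<close>

definition escape_from_doubt ::
  "real \<Rightarrow> (site \<Rightarrow> real) \<Rightarrow> real \<Rightarrow> environment \<Rightarrow> path set" where
  "escape_from_doubt \<epsilon> v h \<omega> =
     {X. X \<in> escapes v \<and> (\<exists>n. h \<le> v (X n) - v (X 0) \<and> escape_prob v \<omega> (X n) < 1 - \<epsilon>)}"

text \<open>
  The walk escapes downwards although at some site on its way escaping upwards was almost certain.
\<close>

definition escape_against_odds ::
  "real \<Rightarrow> (site \<Rightarrow> real) \<Rightarrow> environment \<Rightarrow> path set" where
  "escape_against_odds \<epsilon> v \<omega> =
     {X. X \<in> escapes (\<lambda>x. - v x) \<and> (\<exists>n. 1 - \<epsilon> \<le> escape_prob v \<omega> (X n))}"

lemma measurable_escape_prob_at [measurable]: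
  "(\<lambda>X. escape_prob v \<omega> (X n)) \<in> borel_measurable path_space"
  by (rule measurable_compose[OF measurable_path_component]) simp

lemma escape_from_doubt_measurable [measurable]: "escape_from_doubt \<epsilon> v h \<omega> \<in> sets path_space"
  unfolding escape_from_doubt_def mem_Collect_eq by (rule path_pred_event) measurable

lemma escape_against_odds_measurable [measurable]: "escape_against_odds \<epsilon> v \<omega> \<in> sets path_space"
  unfolding escape_against_odds_def mem_Collect_eq by (rule path_pred_event) measurable

text \<open>
  Stop at the first site where escaping upwards is almost certain; from there, escaping downwards has
  probability at most \<open>\<epsilon>\<close>.
\<close>

lemma measure_escape_against_odds:
  assumes \<omega>: "\<omega> \<in> space env_space" and \<epsilon>: "0 \<le> \<epsilon>"
  shows "qprob \<omega> z (escape_against_odds \<epsilon> v \<omega>) \<le> \<epsilon>"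
proof -
  interpret Q: path_measure "quenched_law \<omega> z" by (rule quenched_path_measure[OF \<omega>])
  let ?A = "escapes (\<lambda>x. - v x)"
  define \<phi> :: "site list \<Rightarrow> bool" where "\<phi> = (\<lambda>\<pi>. \<pi> \<noteq> [] \<and> 1 - \<epsilon> \<le> escape_prob v \<omega> (last \<pi>))"
  let ?T = "first_times 0 \<phi>"
  let ?H = "\<lambda>\<pi>. {X. path_shift (length \<pi> - 1) X \<in> ?A}"
  have H: "?H \<pi> \<in> sets (quenched_law \<omega> z)" for \<pi> :: "site list"
    unfolding Q.sets_Q by (rule path_event_measurable[OF path_shift_measurable escapes_measurable])
  have \<phi>: "\<phi> \<pi>" if "\<pi> \<in> ?T" for \<pi> using that by (simp add: first_times_def)
  have sub: "escape_against_odds \<epsilon> v \<omega> \<subseteq> (\<Union>\<pi>\<in>?T. cylinder \<pi> \<inter> ?H \<pi>)"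
  proof
    fix X assume X: "X \<in> escape_against_odds \<epsilon> v \<omega>"
    then obtain n where "1 - \<epsilon> \<le> escape_prob v \<omega> (X n)" by (auto simp: escape_against_odds_def)
    then have "\<phi> (path_prefix (Suc n) X)" by (simp add: \<phi>_def path_prefix_Suc)
    then obtain \<pi> where "\<pi> \<in> ?T" "X \<in> cylinder \<pi>" using first_times_cover[of 0 \<phi> X] by blast
    moreover have "X \<in> ?A" using X by (simp add: escape_against_odds_def)
    then have "X \<in> ?H \<pi>" for \<pi> :: "site list"
      using escapes_path_shift[of "length \<pi> - 1" X "\<lambda>x. - v x"] by blast
    ultimately show "X \<in> (\<Union>\<pi>\<in>?T. cylinder \<pi> \<inter> ?H \<pi>)" by blast
  qed
  have U: "(\<Union>\<pi>\<in>?T. cylinder \<pi> \<inter> G \<pi>) \<in> sets (quenched_law \<omega> z)" if "\<And>\<pi>. G \<pi> \<in> sets (quenched_law \<omega> z)" for G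
    by (rule sets.countable_UN'') (auto simp: Q.sets_Q that[unfolded Q.sets_Q])
  have odds: "qprob \<omega> x ?A \<le> \<epsilon>" if "1 - \<epsilon> \<le> escape_prob v \<omega> x" for x
  proof -
    interpret Qx: path_measure "quenched_law \<omega> x" by (rule quenched_path_measure[OF \<omega>])
    have "escapes v \<inter> ?A = {}" using not_escapes_both by blast
    then have "qprob \<omega> x (escapes v \<union> ?A) = escape_prob v \<omega> x + qprob \<omega> x ?A"
      by (intro Qx.finite_measure_Union)
        (use escapes_measurable[of v] escapes_measurable[of "\<lambda>x. - v x"] in \<open>simp_all only: Qx.sets_Q\<close>)
    then show ?thesis using that Qx.prob_le_1[of "escapes v \<union> ?A"] by linarith
  qed
  have "emeasure (quenched_law \<omega> z) (escape_against_odds \<epsilon> v \<omega>) \<le> emeasure (quenched_law \<omega> z) (\<Union>\<pi>\<in>?T. cylinder \<pi> \<inter> ?H \<pi>)"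
    by (intro emeasure_mono sub U H)
  also have "\<dots> = (\<integral>\<^sup>+\<pi>. emeasure (quenched_law \<omega> z) (cylinder \<pi> \<inter> ?H \<pi>) \<partial>count_space ?T)"
    by (intro Q.emeasure_UN_cylinders disjoint_first_times H)
  also have "\<dots> \<le> (\<integral>\<^sup>+\<pi>. ennreal \<epsilon> * emeasure (quenched_law \<omega> z) (cylinder \<pi> \<inter> UNIV) \<partial>count_space ?T)"
  proof (rule nn_integral_mono)
    fix \<pi> assume "\<pi> \<in> space (count_space ?T)"
    then have p: "\<pi> \<noteq> []" "1 - \<epsilon> \<le> escape_prob v \<omega> (last \<pi>)" using \<phi>[of \<pi>] by (auto simp: \<phi>_def)
    have "qprob \<omega> z (cylinder \<pi> \<inter> ?H \<pi>) = path_weight \<omega> z \<pi> * qprob \<omega> (last \<pi>) ?A"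
      by (rule quenched_Markov[OF \<omega> p(1) escapes_measurable])
    also have "\<dots> \<le> path_weight \<omega> z \<pi> * \<epsilon>"
      using odds[OF p(2)] weight_nonneg[OF \<omega>] p(1) by (intro mult_left_mono) (simp_all add: path_weight_eq)
    finally show "emeasure (quenched_law \<omega> z) (cylinder \<pi> \<inter> ?H \<pi>) \<le> ennreal \<epsilon> * emeasure (quenched_law \<omega> z) (cylinder \<pi> \<inter> UNIV)"
      using \<epsilon> by (simp add: Q.emeasure_eq_measure measure_quenched_law_cylinder[OF \<omega>] mult.commute ennreal_leI flip: ennreal_mult')
  qed
  also have "\<dots> = ennreal \<epsilon> * emeasure (quenched_law \<omega> z) (\<Union>\<pi>\<in>?T. cylinder \<pi> \<inter> UNIV)"
    using sets.top[of "quenched_law \<omega> z"]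
    by (subst Q.emeasure_UN_cylinders[OF disjoint_first_times]) (simp_all add: nn_integral_cmult)
  also have "\<dots> \<le> ennreal \<epsilon> * 1"
    by (intro mult_left_mono) (simp_all add: Q.emeasure_eq_measure)
  finally show ?thesis using \<epsilon> by (simp add: Q.emeasure_eq_measure)
qed

text \<open>
  Every site with escape probability less than \<open>1 - \<epsilon>\<close> is a trial for not escaping at all.
\<close>

lemma measure_recurrent_doubt:
  assumes \<omega>: "\<omega> \<in> space env_space" and \<epsilon>: "0 < \<epsilon>"
  shows "qprob \<omega> z {X. X \<in> escapes v \<and> (\<forall>N. \<exists>n\<ge>N. escape_prob v \<omega> (X n) < 1 - \<epsilon>)} = 0"
proof -
  interpret Q: path_measure "quenched_law \<omega> z" by (rule quenched_path_measure[OF \<omega>])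
  let ?O = "{X. X \<in> escapes v \<and> (\<forall>N. \<exists>n\<ge>N. escape_prob v \<omega> (X n) < 1 - \<epsilon>)}"
  let ?H = "\<lambda>\<pi>. {X. path_shift (length \<pi> - 1) X \<in> UNIV - escapes v}"
  have m: "UNIV - escapes v \<in> sets path_space"
    using sets.compl_sets[OF escapes_measurable, of v] by (simp only: space_path_space)
  show ?thesis
  proof (rule Q.recurrent_trials[where \<phi>="\<lambda>\<pi>. \<pi> \<noteq> [] \<and> escape_prob v \<omega> (last \<pi>) < 1 - \<epsilon>" and H="?H" and N\<^sub>0=0 and \<kappa>=\<epsilon>])
    show "?O \<in> sets (quenched_law \<omega> z)"
      unfolding Q.sets_Q mem_Collect_eq by (rule path_pred_event) measurable
  next
    fix X and N :: nat assume "X \<in> ?O"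
    then obtain n where "n \<ge> N" "escape_prob v \<omega> (X n) < 1 - \<epsilon>" by blast
    then show "\<exists>n\<ge>N. path_prefix n X \<noteq> [] \<and> escape_prob v \<omega> (last (path_prefix n X)) < 1 - \<epsilon>"
      by (intro exI[of _ "Suc n"]) (simp add: path_prefix_Suc)
  next
    fix \<pi> :: "site list"
    show "?H \<pi> \<in> sets (quenched_law \<omega> z)"
      unfolding Q.sets_Q by (rule path_event_measurable[OF path_shift_measurable m])
  next
    fix \<pi> :: "site list" assume \<pi>: "\<pi> \<noteq> [] \<and> escape_prob v \<omega> (last \<pi>) < 1 - \<epsilon>"
    interpret Q': path_measure "quenched_law \<omega> (last \<pi>)" by (rule quenched_path_measure[OF \<omega>])
    have "qprob \<omega> (last \<pi>) (UNIV - escapes v) = 1 - escape_prob v \<omega> (last \<pi>)"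
      using Q'.prob_compl[of "escapes v"] escapes_measurable[of v] by (simp add: Q'.sets_Q)
    then have "qprob \<omega> z (cylinder \<pi> \<inter> ?H \<pi>) = path_weight \<omega> z \<pi> * (1 - escape_prob v \<omega> (last \<pi>))"
      using quenched_Markov[OF \<omega> _ m, of \<pi> z] \<pi> by simp
    moreover have "path_weight \<omega> z \<pi> * \<epsilon> \<le> path_weight \<omega> z \<pi> * (1 - escape_prob v \<omega> (last \<pi>))"
      using \<pi> weight_nonneg[OF \<omega>] by (intro mult_left_mono) (simp_all add: path_weight_eq)
    ultimately show "\<epsilon> * qprob \<omega> z (cylinder \<pi>) \<le> qprob \<omega> z (cylinder \<pi> \<inter> ?H \<pi>)"
      by (simp add: measure_quenched_law_cylinder[OF \<omega>] mult.commute)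
  next
    fix X and \<pi> :: "site list" assume "X \<in> ?O"
    then have "path_shift (length \<pi> - 1) X \<in> escapes v" by (simp only: escapes_path_shift mem_Collect_eq[of X])
    then show "X \<notin> ?H \<pi>" by blast
  qed (rule \<epsilon>)
qed

text \<open>
  A path that reaches sites of doubt at arbitrarily large heights does so at arbitrarily late times, since it is
  bounded up to any fixed time.
\<close>

lemma tendsto_escape_from_doubt:
  assumes \<omega>: "\<omega> \<in> space env_space" and \<epsilon>: "0 < \<epsilon>"
  shows "(\<lambda>k. qprob \<omega> z (escape_from_doubt \<epsilon> v (real k) \<omega>)) \<longlonglongrightarrow> 0"
proof -
  interpret Q: path_measure "quenched_law \<omega> z" by (rule quenched_path_measure[OF \<omega>])
  let ?O = "{X. X \<in> escapes v \<and> (\<forall>N. \<exists>n\<ge>N. escape_prob v \<omega> (X n) < 1 - \<epsilon>)}"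
  let ?D = "\<lambda>k. escape_from_doubt \<epsilon> v (real k) \<omega>"
  have D: "?D k \<in> sets (quenched_law \<omega> z)" for k by (simp add: Q.sets_Q)
  have "decseq ?D"
    unfolding decseq_def escape_from_doubt_def by (auto intro: order_trans[OF of_nat_mono])
  then have lim: "(\<lambda>k. qprob \<omega> z (?D k)) \<longlonglongrightarrow> qprob \<omega> z (\<Inter>k. ?D k)"
    using D by (intro Q.finite_Lim_measure_decseq) auto
  have "(\<Inter>k. ?D k) \<subseteq> ?O"
  proof
    fix X assume X: "X \<in> (\<Inter>k. ?D k)"
    have "\<exists>n\<ge>N. escape_prob v \<omega> (X n) < 1 - \<epsilon>" for N
    proof -
      obtain k :: nat where k: "Max ((\<lambda>i. v (X i) - v (X 0)) ` {..N}) < real k" using reals_Archimedean2 by blast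
      have small: "v (X i) - v (X 0) < real k" if "i \<le> N" for i
        using that k by (intro le_less_trans[OF Max_ge k]) auto
      obtain n where n: "real k \<le> v (X n) - v (X 0)" "escape_prob v \<omega> (X n) < 1 - \<epsilon>"
        using X by (auto simp: escape_from_doubt_def)
      then have "n \<ge> N" using small[of n] by (cases "n \<le> N") auto
      with n show ?thesis by blast
    qed
    moreover have "X \<in> escapes v" using X by (auto simp: escape_from_doubt_def)
    ultimately show "X \<in> ?O" by blast
  qed
  moreover have "?O \<in> sets (quenched_law \<omega> z)"
    unfolding Q.sets_Q mem_Collect_eq by (rule path_pred_event) measurable
  ultimately have "qprob \<omega> z (\<Inter>k. ?D k) \<le> qprob \<omega> z ?O"
    by (rule Q.finite_measure_mono)
  then have "qprob \<omega> z (\<Inter>k. ?D k) = 0"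
    using measure_recurrent_doubt[OF \<omega> \<epsilon>] by (simp add: order_antisym)
  with lim show ?thesis by simp
qed

lemma emeasure_pair_cylinders:
  assumes Q: "path_measure Q" "path_measure Q'"
    and disj: "disjoint_family_on cylinder T" "disjoint_family_on cylinder T'" and W: "W \<subseteq> T \<times> T'"
  shows "(\<Union>p\<in>W. cylinder (fst p) \<times> cylinder (snd p)) \<in> sets (Q \<Otimes>\<^sub>M Q')"
    and "emeasure (Q \<Otimes>\<^sub>M Q') (\<Union>p\<in>W. cylinder (fst p) \<times> cylinder (snd p)) =
    (\<integral>\<^sup>+p. ennreal (measure Q (cylinder (fst p)) * measure Q' (cylinder (snd p))) \<partial>count_space W)"
proof -
  interpret Q: path_measure Q by fact
  interpret Q': path_measure Q' by fact
  have c: "cylinder xs \<in> sets Q" "cylinder xs \<in> sets Q'" for xs by (simp_all add: Q.sets_Q Q'.sets_Q)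
  have d: "disjoint_family_on (\<lambda>p. cylinder (fst p) \<times> cylinder (snd p)) W"
    unfolding disjoint_family_on_def
  proof (intro ballI impI)
    fix p q assume pq: "p \<in> W" "q \<in> W" "p \<noteq> q"
    then have "p \<in> T \<times> T'" "q \<in> T \<times> T'" using W by auto
    then have t: "fst p \<in> T" "fst q \<in> T" "snd p \<in> T'" "snd q \<in> T'" by (simp_all add: mem_Times_iff)
    have "fst p \<noteq> fst q \<or> snd p \<noteq> snd q" using pq(3) by (simp add: prod_eq_iff)
    then have "cylinder (fst p) \<inter> cylinder (fst q) = {} \<or> cylinder (snd p) \<inter> cylinder (snd q) = {}"
      using t disj unfolding disjoint_family_on_def by blast
    then show "cylinder (fst p) \<times> cylinder (snd p) \<inter> cylinder (fst q) \<times> cylinder (snd q) = {}" by blast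
  qed
  have m: "cylinder (fst p) \<times> cylinder (snd p) \<in> sets (Q \<Otimes>\<^sub>M Q')" for p by (rule pair_measureI[OF c])
  show "(\<Union>p\<in>W. cylinder (fst p) \<times> cylinder (snd p)) \<in> sets (Q \<Otimes>\<^sub>M Q')"
    by (rule sets.countable_UN'') (auto intro: m)
  have "emeasure (Q \<Otimes>\<^sub>M Q') (\<Union>p\<in>W. cylinder (fst p) \<times> cylinder (snd p)) =
      (\<integral>\<^sup>+p. emeasure (Q \<Otimes>\<^sub>M Q') (cylinder (fst p) \<times> cylinder (snd p)) \<partial>count_space W)"
    by (rule emeasure_UN_countable) (use m d in auto)
  also have "\<dots> = (\<integral>\<^sup>+p. ennreal (measure Q (cylinder (fst p)) * measure Q' (cylinder (snd p))) \<partial>count_space W)"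
    using c by (intro nn_integral_cong)
      (simp add: Q'.emeasure_pair_measure_Times Q.emeasure_eq_measure Q'.emeasure_eq_measure ennreal_mult)
  finally show "emeasure (Q \<Otimes>\<^sub>M Q') (\<Union>p\<in>W. cylinder (fst p) \<times> cylinder (snd p)) =
    (\<integral>\<^sup>+p. ennreal (measure Q (cylinder (fst p)) * measure Q' (cylinder (snd p))) \<partial>count_space W)" .
qed

text \<open>
  Under the product of the two quenched laws, two escaping walks either have disjoint crossings or share a site.
  A shared site is far from \<open>0\<close> or far from \<open>z\<close>. In the first case, either the first walk escapes from doubt there,
  or the second one escapes against the odds after visiting it; the second case is symmetric. Each of
  these four events concerns a single walk.
\<close>

lemma quenched_two_walks_bound:
  assumes v: "coordinate_height v e" and \<omega>: "\<omega> \<in> space env_space" and \<epsilon>: "0 \<le> \<epsilon>"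
    and z: "\<lceil>v z\<rceil> = 2 * int k + 1"
  defines "W \<equiv> {p \<in> crossings_up v (2 * int k + 1) \<times> crossings_down v z. set (fst p) \<inter> set (snd p) = {}}"
  shows "ennreal (qprob \<omega> 0 (escape_above v) * qprob \<omega> z (escape_above (\<lambda>x. - v x))) \<le>
    ennreal (qprob \<omega> 0 (escape_from_doubt \<epsilon> v (real k) \<omega>) +
      qprob \<omega> z (escape_from_doubt \<epsilon> (\<lambda>x. - v x) (real k) \<omega>) + 2 * \<epsilon>) +
    (\<integral>\<^sup>+p. ennreal (path_weight \<omega> 0 (fst p) * path_weight \<omega> z (snd p)) \<partial>count_space W)"
proof -
  interpret Q: path_measure "quenched_law \<omega> 0" by (rule quenched_path_measure[OF \<omega>])
  interpret Q': path_measure "quenched_law \<omega> z" by (rule quenched_path_measure[OF \<omega>])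
  let ?v' = "\<lambda>x. - v x"
  let ?M = "quenched_law \<omega> 0 \<Otimes>\<^sub>M quenched_law \<omega> z"
  let ?L = "2 * int k + 1"
  define E1 where "E1 = escape_above v \<inter> {X. walk 0 X}"
  define E2 where "E2 = escape_above ?v' \<inter> {X. walk z X}"
  define D1 where "D1 = escape_from_doubt \<epsilon> v (real k) \<omega>"
  define D2 where "D2 = escape_from_doubt \<epsilon> ?v' (real k) \<omega>"
  define O1 where "O1 = escape_against_odds \<epsilon> ?v' \<omega>"
  define O2 where "O2 = escape_against_odds \<epsilon> v \<omega>"
  define U where "U = (\<Union>p\<in>W. cylinder (fst p) \<times> cylinder (snd p))"
  have sets_path: "E1 \<in> sets path_space" "E2 \<in> sets path_space" "D1 \<in> sets path_space" "D2 \<in> sets path_space"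
    "O1 \<in> sets path_space" "O2 \<in> sets path_space" "UNIV \<in> sets path_space"
    using sets.top[of path_space] by (simp_all add: E1_def E2_def D1_def D2_def O1_def O2_def sets.Int)
  then have s: "E1 \<in> sets (quenched_law \<omega> 0)" "D1 \<in> sets (quenched_law \<omega> 0)" "O1 \<in> sets (quenched_law \<omega> 0)"
    "E2 \<in> sets (quenched_law \<omega> z)" "D2 \<in> sets (quenched_law \<omega> z)" "O2 \<in> sets (quenched_law \<omega> z)"
    "UNIV \<in> sets (quenched_law \<omega> 0)" "UNIV \<in> sets (quenched_law \<omega> z)"
    by (simp_all only: Q.sets_Q Q'.sets_Q)
  have W: "W \<subseteq> crossings_up v ?L \<times> crossings_down v z" unfolding W_def by blast
  note pairs = emeasure_pair_cylinders[OF Q.path_measure_axioms Q'.path_measure_axioms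
    disjoint_crossings_up disjoint_crossings_down W]
  have U: "U \<in> sets ?M" unfolding U_def by (rule pairs(1))
  have "E1 \<times> E2 \<subseteq> D1 \<times> UNIV \<union> UNIV \<times> D2 \<union> O1 \<times> UNIV \<union> UNIV \<times> O2 \<union> U"
  proof
    fix p assume "p \<in> E1 \<times> E2"
    then obtain X Y where p: "p = (X, Y)" and X: "X \<in> E1" and Y: "Y \<in> E2" by blast
    have X': "walk 0 X" "X \<in> escape_above v" and Y': "walk z Y" "Y \<in> escape_above ?v'"
      using X Y by (auto simp: E1_def E2_def)
    obtain \<pi> where \<pi>: "\<pi> \<in> crossings_up v ?L" "X \<in> cylinder \<pi>"
      using ex_crossing_up[OF v X', of ?L] by auto
    obtain \<rho> where \<rho>: "\<rho> \<in> crossings_down v z" "Y \<in> cylinder \<rho>"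
      using ex_crossing_down[OF v Y'] z by auto
    show "p \<in> D1 \<times> UNIV \<union> UNIV \<times> D2 \<union> O1 \<times> UNIV \<union> UNIV \<times> O2 \<union> U"
    proof (cases "set \<pi> \<inter> set \<rho> = {}")
      case True
      then have "(\<pi>, \<rho>) \<in> W" using \<pi> \<rho> by (simp add: W_def)
      then have "p \<in> U" unfolding U_def p using \<pi>(2) \<rho>(2) by force
      then show ?thesis by blast
    next
      case False
      then obtain i j where "i < length \<pi>" "j < length \<rho>" "\<pi> ! i = \<rho> ! j"
        by (metis disjoint_iff in_set_conv_nth)
      then have meet: "X i = Y j" using cylinder_eqD[OF \<pi>(2)] cylinder_eqD[OF \<rho>(2)] by metis
      have esc: "X \<in> escapes v" "Y \<in> escapes ?v'" using X' Y' by (auto simp: escape_above_def)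
      have start: "X 0 = 0" "Y 0 = z" using X' Y' by (auto simp: walk_def)
      have v0: "v 0 = 0" by (rule height_zero[OF v])
      show ?thesis
      proof (cases "real k \<le> v (X i)")
        case high: True
        show ?thesis
        proof (cases "escape_prob v \<omega> (X i) < 1 - \<epsilon>")
          case True
          then have "X \<in> D1" unfolding D1_def escape_from_doubt_def using esc high start v0 by auto
          then show ?thesis by (simp add: p)
        next
          case False
          then have "Y \<in> O2" unfolding O2_def escape_against_odds_def using esc meet by (auto simp: not_less)
          then show ?thesis by (simp add: p)
        qed
      next
        case low: False
        \<comment> \<open>the level of \<open>z\<close> is \<open>2 * k + 1\<close>, so a site at height less than \<open>k\<close> is at least \<open>k\<close> below it\<close>
        have far: "real k \<le> ?v' (Y j) - ?v' (Y 0)" using low z meet start by simp linarith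
        show ?thesis
        proof (cases "escape_prob ?v' \<omega> (Y j) < 1 - \<epsilon>")
          case True
          then have "Y \<in> D2" unfolding D2_def escape_from_doubt_def using esc far by auto
          then show ?thesis by (simp add: p)
        next
          case False
          then have "X \<in> O1" unfolding O1_def escape_against_odds_def using esc meet by (auto simp: not_less intro!: exI[of _ i])
          then show ?thesis by (simp add: p)
        qed
      qed
    qed
  qed
  then have "emeasure ?M (E1 \<times> E2) \<le> emeasure ?M (D1 \<times> UNIV \<union> UNIV \<times> D2 \<union> O1 \<times> UNIV \<union> UNIV \<times> O2 \<union> U)"
    using s U by (intro emeasure_mono) auto
  also have "\<dots> \<le> emeasure ?M (D1 \<times> UNIV \<union> UNIV \<times> D2 \<union> O1 \<times> UNIV \<union> UNIV \<times> O2) + emeasure ?M U"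
    using s U by (intro emeasure_subadditive) auto
  also have "emeasure ?M (D1 \<times> UNIV \<union> UNIV \<times> D2 \<union> O1 \<times> UNIV \<union> UNIV \<times> O2) \<le>
      emeasure ?M (D1 \<times> UNIV) + emeasure ?M (UNIV \<times> D2) + emeasure ?M (O1 \<times> UNIV) + emeasure ?M (UNIV \<times> O2)"
    using s by (intro order_trans[OF emeasure_subadditive] add_mono order_refl) auto
  also have "\<dots> = ennreal (qprob \<omega> 0 D1 + qprob \<omega> z D2 +
      qprob \<omega> 0 O1 + qprob \<omega> z O2)"
    using s Q.emeasure_space_1 Q'.emeasure_space_1
    by (simp add: Q'.emeasure_pair_measure_Times Q.emeasure_eq_measure Q'.emeasure_eq_measure)
  also have "\<dots> \<le> ennreal (qprob \<omega> 0 D1 + qprob \<omega> z D2 + 2 * \<epsilon>)"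
    using measure_escape_against_odds[OF \<omega> \<epsilon>, of 0 ?v'] measure_escape_against_odds[OF \<omega> \<epsilon>, of z v]
    by (intro ennreal_leI) (simp add: O1_def O2_def)
  also have "emeasure ?M U = (\<integral>\<^sup>+p. ennreal (path_weight \<omega> 0 (fst p) * path_weight \<omega> z (snd p)) \<partial>count_space W)"
    unfolding U_def pairs(2) by (simp only: measure_quenched_law_cylinder[OF \<omega>])
  finally have "emeasure ?M (E1 \<times> E2) \<le> ennreal (qprob \<omega> 0 D1 + qprob \<omega> z D2 + 2 * \<epsilon>) +
      (\<integral>\<^sup>+p. ennreal (path_weight \<omega> 0 (fst p) * path_weight \<omega> z (snd p)) \<partial>count_space W)"
    by (simp add: add_right_mono)
  moreover have "emeasure ?M (E1 \<times> E2) = ennreal (qprob \<omega> 0 E1 * qprob \<omega> z E2)"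
    using s by (simp add: Q'.emeasure_pair_measure_Times Q.emeasure_eq_measure Q'.emeasure_eq_measure ennreal_mult)
  moreover have "qprob \<omega> 0 E1 = qprob \<omega> 0 (escape_above v)"
    using AE_quenched_walk[OF \<omega>, of 0] s(1) escape_above_measurable[of v]
    by (intro Q.finite_measure_eq_AE) (auto simp: E1_def Q.sets_Q)
  moreover have "qprob \<omega> z E2 = qprob \<omega> z (escape_above ?v')"
    using AE_quenched_walk[OF \<omega>, of z] s(4) escape_above_measurable[of ?v']
    by (intro Q'.finite_measure_eq_AE) (auto simp: E2_def Q'.sets_Q)
  ultimately show ?thesis by (simp only: D1_def D2_def)
qed

lemma unit_product_perturb:
  fixes a b a' b' p q :: real
  assumes "0 \<le> a" "a \<le> 1" "0 \<le> b" "b \<le> 1" "0 \<le> a'" "a' \<le> 1" "0 \<le> b'" "b' \<le> 1"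
    and "a \<le> a' + p" "b \<le> b' + q" "0 \<le> p" "0 \<le> q"
  shows "a * b \<le> a' * b' + p + q"
proof -
  have "a * b \<le> a * (b' + q)" by (rule mult_left_mono) fact+
  also have "\<dots> \<le> a * b' + q" using mult_right_mono[OF \<open>a \<le> 1\<close> \<open>0 \<le> q\<close>] by (simp add: algebra_simps)
  also have "a * b' \<le> (a' + p) * b'" by (rule mult_right_mono) fact+
  also have "(a' + p) * b' \<le> a' * b' + p" using mult_left_mono[OF \<open>b' \<le> 1\<close> \<open>0 \<le> p\<close>] by (simp add: algebra_simps)
  finally show ?thesis by linarith
qed

lemma walk_height_bound:
  assumes v: "coordinate_height v e" and X: "walk z X"
  shows "\<bar>v (X n) - v z\<bar> \<le> real n"
proof (induction n)
  case 0
  then show ?case using X by (simp add: walk_def)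
next
  case (Suc n)
  have "\<bar>v (X (Suc n)) - v (X n)\<bar> \<le> 1"
    by (rule height_walk_step[OF v]) (use X in \<open>simp add: walk_def\<close>)
  with Suc show ?case by simp
qed

text \<open>
  The part of \<open>escape_above v\<close> that is visible when the walk has risen by \<open>m\<close>. Unlike \<open>escape_above v\<close>, it contains
  all paths in the cylinders of the crossings of a slab.
\<close>

definition progress :: "(site \<Rightarrow> real) \<Rightarrow> real \<Rightarrow> path set" where
  "progress v m = {X. \<exists>n. m \<le> v (X n) - v (X 0) \<and> (\<forall>i\<ge>1. i \<le> n \<longrightarrow> v (X 0) + 1 \<le> v (X i))}"

lemma progress_measurable [measurable]: "progress v m \<in> sets path_space"
proof -
  have "{X \<in> space path_space. \<exists>n. m \<le> v (X n) - v (X 0) \<and> (\<forall>i\<ge>1. i \<le> n \<longrightarrow> v (X 0) + 1 \<le> v (X i))} \<in> sets path_space"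
    by measurable
  then show ?thesis by (simp add: progress_def)
qed

lemma quenched_doubt_measurable:
  "(\<lambda>\<omega>. qprob \<omega> z (escape_from_doubt \<epsilon> v h \<omega>)) \<in> borel_measurable env_space"
proof (rule measure_measurable_subprob_algebra2[OF _ measurable_quenched_kernel])
  let ?S = "env_space \<Otimes>\<^sub>M path_space"
  have h [measurable]: "(\<lambda>p. v (snd p n)) \<in> borel_measurable ?S" for n
    by (rule measurable_compose[OF measurable_snd measurable_height])
  have r [measurable]: "(\<lambda>p. escape_prob v (fst p) (snd p n)) \<in> borel_measurable ?S" for n
  proof (rule measurable_compose_countable)
    show "(\<lambda>p. escape_prob v (fst p) x) \<in> borel_measurable ?S" for x
      by (rule measurable_compose[OF measurable_fst measurable_quenched_measure[OF escapes_measurable]])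
    show "(\<lambda>p. snd p n) \<in> measurable ?S (count_space UNIV)"
      by (rule measurable_compose[OF measurable_snd measurable_path_component])
  qed
  have "{p \<in> space ?S. (\<forall>k. \<exists>N. \<forall>n\<ge>N. real k \<le> v (snd p n)) \<and>
      (\<exists>n. h \<le> v (snd p n) - v (snd p 0) \<and> escape_prob v (fst p) (snd p n) < 1 - \<epsilon>)} \<in> sets ?S" by measurable
  also have "{p \<in> space ?S. (\<forall>k. \<exists>N. \<forall>n\<ge>N. real k \<le> v (snd p n)) \<and>
      (\<exists>n. h \<le> v (snd p n) - v (snd p 0) \<and> escape_prob v (fst p) (snd p n) < 1 - \<epsilon>)} =
      (SIGMA \<omega>:space env_space. escape_from_doubt \<epsilon> v h \<omega>)"
    by (auto simp: escape_from_doubt_def filterlim_at_top_nat_iff space_pair_measure)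
  finally show "(SIGMA \<omega>:space env_space. escape_from_doubt \<epsilon> v h \<omega>) \<in> sets ?S" .
qed

lemma escape_from_doubt_translate:
  assumes v: "coordinate_height v e" and \<omega>: "\<omega> \<in> space env_space"
  shows "qprob \<omega> z (escape_from_doubt \<epsilon> v h \<omega>) =
    qprob (shift_env z \<omega>) 0 (escape_from_doubt \<epsilon> v h (shift_env z \<omega>))"
proof -
  have esc: "{X. (\<lambda>n. X n - y) \<in> escapes v} = escapes v" for y
    using filterlim_tendsto_add_at_top_iff[of "\<lambda>_. - v y" "- v y" sequentially "\<lambda>n. v (X n)" for X]
    by (simp add: height_diff[OF v])
  have prob: "escape_prob v (shift_env z \<omega>) (x - z) = escape_prob v \<omega> x" for x
    using quenched_law_translate[OF \<omega> escapes_measurable, of "x - z" z v] esc[of z] by simp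
  have "{X. (\<lambda>n. X n - z) \<in> escape_from_doubt \<epsilon> v h (shift_env z \<omega>)} = escape_from_doubt \<epsilon> v h \<omega>"
    using esc[of z] by (auto simp: escape_from_doubt_def prob height_diff[OF v])
  then show ?thesis
    using quenched_law_translate[OF \<omega> escape_from_doubt_measurable, of 0 z \<epsilon> v h "shift_env z \<omega>"] by simp
qed

text \<open>
  A median of the integer \<open>f \<pi>\<close> of the stopped path \<open>\<pi>\<close>: the largest \<open>k\<close> for which the values less than \<open>k\<close> carry at
  most half of the mass.
\<close>

lemma (in path_measure) median_of_cylinders:
  fixes f :: "site list \<Rightarrow> int"
  assumes disj: "disjoint_family_on cylinder T"
  obtains k where
    "measure Q (\<Union>\<pi>\<in>{\<pi>\<in>T. f \<pi> < k}. cylinder \<pi>) \<le> measure Q (\<Union>\<pi>\<in>T. cylinder \<pi>) / 2"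
    "measure Q (\<Union>\<pi>\<in>{\<pi>\<in>T. k < f \<pi>}. cylinder \<pi>) \<le> measure Q (\<Union>\<pi>\<in>T. cylinder \<pi>) / 2"
proof -
  define m where "m = (\<lambda>k. measure Q (\<Union>\<pi>\<in>{\<pi>\<in>T. f \<pi> < k}. cylinder \<pi>))"
  define d where "d = measure Q (\<Union>\<pi>\<in>T. cylinder \<pi>)"
  have sets: "(\<Union>\<pi>\<in>A. cylinder \<pi>) \<in> sets Q" for A
    by (rule sets.countable_UN'') (auto simp: sets_Q)
  show ?thesis
  proof (cases "d = 0")
    case True
    have "measure Q (\<Union>\<pi>\<in>A. cylinder \<pi>) \<le> d" if "A \<subseteq> T" for A
      unfolding d_def using sets that by (intro finite_measure_mono) auto
    from this[of "{\<pi>\<in>T. f \<pi> < 0}"] this[of "{\<pi>\<in>T. 0 < f \<pi>}"] show ?thesis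
      by (intro that[of 0]) (auto simp: True d_def[symmetric])
  next
    case False
    then have d: "d > 0" by (simp add: d_def zero_less_measure_iff)
    have up: "(\<lambda>n. m (int n)) \<longlonglongrightarrow> d"
    proof -
      have "(\<lambda>n. m (int n)) \<longlonglongrightarrow> measure Q (\<Union>n. \<Union>\<pi>\<in>{\<pi>\<in>T. f \<pi> < int n}. cylinder \<pi>)"
        unfolding m_def using sets by (intro finite_Lim_measure_incseq) (auto simp: incseq_def)
      also have "(\<Union>n. \<Union>\<pi>\<in>{\<pi>\<in>T. f \<pi> < int n}. cylinder \<pi>) = (\<Union>\<pi>\<in>T. cylinder \<pi>)"
      proof -
        have "\<exists>n. f \<pi> < int n" for \<pi> by (rule exI[of _ "nat (f \<pi> + 1)"]) linarith
        then show ?thesis by blast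
      qed
      finally show ?thesis by (simp add: d_def)
    qed
    have down: "(\<lambda>n. m (- int n)) \<longlonglongrightarrow> 0"
    proof -
      have "(\<lambda>n. m (- int n)) \<longlonglongrightarrow> measure Q (\<Inter>n. \<Union>\<pi>\<in>{\<pi>\<in>T. f \<pi> < - int n}. cylinder \<pi>)"
        unfolding m_def using sets by (intro finite_Lim_measure_decseq) (auto simp: decseq_def)
      also have "(\<Inter>n. \<Union>\<pi>\<in>{\<pi>\<in>T. f \<pi> < - int n}. cylinder \<pi>) = {}"
      proof (rule ccontr)
        assume "\<not> ?thesis"
        then obtain X where "X \<in> (\<Inter>n. \<Union>\<pi>\<in>{\<pi>\<in>T. f \<pi> < - int n}. cylinder \<pi>)" by blast
        then have X: "\<exists>\<pi>\<in>T. f \<pi> < - int n \<and> X \<in> cylinder \<pi>" for n by blast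
        obtain \<pi> where \<pi>: "\<pi> \<in> T" "X \<in> cylinder \<pi>" using X[of 0] by blast
        obtain \<rho> where \<rho>: "\<rho> \<in> T" "f \<rho> < - int (nat \<bar>f \<pi>\<bar>)" "X \<in> cylinder \<rho>" using X by blast
        have "\<pi> = \<rho>" using disj \<pi> \<rho> unfolding disjoint_family_on_def by blast
        with \<rho>(2) show False by simp
      qed
      finally show ?thesis by simp
    qed
    have "\<forall>\<^sub>F n in sequentially. d / 2 < m (int n)" using d by (intro order_tendstoD(1)[OF up]) simp
    then obtain a where a: "d / 2 < m (int a)" by (auto simp: eventually_sequentially)
    have "\<forall>\<^sub>F n in sequentially. m (- int n) < d / 2" using d by (intro order_tendstoD(2)[OF down]) simp
    then obtain b where b: "m (- int b) < d / 2" by (auto simp: eventually_sequentially)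
    have "\<exists>k. m k \<le> d / 2 \<and> d / 2 < m (k + 1)"
    proof (rule ccontr)
      assume *: "\<nexists>k. m k \<le> d / 2 \<and> d / 2 < m (k + 1)"
      have "m (- int b + int n) \<le> d / 2" for n
      proof (induction n)
        case (Suc n)
        then have "\<not> d / 2 < m (- int b + int n + 1)" using * by blast
        then show ?case by (simp add: algebra_simps)
      qed (use b in simp)
      from this[of "a + b"] a show False by simp
    qed
    then obtain k where k: "m k \<le> d / 2" "d / 2 < m (k + 1)" by blast
    let ?U = "\<lambda>A. \<Union>\<pi>\<in>A. cylinder \<pi>"
    have "measure Q (?U {\<pi>\<in>T. f \<pi> < k + 1} \<union> ?U {\<pi>\<in>T. k < f \<pi>}) =
        measure Q (?U {\<pi>\<in>T. f \<pi> < k + 1}) + measure Q (?U {\<pi>\<in>T. k < f \<pi>})"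
    proof (rule finite_measure_Union[OF sets sets])
      show "?U {\<pi>\<in>T. f \<pi> < k + 1} \<inter> ?U {\<pi>\<in>T. k < f \<pi>} = {}"
      proof (rule ccontr)
        assume "\<not> ?thesis"
        then obtain X \<pi> \<rho> where X: "\<pi> \<in> T" "f \<pi> < k + 1" "X \<in> cylinder \<pi>" "\<rho> \<in> T" "k < f \<rho>" "X \<in> cylinder \<rho>" by auto
        then have "\<pi> = \<rho>" using disj unfolding disjoint_family_on_def by blast
        with X show False by simp
      qed
    qed
    moreover have "measure Q (?U {\<pi>\<in>T. f \<pi> < k + 1} \<union> ?U {\<pi>\<in>T. k < f \<pi>}) \<le> d"
      unfolding d_def by (intro finite_measure_mono sets) auto
    ultimately have "measure Q (?U {\<pi>\<in>T. k < f \<pi>}) \<le> d / 2" using k(2) by (simp add: m_def)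
    with k(1) show ?thesis by (intro that[of k]) (simp_all add: m_def d_def)
  qed
qed

context elliptic_environment begin

text \<open>
  A path that makes progress to every height stays above its start and does not escape downwards; hence it
  escapes upwards, by the alternative for escaping walks.
\<close>

lemma tendsto_progress:
  assumes v: "coordinate_height v e" and pos: "aprob 0 (escapes v) > 0"
  shows "(\<lambda>k. aprob 0 (progress v (2 * real k))) \<longlonglongrightarrow> aprob 0 (escape_above v)"
proof -
  interpret W: path_measure "walk_law 0" by (rule walk_law_path_measure)
  let ?D = "\<lambda>k. progress v (2 * real k)"
  have dec: "decseq ?D"
    unfolding decseq_def
  proof (intro allI impI subsetI)
    fix k l :: nat and X assume kl: "k \<le> l" and "X \<in> ?D l"
    then obtain n where n: "2 * real l \<le> v (X n) - v (X 0)" "\<forall>i\<ge>1. i \<le> n \<longrightarrow> v (X 0) + 1 \<le> v (X i)"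
      by (auto simp: progress_def)
    moreover have "2 * real k \<le> 2 * real l" using kl by simp
    ultimately show "X \<in> ?D k" unfolding progress_def by (auto intro!: exI[of _ n])
  qed
  have lim: "(\<lambda>k. aprob 0 (?D k)) \<longlonglongrightarrow> aprob 0 (\<Inter>k. ?D k)"
    using dec by (intro W.finite_Lim_measure_decseq) (auto simp: W.sets_Q)
  have char: "X \<in> (\<Inter>k. ?D k) \<longleftrightarrow> X \<in> escape_above v"
    if X: "walk 0 X" "X \<in> escapes v \<or> X \<in> escapes (\<lambda>x. - v x)" for X
  proof
    have X0: "v (X 0) = 0" using X(1) height_zero[OF v] by (simp add: walk_def)
    assume D: "X \<in> (\<Inter>k. ?D k)"
    have ex: "\<exists>n. 2 * real k \<le> v (X n) \<and> 2 * k \<le> n \<and> (\<forall>i\<ge>1. i \<le> n \<longrightarrow> 1 \<le> v (X i))" for k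
    proof -
      have "X \<in> ?D k" using D by blast
      then obtain n where n: "2 * real k \<le> v (X n)" "\<forall>i\<ge>1. i \<le> n \<longrightarrow> 1 \<le> v (X i)"
        by (auto simp: progress_def X0)
      then have "real (2 * k) \<le> real n"
        using walk_height_bound[OF v X(1), of n] height_zero[OF v] by simp
      then have "2 * k \<le> n" by (simp only: of_nat_le_iff)
      then show ?thesis using n by blast
    qed
    have above: "1 \<le> v (X i)" if "i \<ge> 1" for i
      using ex[of i] that by auto
    have "X \<notin> escapes (\<lambda>x. - v x)"
    proof
      assume "X \<in> escapes (\<lambda>x. - v x)"
      then have "filterlim (\<lambda>n. - v (X n)) at_top sequentially" by simp
      then have "\<forall>\<^sub>F n in sequentially. 0 \<le> - v (X n)" unfolding filterlim_at_top by blast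
      then obtain N where "\<And>n. n \<ge> N \<Longrightarrow> 0 \<le> - v (X n)" by (auto simp: eventually_sequentially)
      from this[of "Suc N"] above[of "Suc N"] show False by simp
    qed
    with X above X0 show "X \<in> escape_above v" by (simp add: escape_above_def stays_above_def)
  next
    assume E: "X \<in> escape_above v"
    show "X \<in> (\<Inter>k. ?D k)"
    proof
      fix k
      have "filterlim (\<lambda>n. v (X n)) at_top sequentially" using E by (simp add: escape_above_def)
      then have "\<forall>\<^sub>F n in sequentially. 2 * real k + v (X 0) \<le> v (X n)" unfolding filterlim_at_top by blast
      then obtain n where "2 * real k + v (X 0) \<le> v (X n)" by (auto simp: eventually_sequentially)
      then show "X \<in> ?D k"
        using E by (auto simp: progress_def escape_above_def stays_above_def intro!: exI[of _ n])
    qed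
  qed
  have "AE X in walk_law 0. X \<in> (\<Inter>k. ?D k) \<longleftrightarrow> X \<in> escape_above v"
    using AE_walk_law_walk[of 0] AE_escapes_or_escapes_back[OF v pos] by eventually_elim (rule char)
  moreover have "(\<Inter>k. ?D k) \<in> sets (walk_law 0)" by (auto simp: W.sets_Q)
  moreover have "escape_above v \<in> sets (walk_law 0)" by (simp add: W.sets_Q)
  ultimately have "aprob 0 (\<Inter>k. ?D k) = aprob 0 (escape_above v)"
    by (intro W.finite_measure_eq_AE)
  with lim show ?thesis by simp
qed

lemma measure_progress_translate:
  assumes v: "coordinate_height v e"
  shows "aprob z (progress v m) = aprob 0 (progress v m)"
proof -
  have "{X. (\<lambda>n. X n - z) \<in> progress v m} = progress v m"
    by (simp add: progress_def height_diff[OF v])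
  then show ?thesis using walk_law_translate[OF progress_measurable, of 0 z v m] by simp
qed

lemma tendsto_mean_doubt:
  assumes "0 < \<epsilon>"
  shows "(\<lambda>k. \<integral>\<omega>. qprob \<omega> 0 (escape_from_doubt \<epsilon> v (real k) \<omega>) \<partial>P) \<longlonglongrightarrow> 0"
proof -
  have "(\<lambda>k. \<integral>\<omega>. qprob \<omega> 0 (escape_from_doubt \<epsilon> v (real k) \<omega>) \<partial>P) \<longlonglongrightarrow> (\<integral>\<omega>. 0 \<partial>P)"
  proof (rule integral_dominated_convergence[where w="\<lambda>_. 1"])
    show "(\<lambda>\<omega>. qprob \<omega> 0 (escape_from_doubt \<epsilon> v (real k) \<omega>)) \<in> borel_measurable P" for k
      using quenched_doubt_measurable by (simp add: borel_measurable_P)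
    show "AE \<omega> in P. (\<lambda>k. qprob \<omega> 0 (escape_from_doubt \<epsilon> v (real k) \<omega>)) \<longlonglongrightarrow> 0"
      by (rule AE_I2) (intro tendsto_escape_from_doubt assms, simp add: space_P)
    show "AE \<omega> in P. norm (qprob \<omega> 0 (escape_from_doubt \<epsilon> v (real k) \<omega>)) \<le> 1" for k
      by (rule AE_I2) (simp add: space_P quenched_measure_bounds)
  qed auto
  then show ?thesis by simp
qed

lemma mean_doubt_translate:
  assumes v: "coordinate_height v e"
  shows "(\<integral>\<omega>. qprob \<omega> z (escape_from_doubt \<epsilon> v h \<omega>) \<partial>P) =
    (\<integral>\<omega>. qprob \<omega> 0 (escape_from_doubt \<epsilon> v h \<omega>) \<partial>P)"
proof -
  have "(\<integral>\<omega>. qprob \<omega> z (escape_from_doubt \<epsilon> v h \<omega>) \<partial>P) =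
      (\<integral>\<omega>. qprob (shift_env z \<omega>) 0 (escape_from_doubt \<epsilon> v h (shift_env z \<omega>)) \<partial>P)"
    by (intro Bochner_Integration.integral_cong refl escape_from_doubt_translate[OF v]) (simp add: space_P)
  also have "\<dots> = (\<integral>\<omega>. qprob \<omega> 0 (escape_from_doubt \<epsilon> v h \<omega>) \<partial>P)"
    by (rule integral_shift_env[OF quenched_doubt_measurable])
  finally show ?thesis .
qed

text \<open>
  Up to small errors the two events are decided by finitely many steps of the two walks. These explore the
  environment near the starting points only, which are disjoint regions if \<open>z\<close> is high enough.
\<close>

lemma distant_walks_decouple:
  assumes v: "coordinate_height v e"
    and E: "E1 \<in> sets path_space" "E2 \<in> sets path_space"
    and inv: "\<And>z X. (\<lambda>n. X n - z) \<in> E2 \<longleftrightarrow> X \<in> E2"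
    and \<delta>: "\<delta> > 0"
  obtains h where "\<And>z. h \<le> v z \<Longrightarrow>
    aprob 0 E1 * aprob 0 E2 - 4 * \<delta> \<le>
    (\<integral>\<omega>. qprob \<omega> 0 E1 * qprob \<omega> z E2 \<partial>P)"
proof -
  interpret W: path_measure "walk_law 0" by (rule walk_law_path_measure)
  obtain n B where B: "aprob 0 (sym_diff E1 {X. path_prefix n X \<in> B}) < \<delta>"
    using W.obtain_prefix_approximation[OF _ \<delta>, of E1] E by (auto simp: W.sets_Q)
  obtain m C where C: "aprob 0 (sym_diff E2 {X. path_prefix m X \<in> C}) < \<delta>"
    using W.obtain_prefix_approximation[OF _ \<delta>, of E2] E by (auto simp: W.sets_Q)
  show ?thesis
  \<comment> \<open>beyond this height the two explored regions are disjoint\<close>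
  proof (rule that[of "real n + real m + 1"])
    fix z assume z: "real n + real m + 1 \<le> v z"
    interpret Wz: path_measure "walk_law z" by (rule walk_law_path_measure)
    \<comment> \<open>the first \<open>n\<close> (\<open>m\<close>) sites lie within height distance \<open>n\<close> (\<open>m\<close>) of the start; spelling this out bounds the explored region\<close>
    define A1 where "A1 = {X. path_prefix n X \<in> {\<pi>\<in>B. \<forall>x\<in>set \<pi>. v x \<le> real n}}"
    define A2 where "A2 = {X. path_prefix m X \<in> {\<rho>. map (\<lambda>x. x - z) \<rho> \<in> C \<and> (\<forall>x\<in>set \<rho>. v z - real m \<le> v x)}}"
    define S1 where "S1 = sym_diff E1 A1"
    define S2 where "S2 = sym_diff E2 A2"
    have A: "A1 \<in> sets path_space" "A2 \<in> sets path_space"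
      unfolding A1_def A2_def by (rule path_prefix_event_measurable)+
    have S: "S1 \<in> sets path_space" "S2 \<in> sets path_space" unfolding S1_def S2_def using A E by auto
    have near: "v z - real k \<le> v (X i) \<and> v (X i) \<le> v z + real k" if "walk z X" "i < k" for z X i k
      using walk_height_bound[OF v that(1), of i] that(2) by linarith
    have "aprob 0 S1 = aprob 0 (sym_diff E1 {X. path_prefix n X \<in> B})"
    proof (rule W.finite_measure_eq_AE)
      show "AE X in walk_law 0. X \<in> S1 \<longleftrightarrow> X \<in> sym_diff E1 {X. path_prefix n X \<in> B}"
        using AE_walk_law_walk[of 0]
      proof eventually_elim
        case (elim X)
        have "\<forall>x\<in>set (path_prefix n X). v x \<le> real n"
          using near[OF elim, of _ n] height_zero[OF v] by (auto simp: set_path_prefix)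
        then show ?case by (auto simp: S1_def A1_def)
      qed
    qed (use S E in \<open>auto simp: W.sets_Q\<close>)
    with B have S1_small: "aprob 0 S1 < \<delta>" by simp
    have "aprob z S2 = aprob z {X. (\<lambda>n. X n - z) \<in> sym_diff E2 {X. path_prefix m X \<in> C}}"
    proof (rule Wz.finite_measure_eq_AE)
      show "AE X in walk_law z. X \<in> S2 \<longleftrightarrow> X \<in> {X. (\<lambda>n. X n - z) \<in> sym_diff E2 {X. path_prefix m X \<in> C}}"
        using AE_walk_law_walk[of z]
      proof eventually_elim
        case (elim X)
        have "\<forall>x\<in>set (path_prefix m X). v z - real m \<le> v x"
          using near[OF elim, of _ m] by (auto simp: set_path_prefix)
        moreover have "path_prefix m (\<lambda>n. X n - z) = map (\<lambda>x. x - z) (path_prefix m X)"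
          by (simp add: path_prefix_def)
        ultimately show ?case using inv[of X z] by (auto simp: S2_def A2_def)
      qed
      have "{X. (\<lambda>n. X n - z) \<in> sym_diff E2 {X. path_prefix m X \<in> C}} \<in> sets path_space"
        using E by (intro path_event_measurable path_map_measurable) auto
      then show "{X. (\<lambda>n. X n - z) \<in> sym_diff E2 {X. path_prefix m X \<in> C}} \<in> sets (walk_law z)"
        by (simp only: Wz.sets_Q)
    qed (use S in \<open>simp add: Wz.sets_Q\<close>)
    also have "\<dots> = aprob 0 (sym_diff E2 {X. path_prefix m X \<in> C})"
      using walk_law_translate[of "sym_diff E2 {X. path_prefix m X \<in> C}" 0 z] E by auto
    finally have S2_small: "aprob z S2 < \<delta>" using C by simp
    have E2z: "aprob z E2 = aprob 0 E2"
      using walk_law_translate[OF E(2), of 0 z] by (simp add: inv)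
    let ?q = "\<lambda>\<omega> x A. qprob \<omega> x A"
    have le1: "measure R A \<le> measure R B + measure R (sym_diff A B)"
      "measure R B \<le> measure R A + measure R (sym_diff A B)"
      if "path_measure R" "A \<in> sets path_space" "B \<in> sets path_space" for R A B
    proof -
      interpret R: path_measure R by fact
      have s: "A \<in> sets R" "B \<in> sets R" using that by (simp_all add: R.sets_Q)
      have "measure R A \<le> measure R (B \<union> sym_diff A B)" "measure R B \<le> measure R (A \<union> sym_diff A B)"
        using s by (auto intro!: R.finite_measure_mono)
      moreover have "measure R (B \<union> sym_diff A B) \<le> measure R B + measure R (sym_diff A B)"
        "measure R (A \<union> sym_diff A B) \<le> measure R A + measure R (sym_diff A B)"
        using s by (intro measure_Un_le; auto)+
      ultimately show "measure R A \<le> measure R B + measure R (sym_diff A B)"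
        "measure R B \<le> measure R A + measure R (sym_diff A B)" by linarith+
    qed
    have I: "integrable P (\<lambda>\<omega>. ?q \<omega> x A)" if "A \<in> sets path_space" for x A
      by (rule integrable_quenched_measure[OF that])
    have I2: "integrable P (\<lambda>\<omega>. ?q \<omega> x A * ?q \<omega> y B)" if "A \<in> sets path_space" "B \<in> sets path_space" for x y A B
      using that by (intro integrable_bounded_mult measurable_quenched_measure) (simp_all add: quenched_measure_bounds)
    have "(\<integral>\<omega>. ?q \<omega> 0 A1 * ?q \<omega> z A2 \<partial>P) \<le> (\<integral>\<omega>. ?q \<omega> 0 E1 * ?q \<omega> z E2 + ?q \<omega> 0 S1 + ?q \<omega> z S2 \<partial>P)"
    proof (rule integral_mono_AE)
      show "AE \<omega> in P. ?q \<omega> 0 A1 * ?q \<omega> z A2 \<le> ?q \<omega> 0 E1 * ?q \<omega> z E2 + ?q \<omega> 0 S1 + ?q \<omega> z S2"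
      proof (rule AE_I2)
        fix \<omega> assume "\<omega> \<in> space P"
        then have \<omega>: "\<omega> \<in> space env_space" by (simp add: space_P)
        show "?q \<omega> 0 A1 * ?q \<omega> z A2 \<le> ?q \<omega> 0 E1 * ?q \<omega> z E2 + ?q \<omega> 0 S1 + ?q \<omega> z S2"
          unfolding S1_def S2_def
          by (rule unit_product_perturb)
             (simp_all add: quenched_measure_bounds[OF \<omega>] le1[OF quenched_path_measure[OF \<omega>]] A E)
      qed
    qed (use I I2 A E S in auto)
    also have "\<dots> = (\<integral>\<omega>. ?q \<omega> 0 E1 * ?q \<omega> z E2 \<partial>P) + aprob 0 S1 + aprob z S2"
      using I I2 E S by (simp add: measure_walk_law)
    finally have upper: "(\<integral>\<omega>. ?q \<omega> 0 A1 * ?q \<omega> z A2 \<partial>P) \<le> (\<integral>\<omega>. ?q \<omega> 0 E1 * ?q \<omega> z E2 \<partial>P) + 2 * \<delta>"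
      using S1_small S2_small by simp
    have "(\<integral>\<omega>. ?q \<omega> 0 A1 * ?q \<omega> z A2 \<partial>P) = (\<integral>\<omega>. ?q \<omega> 0 A1 \<partial>P) * (\<integral>\<omega>. ?q \<omega> z A2 \<partial>P)"
    proof (rule integral_mult_determined_by)
      show "determined_by (\<lambda>\<omega>. ?q \<omega> 0 A1) {x. v x \<le> real n}"
        unfolding A1_def by (rule determined_by_prefix_event) (auto dest: in_set_butlastD simp del: split_paired_All)
      show "determined_by (\<lambda>\<omega>. ?q \<omega> z A2) {x. v z - real m \<le> v x}"
        unfolding A2_def by (rule determined_by_prefix_event) (auto dest: in_set_butlastD simp del: split_paired_All)
      show "{x. v x \<le> real n} \<inter> {x. v z - real m \<le> v x} = {}" using z by auto
    qed (use A I in auto)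
    then have "(\<integral>\<omega>. ?q \<omega> 0 A1 * ?q \<omega> z A2 \<partial>P) = aprob 0 A1 * aprob z A2"
      using A by (simp add: measure_walk_law)
    moreover have "aprob 0 E1 * aprob z E2 \<le>
        aprob 0 A1 * aprob z A2 + aprob 0 S1 + aprob z S2"
      unfolding S1_def S2_def
      by (rule unit_product_perturb) (simp_all add: le1[OF walk_law_path_measure] A E)
    ultimately show "aprob 0 E1 * aprob 0 E2 - 4 * \<delta> \<le> (\<integral>\<omega>. ?q \<omega> 0 E1 * ?q \<omega> z E2 \<partial>P)"
      using upper S1_small S2_small by (simp add: E2z)
  qed
qed

end

context elliptic_environment begin

text \<open>
  For disjoint crossings the mean of the product of the weights is the product of the means, as if the two walks
  had independent environments. By the dichotomy, the first walk arrives below the median row and the second one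
  on the positive side of the origin, or the first one above and the second one on the negative side. In both
  cases the first walk contributes at most half of its crossing probability, and the two contributions of the
  second walk add up to at most its crossing probability.
\<close>

lemma non_crossing_pairs_bound:
  assumes v: "coordinate_height v e"
  obtains z where "\<lceil>v z\<rceil> = 2 * int k + 1"
    "(\<integral>\<^sup>+\<omega>. (\<integral>\<^sup>+p. ennreal (path_weight \<omega> 0 (fst p) * path_weight \<omega> z (snd p))
        \<partial>count_space {p \<in> crossings_up v (2 * int k + 1) \<times> crossings_down v z. set (fst p) \<inter> set (snd p) = {}}) \<partial>P)
      \<le> ennreal (aprob 0 (progress v (2 * real k)) * aprob 0 (progress (\<lambda>x. - v x) (2 * real k)) / 2)"
proof -
  interpret W: path_measure "walk_law 0" by (rule walk_law_path_measure)
  let ?L = "2 * int k + 1" and ?v' = "\<lambda>x. - v x"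
  have v': "coordinate_height ?v' (- e)" by (rule coordinate_height_uminus[OF v])
  let ?T = "crossings_up v ?L"
  obtain row :: "site \<Rightarrow> int" where ex: "\<And>L k. \<exists>z. \<lceil>v z\<rceil> = L \<and> row z = k"
    and dichotomy: "\<And>L z \<pi> \<rho>. \<lceil>v z\<rceil> = L \<Longrightarrow> 1 \<le> L \<Longrightarrow> \<pi> \<in> crossings_up v L \<Longrightarrow> \<rho> \<in> crossings_down v z \<Longrightarrow> set \<pi> \<inter> set \<rho> = {} \<Longrightarrow>
      (row (last \<pi>) < row z \<and> 0 < row (last \<rho>)) \<or> (row z < row (last \<pi>) \<and> row (last \<rho>) < 0)"
    by (rule disjoint_crossings_dichotomy[OF v], rule that)
  obtain j where j:
    "aprob 0 (\<Union>\<pi>\<in>{\<pi>\<in>?T. row (last \<pi>) < j}. cylinder \<pi>) \<le> aprob 0 (\<Union>\<pi>\<in>?T. cylinder \<pi>) / 2"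
    "aprob 0 (\<Union>\<pi>\<in>{\<pi>\<in>?T. j < row (last \<pi>)}. cylinder \<pi>) \<le> aprob 0 (\<Union>\<pi>\<in>?T. cylinder \<pi>) / 2"
    using W.median_of_cylinders[OF disjoint_crossings_up[of v ?L], of "\<lambda>\<pi>. row (last \<pi>)"] by blast
  obtain z where z: "\<lceil>v z\<rceil> = ?L" "row z = j" using ex by blast
  interpret Wz: path_measure "walk_law z" by (rule walk_law_path_measure)
  let ?T' = "crossings_down v z"
  let ?W = "{p \<in> ?T \<times> ?T'. set (fst p) \<inter> set (snd p) = {}}"
  let ?U = "\<lambda>A. \<Union>\<pi>\<in>A. cylinder \<pi>"
  define low where "low = ?U {\<pi>\<in>?T. row (last \<pi>) < j}"
  define high where "high = ?U {\<pi>\<in>?T. j < row (last \<pi>)}"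
  define up where "up = ?U {\<rho>\<in>?T'. 0 < row (last \<rho>)}"
  define down where "down = ?U {\<rho>\<in>?T'. row (last \<rho>) < 0}"
  have sets: "?U A \<in> sets path_space" for A
    by (rule sets.countable_UN'') auto
  have s: "low \<in> sets (walk_law 0)" "high \<in> sets (walk_law 0)" "up \<in> sets (walk_law z)" "down \<in> sets (walk_law z)"
    unfolding low_def high_def up_def down_def W.sets_Q Wz.sets_Q by (rule sets)+
  let ?a = "aprob 0 (progress v (2 * real k))" and ?b = "aprob 0 (progress ?v' (2 * real k))"
  have nth_tl: "\<pi> ! i \<in> set (tl \<pi>)" if "1 \<le> i" "i < length \<pi>" for i and \<pi> :: "site list"
    using that by (cases \<pi>; cases i) auto
  have T_progress: "?U ?T \<subseteq> progress v (2 * real k)"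
  proof
    fix X assume "X \<in> ?U ?T"
    then obtain \<pi> where \<pi>: "\<pi> \<in> ?T" "X \<in> cylinder \<pi>" by blast
    then have ne: "\<pi> \<noteq> []" and hd: "hd \<pi> = 0" and tl: "\<And>x. x \<in> set (tl \<pi>) \<Longrightarrow> 1 \<le> v x" and last: "\<lceil>v (last \<pi>)\<rceil> = ?L"
      by (auto simp: crossings_up_def simp del: split_paired_All)
    have X: "X i = \<pi> ! i" if "i < length \<pi>" for i using cylinder_eqD[OF \<pi>(2) that] .
    have v0: "v (X 0) = 0" using X[of 0] ne hd height_zero[OF v] by (simp add: hd_conv_nth)
    have "2 * real k \<le> v (X (length \<pi> - 1)) - v (X 0)"
      using X[of "length \<pi> - 1"] ne last v0 by (simp add: last_conv_nth) linarith
    moreover have "v (X 0) + 1 \<le> v (X i)" if "1 \<le> i" "i \<le> length \<pi> - 1" for i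
    proof -
      have "i < length \<pi>" using that ne by (cases \<pi>) auto
      then show ?thesis using X[of i] tl[OF nth_tl] that v0 by simp
    qed
    ultimately show "X \<in> progress v (2 * real k)" unfolding progress_def by blast
  qed
  have T'_progress: "?U ?T' \<subseteq> progress ?v' (2 * real k)"
  proof
    fix X assume "X \<in> ?U ?T'"
    then obtain \<pi> where \<pi>: "\<pi> \<in> ?T'" "X \<in> cylinder \<pi>" by blast
    then have ne: "\<pi> \<noteq> []" and hd: "hd \<pi> = z" and tl: "\<And>x. x \<in> set (tl \<pi>) \<Longrightarrow> v x \<le> v z - 1" and last: "\<lceil>v (last \<pi>)\<rceil> = 0"
      by (auto simp: crossings_down_def simp del: split_paired_All)
    have X: "X i = \<pi> ! i" if "i < length \<pi>" for i using cylinder_eqD[OF \<pi>(2) that] .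
    have v0: "X 0 = z" using X[of 0] ne hd by (simp add: hd_conv_nth)
    have "2 * real k \<le> ?v' (X (length \<pi> - 1)) - ?v' (X 0)"
      using X[of "length \<pi> - 1"] ne last v0 z(1) by (simp add: last_conv_nth) linarith
    moreover have "?v' (X 0) + 1 \<le> ?v' (X i)" if "1 \<le> i" "i \<le> length \<pi> - 1" for i
    proof -
      have "i < length \<pi>" using that ne by (cases \<pi>) auto
      then show ?thesis using X[of i] tl[OF nth_tl, of i] that v0 by simp
    qed
    ultimately show "X \<in> progress ?v' (2 * real k)" unfolding progress_def by blast
  qed
  have "aprob 0 (?U ?T) \<le> ?a"
    using T_progress by (intro W.finite_measure_mono) (simp_all add: W.sets_Q)
  with j have lh: "aprob 0 low \<le> ?a / 2" "aprob 0 high \<le> ?a / 2"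
    unfolding low_def high_def by linarith+
  have disjoint_ends: "up \<inter> down = {}"
  proof (rule ccontr)
    assume "up \<inter> down \<noteq> {}"
    then obtain X \<rho> \<sigma> where X: "\<rho> \<in> ?T'" "0 < row (last \<rho>)" "X \<in> cylinder \<rho>" "\<sigma> \<in> ?T'" "row (last \<sigma>) < 0" "X \<in> cylinder \<sigma>"
      unfolding up_def down_def by blast
    then have "\<rho> = \<sigma>" using disjoint_crossings_down[of v z] unfolding disjoint_family_on_def by blast
    with X show False by simp
  qed
  have "aprob z up + aprob z down = aprob z (up \<union> down)"
    using s disjoint_ends by (intro Wz.finite_measure_Union[symmetric])
  also have "\<dots> \<le> aprob z (progress ?v' (2 * real k))"
    using T'_progress by (intro Wz.finite_measure_mono) (auto simp: up_def down_def Wz.sets_Q)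
  also have "\<dots> = ?b" by (rule measure_progress_translate[OF v'])
  finally have ud: "aprob z up + aprob z down \<le> ?b" .
  let ?M = "walk_law 0 \<Otimes>\<^sub>M walk_law z"
  have W: "?W \<subseteq> ?T \<times> ?T'" by blast
  note pairs = emeasure_pair_cylinders[OF W.path_measure_axioms Wz.path_measure_axioms
      disjoint_crossings_up disjoint_crossings_down W]
  have decouple: "(\<integral>\<^sup>+\<omega>. ennreal (path_weight \<omega> 0 (fst p) * path_weight \<omega> z (snd p)) \<partial>P) =
      ennreal (aprob 0 (cylinder (fst p)) * aprob z (cylinder (snd p)))" if p: "p \<in> ?W" for p
  proof -
    have ne: "fst p \<noteq> []" "snd p \<noteq> []" using p by (auto simp: crossings_up_def crossings_down_def)
    have b: "0 \<le> path_weight \<omega> x \<pi> \<and> path_weight \<omega> x \<pi> \<le> 1" if "\<omega> \<in> space env_space" "\<pi> \<noteq> []" for \<omega> x \<pi>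
      using that by (auto simp: path_weight_eq weight_nonneg weight_le_1)
    have m: "(\<lambda>\<omega>. path_weight \<omega> x \<pi>) \<in> borel_measurable env_space" if "\<pi> \<noteq> []" for x \<pi>
      using that by (simp add: path_weight_eq)
    have "(\<integral>\<^sup>+\<omega>. ennreal (path_weight \<omega> 0 (fst p) * path_weight \<omega> z (snd p)) \<partial>P) =
        ennreal (\<integral>\<omega>. path_weight \<omega> 0 (fst p) * path_weight \<omega> z (snd p) \<partial>P)"
      using ne b by (intro nn_integral_eq_integral integrable_bounded_mult m AE_I2) (simp_all add: space_P)
    also have "(\<integral>\<omega>. path_weight \<omega> 0 (fst p) * path_weight \<omega> z (snd p) \<partial>P) =
        (\<integral>\<omega>. path_weight \<omega> 0 (fst p) \<partial>P) * (\<integral>\<omega>. path_weight \<omega> z (snd p) \<partial>P)"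
    proof (rule integral_mult_determined_by)
      show "determined_by (\<lambda>\<omega>. path_weight \<omega> 0 (fst p)) (set (fst p))"
        "determined_by (\<lambda>\<omega>. path_weight \<omega> z (snd p)) (set (snd p))"
        by (rule determined_by_path_weight, blast dest: in_set_butlastD)+
    qed (use p ne in \<open>auto simp: integrable_path_weight m\<close>)
    finally show ?thesis by (simp only: measure_walk_law_cylinder)
  qed
  have "(\<integral>\<^sup>+\<omega>. (\<integral>\<^sup>+p. ennreal (path_weight \<omega> 0 (fst p) * path_weight \<omega> z (snd p)) \<partial>count_space ?W) \<partial>P) =
      (\<integral>\<^sup>+p. (\<integral>\<^sup>+\<omega>. ennreal (path_weight \<omega> 0 (fst p) * path_weight \<omega> z (snd p)) \<partial>P) \<partial>count_space ?W)"
  proof (rule nn_integral_count_space_nn_integral[OF countableI_type])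
    fix p assume "p \<in> ?W"
    then have "fst p \<noteq> []" "snd p \<noteq> []" by (auto simp: crossings_up_def crossings_down_def)
    then show "(\<lambda>\<omega>. ennreal (path_weight \<omega> 0 (fst p) * path_weight \<omega> z (snd p))) \<in> borel_measurable P"
      unfolding measurable_cong_sets[OF sets_P refl] by (simp add: path_weight_eq)
  qed
  also have "\<dots> = (\<integral>\<^sup>+p. ennreal (aprob 0 (cylinder (fst p)) * aprob z (cylinder (snd p))) \<partial>count_space ?W)"
    by (intro nn_integral_cong decouple) simp
  also have "\<dots> = emeasure ?M (\<Union>p\<in>?W. cylinder (fst p) \<times> cylinder (snd p))" by (rule pairs(2)[symmetric])
  also have "\<dots> \<le> emeasure ?M (low \<times> up \<union> high \<times> down)"
  proof (rule emeasure_mono)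
    show "(\<Union>p\<in>?W. cylinder (fst p) \<times> cylinder (snd p)) \<subseteq> low \<times> up \<union> high \<times> down"
    proof
      fix q assume "q \<in> (\<Union>p\<in>?W. cylinder (fst p) \<times> cylinder (snd p))"
      then obtain \<pi> \<rho> where p: "\<pi> \<in> ?T" "\<rho> \<in> ?T'" "set \<pi> \<inter> set \<rho> = {}" "q \<in> cylinder \<pi> \<times> cylinder \<rho>" by auto
      from dichotomy[OF z(1) _ p(1-3)] z(2)
      have "(row (last \<pi>) < j \<and> 0 < row (last \<rho>)) \<or> (j < row (last \<pi>) \<and> row (last \<rho>) < 0)" by simp
      with p show "q \<in> low \<times> up \<union> high \<times> down"
        unfolding low_def high_def up_def down_def by (auto simp: mem_Times_iff)
    qed
  qed (use s in auto)
  also have "\<dots> \<le> emeasure ?M (low \<times> up) + emeasure ?M (high \<times> down)"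
    using s by (intro emeasure_subadditive) auto
  also have "\<dots> = ennreal (aprob 0 low * aprob z up + aprob 0 high * aprob z down)"
    using s by (simp add: Wz.emeasure_pair_measure_Times W.emeasure_eq_measure Wz.emeasure_eq_measure flip: ennreal_mult)
  also have "\<dots> \<le> ennreal (?a * ?b / 2)"
  proof (rule ennreal_leI)
    have "aprob 0 low * aprob z up + aprob 0 high * aprob z down \<le>
        ?a / 2 * aprob z up + ?a / 2 * aprob z down"
      by (intro add_mono mult_right_mono lh) simp_all
    also have "\<dots> = ?a / 2 * (aprob z up + aprob z down)" by (simp add: algebra_simps)
    also have "\<dots> \<le> ?a / 2 * ?b" by (intro mult_left_mono ud) simp
    finally show "aprob 0 low * aprob z up + aprob 0 high * aprob z down \<le> ?a * ?b / 2"
      by simp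
  qed
  finally show ?thesis by (rule that[OF z(1)])
qed

lemma two_walks_bound:
  assumes v: "coordinate_height v e" and \<epsilon>: "0 < \<epsilon>"
  obtains z where "\<lceil>v z\<rceil> = 2 * int k + 1"
    "(\<integral>\<omega>. qprob \<omega> 0 (escape_above v) * qprob \<omega> z (escape_above (\<lambda>x. - v x)) \<partial>P) \<le>
      (\<integral>\<omega>. qprob \<omega> 0 (escape_from_doubt \<epsilon> v (real k) \<omega>) \<partial>P) +
      (\<integral>\<omega>. qprob \<omega> 0 (escape_from_doubt \<epsilon> (\<lambda>x. - v x) (real k) \<omega>) \<partial>P) + 2 * \<epsilon> +
      aprob 0 (progress v (2 * real k)) * aprob 0 (progress (\<lambda>x. - v x) (2 * real k)) / 2"
proof -
  let ?v' = "\<lambda>x. - v x"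
  have v': "coordinate_height ?v' (- e)" by (rule coordinate_height_uminus[OF v])
  let ?c = "aprob 0 (progress v (2 * real k)) * aprob 0 (progress ?v' (2 * real k)) / 2"
  obtain z where z: "\<lceil>v z\<rceil> = 2 * int k + 1"
    and bound: "(\<integral>\<^sup>+\<omega>. (\<integral>\<^sup>+p. ennreal (path_weight \<omega> 0 (fst p) * path_weight \<omega> z (snd p))
        \<partial>count_space {p \<in> crossings_up v (2 * int k + 1) \<times> crossings_down v z. set (fst p) \<inter> set (snd p) = {}}) \<partial>P) \<le> ennreal ?c"
    by (rule non_crossing_pairs_bound[OF v, of k], rule that)
  let ?W = "{p \<in> crossings_up v (2 * int k + 1) \<times> crossings_down v z. set (fst p) \<inter> set (snd p) = {}}"
  let ?f = "\<lambda>\<omega>. qprob \<omega> 0 (escape_above v) * qprob \<omega> z (escape_above ?v')"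
  let ?d = "\<lambda>\<omega>. qprob \<omega> 0 (escape_from_doubt \<epsilon> v (real k) \<omega>) +
      qprob \<omega> z (escape_from_doubt \<epsilon> ?v' (real k) \<omega>) + 2 * \<epsilon>"
  let ?g = "\<lambda>\<omega>. \<integral>\<^sup>+p. ennreal (path_weight \<omega> 0 (fst p) * path_weight \<omega> z (snd p)) \<partial>count_space ?W"
  have doubt: "integrable P (\<lambda>\<omega>. qprob \<omega> x (escape_from_doubt \<epsilon> w (real k) \<omega>))" for x w
    by (rule integrable_bounded[OF quenched_doubt_measurable]) (simp add: quenched_measure_bounds)
  have int_f: "integrable P ?f"
    by (intro integrable_bounded_mult measurable_quenched_measure escape_above_measurable) (simp_all add: quenched_measure_bounds)
  have int_d: "integrable P ?d" using doubt by simp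
  have d_nonneg: "0 \<le> ?d \<omega>" if "\<omega> \<in> space env_space" for \<omega>
    using quenched_measure_bounds[OF that] \<epsilon> by (simp add: add_nonneg_nonneg)
  have g: "?g \<in> borel_measurable P"
  proof (rule sigma_finite_measure.borel_measurable_nn_integral)
    show "sigma_finite_measure (count_space ?W)" by (rule sigma_finite_measure_count_space_countable) (rule countableI_type)
    have "(\<lambda>q. ennreal (path_weight (fst q) 0 (fst (snd q)) * path_weight (fst q) z (snd (snd q)))) \<in> borel_measurable (P \<Otimes>\<^sub>M count_space ?W)"
    proof (rule measurable_compose_countable'[where I="?W" and g=snd and f="\<lambda>p q. ennreal (path_weight (fst q) 0 (fst p) * path_weight (fst q) z (snd p))"])
      fix p assume "p \<in> ?W"
      then have "fst p \<noteq> []" "snd p \<noteq> []" by (auto simp: crossings_up_def crossings_down_def)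
      then have "(\<lambda>\<omega>. ennreal (path_weight \<omega> 0 (fst p) * path_weight \<omega> z (snd p))) \<in> borel_measurable P"
        unfolding measurable_cong_sets[OF sets_P refl] by (simp add: path_weight_eq)
      then show "(\<lambda>q. ennreal (path_weight (fst q) 0 (fst p) * path_weight (fst q) z (snd p))) \<in> borel_measurable (P \<Otimes>\<^sub>M count_space ?W)"
        by (rule measurable_compose[OF measurable_fst])
    qed (auto intro: countableI_type)
    then show "(\<lambda>(\<omega>, p). ennreal (path_weight \<omega> 0 (fst p) * path_weight \<omega> z (snd p))) \<in> borel_measurable (P \<Otimes>\<^sub>M count_space ?W)"
      by (simp add: case_prod_unfold)
  qed
  have "ennreal (\<integral>\<omega>. ?f \<omega> \<partial>P) = (\<integral>\<^sup>+\<omega>. ennreal (?f \<omega>) \<partial>P)"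
    by (rule nn_integral_eq_integral[symmetric, OF int_f]) (simp add: AE_I2)
  also have "\<dots> \<le> (\<integral>\<^sup>+\<omega>. ennreal (?d \<omega>) + ?g \<omega> \<partial>P)"
    by (rule nn_integral_mono, rule quenched_two_walks_bound[OF v _ _ z]) (use \<epsilon> in \<open>simp_all add: space_P\<close>)
  also have "\<dots> = (\<integral>\<^sup>+\<omega>. ennreal (?d \<omega>) \<partial>P) + (\<integral>\<^sup>+\<omega>. ?g \<omega> \<partial>P)"
    by (rule nn_integral_add[OF _ g]) (use int_d in measurable)
  also have "(\<integral>\<^sup>+\<omega>. ennreal (?d \<omega>) \<partial>P) = ennreal (\<integral>\<omega>. ?d \<omega> \<partial>P)"
    by (rule nn_integral_eq_integral[OF int_d]) (rule AE_I2, rule d_nonneg, simp add: space_P)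
  also have "ennreal (\<integral>\<omega>. ?d \<omega> \<partial>P) + (\<integral>\<^sup>+\<omega>. ?g \<omega> \<partial>P) \<le> ennreal (\<integral>\<omega>. ?d \<omega> \<partial>P) + ennreal ?c"
    by (rule add_left_mono[OF bound])
  also have "\<dots> = ennreal ((\<integral>\<omega>. ?d \<omega> \<partial>P) + ?c)"
  proof (rule ennreal_plus[symmetric])
    show "0 \<le> (\<integral>\<omega>. ?d \<omega> \<partial>P)" by (rule integral_nonneg_AE) (rule AE_I2, rule d_nonneg, simp add: space_P)
  qed simp
  finally have "ennreal (\<integral>\<omega>. ?f \<omega> \<partial>P) \<le> ennreal ((\<integral>\<omega>. ?d \<omega> \<partial>P) + ?c)" .
  moreover have "0 \<le> (\<integral>\<omega>. ?d \<omega> \<partial>P) + ?c"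
    by (intro add_nonneg_nonneg integral_nonneg_AE AE_I2 d_nonneg) (simp_all add: space_P)
  ultimately have "(\<integral>\<omega>. ?f \<omega> \<partial>P) \<le> (\<integral>\<omega>. ?d \<omega> \<partial>P) + ?c" by (simp only: ennreal_le_iff)
  also have "(\<integral>\<omega>. ?d \<omega> \<partial>P) = (\<integral>\<omega>. qprob \<omega> 0 (escape_from_doubt \<epsilon> v (real k) \<omega>) \<partial>P) +
      (\<integral>\<omega>. qprob \<omega> 0 (escape_from_doubt \<epsilon> ?v' (real k) \<omega>) \<partial>P) + 2 * \<epsilon>"
    using doubt by (simp add: prob_space mean_doubt_translate[OF v', of z])
  finally show ?thesis by (rule that[OF z])
qed

lemma not_both_directions:
  assumes v: "coordinate_height v e"
    and pos: "aprob 0 (escapes v) > 0" "aprob 0 (escapes (\<lambda>x. - v x)) > 0"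
  shows False
proof -
  let ?v' = "\<lambda>x. - v x"
  have v': "coordinate_height ?v' (- e)" by (rule coordinate_height_uminus[OF v])
  define c1 where "c1 = aprob 0 (escape_above v)"
  define c2 where "c2 = aprob 0 (escape_above ?v')"
  have c: "c1 > 0" "c2 > 0"
    unfolding c1_def c2_def by (rule escape_above_pos[OF v pos(1)], rule escape_above_pos[OF v' pos(2)])
  \<comment> \<open>small enough for \<open>c1 * c2 - 4 * \<epsilon> \<le> 2 * \<epsilon> + c1 * c2 / 2\<close> to fail\<close>
  define \<epsilon> where "\<epsilon> = c1 * c2 / 32"
  have \<epsilon>: "\<epsilon> > 0" using c by (simp add: \<epsilon>_def)
  have inv: "(\<lambda>n. X n - z) \<in> escape_above ?v' \<longleftrightarrow> X \<in> escape_above ?v'" for z X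
  proof -
    have "filterlim (\<lambda>n. v z - v (X n)) at_top sequentially \<longleftrightarrow> filterlim (\<lambda>n. - v (X n)) at_top sequentially"
      using filterlim_tendsto_add_at_top_iff[of "\<lambda>_. v z" "v z" sequentially "\<lambda>n. - v (X n)"] by simp
    then show ?thesis by (simp add: escape_above_def stays_above_def height_diff[OF v])
  qed
  obtain h where h: "\<And>z. h \<le> v z \<Longrightarrow> c1 * c2 - 4 * \<epsilon> \<le>
      (\<integral>\<omega>. qprob \<omega> 0 (escape_above v) * qprob \<omega> z (escape_above ?v') \<partial>P)"
    using distant_walks_decouple[OF v escape_above_measurable escape_above_measurable inv \<epsilon>, of v]
    unfolding c1_def c2_def by blast
  let ?\<beta> = "\<lambda>w k. \<integral>\<omega>. qprob \<omega> 0 (escape_from_doubt \<epsilon> w (real k) \<omega>) \<partial>P"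
  let ?p = "\<lambda>w k. aprob 0 (progress w (2 * real k))"
  have "c1 * c2 - 4 * \<epsilon> \<le> ?\<beta> v k + ?\<beta> ?v' k + 2 * \<epsilon> + ?p v k * ?p ?v' k / 2" if k: "h \<le> real k" for k
  proof -
    obtain z where z: "\<lceil>v z\<rceil> = 2 * int k + 1"
      and le: "(\<integral>\<omega>. qprob \<omega> 0 (escape_above v) * qprob \<omega> z (escape_above ?v') \<partial>P) \<le>
        ?\<beta> v k + ?\<beta> ?v' k + 2 * \<epsilon> + ?p v k * ?p ?v' k / 2"
      by (rule two_walks_bound[OF v \<epsilon>, of k], rule that)
    have "real k \<le> v z" using z by linarith
    with h[of z] k le show ?thesis by linarith
  qed
  then have "\<forall>\<^sub>F k in sequentially. c1 * c2 - 4 * \<epsilon> \<le> ?\<beta> v k + ?\<beta> ?v' k + 2 * \<epsilon> + ?p v k * ?p ?v' k / 2"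
    using real_arch_simple[of h] by (meson eventually_sequentiallyI of_nat_mono order_trans)
  moreover have "(\<lambda>k. ?\<beta> v k + ?\<beta> ?v' k + 2 * \<epsilon> + ?p v k * ?p ?v' k / 2) \<longlonglongrightarrow> 0 + 0 + 2 * \<epsilon> + c1 * c2 / 2"
    unfolding c1_def c2_def
    by (intro tendsto_intros tendsto_mean_doubt \<epsilon> tendsto_progress[OF v pos(1)] tendsto_progress[OF v' pos(2)]) simp
  ultimately have "c1 * c2 - 4 * \<epsilon> \<le> 0 + 0 + 2 * \<epsilon> + c1 * c2 / 2"
    by (intro tendsto_lowerbound) auto
  then show False using \<epsilon> by (simp add: \<epsilon>_def)
qed

lemma directional_zero_one_law:
  assumes v: "coordinate_height v e"
  shows "aprob 0 (escapes v) \<in> {0, 1}"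
proof (cases "aprob 0 (escapes v) = 0")
  case False
  interpret W: path_measure "walk_law 0" by (rule walk_law_path_measure)
  have pos: "aprob 0 (escapes v) > 0" using False by (simp add: zero_less_measure_iff)
  have "\<not> 0 < aprob 0 (escapes (\<lambda>x. - v x))"
    using not_both_directions[OF v pos] by blast
  then have "aprob 0 (escapes (\<lambda>x. - v x)) = 0"
    using measure_nonneg[of "walk_law 0" "escapes (\<lambda>x. - v x)"] by linarith
  then have "AE X in walk_law 0. X \<notin> escapes (\<lambda>x. - v x)"
    using escapes_measurable[of "\<lambda>x. - v x"] by (intro W.AE_notin_of_measure_zero) (simp_all only: W.sets_Q)
  with AE_escapes_or_escapes_back[OF v pos] have "AE X in walk_law 0. X \<in> escapes v"
    by eventually_elim blast
  then have "aprob 0 (escapes v) = 1"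
    using escapes_measurable[of v] by (subst W.prob_eq_1) (simp_all only: W.sets_Q)
  then show ?thesis by blast
qed simp

end

section \<open>The zero-one law\<close>

lemma coordinate_height_of_direction:
  assumes l: "l \<noteq> (0 :: real \<times> real)"
  obtains a e where "a > 0" "coordinate_height (\<lambda>x. (lattice_vec x \<bullet> l) / a) e"
proof -
  define a where "a = max \<bar>fst l\<bar> \<bar>snd l\<bar>"
  have a: "a > 0" using l by (auto simp: a_def prod_eq_iff max_def)
  define e :: "site" where
    "e = (if \<bar>snd l\<bar> \<le> \<bar>fst l\<bar> then (if 0 \<le> fst l then 1 else -1, 0) else (0, if 0 \<le> snd l then 1 else -1))"
  have inner: "lattice_vec x \<bullet> l = real_of_int (fst x) * fst l + real_of_int (snd x) * snd l" for x
    by (simp add: lattice_vec_def inner_prod_def)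
  have "coordinate_height (\<lambda>x. (lattice_vec x \<bullet> l) / a) e"
    unfolding coordinate_height_def
  proof (intro conjI)
    show "\<forall>x y. lattice_vec (x + y) \<bullet> l / a = lattice_vec x \<bullet> l / a + lattice_vec y \<bullet> l / a"
      unfolding inner by (simp add: algebra_simps add_divide_distrib)
    show "e \<in> unit_steps" by (simp add: e_def unit_steps_eq)
    show "lattice_vec e \<bullet> l / a = 1"
      unfolding inner using a by (auto simp: e_def a_def)
    show "\<forall>s\<in>unit_steps. \<bar>lattice_vec s \<bullet> l / a\<bar> \<le> 1"
      unfolding inner using a by (auto simp: unit_steps_eq a_def)
  qed
  with a show ?thesis by (rule that)
qed

theorem theorem1:
  fixes l :: "real \<times> real"
    and P :: "(int \<times> int \<Rightarrow> int \<times> int \<Rightarrow> real) measure"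
  assumes "l \<noteq> 0"
    and "prob_space P"
    and "sets P = sets env_space"
    and "iid_env P"
    and "elliptic_env P"
  shows "measure (annealed_law P 0) (transience_event l) \<in> {0, 1}"
proof -
  interpret prob_space P by fact
  interpret elliptic_environment P by unfold_locales fact+
  obtain a e where a: "a > 0" and v: "coordinate_height (\<lambda>x. (lattice_vec x \<bullet> l) / a) e"
    using coordinate_height_of_direction[OF \<open>l \<noteq> 0\<close>] by blast
  let ?v = "\<lambda>x. (lattice_vec x \<bullet> l) / a"
  have slice: "{X. (\<omega>, X) \<in> transience_event l} = escapes ?v" if "\<omega> \<in> space P" for \<omega>
  proof -
    have "filterlim (\<lambda>n. lattice_vec (X n) \<bullet> l) at_top sequentially \<longleftrightarrow> filterlim (\<lambda>n. ?v (X n)) at_top sequentially" for X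
      using filterlim_tendsto_pos_mult_at_top_iff[of "\<lambda>_. 1 / a" "1 / a" sequentially "\<lambda>n. lattice_vec (X n) \<bullet> l"] a by simp
    then show ?thesis using that by (simp add: transience_event_def space_P)
  qed
  have "emeasure (annealed_law P 0) (transience_event l) =
      (\<integral>\<^sup>+\<omega>. emeasure (quenched_law \<omega> 0) {X. (\<omega>, X) \<in> transience_event l} \<partial>P)"
    by (rule emeasure_annealed_law[OF assms(2,3) transience_event_measurable])
  also have "\<dots> = (\<integral>\<^sup>+\<omega>. emeasure (quenched_law \<omega> 0) (escapes ?v) \<partial>P)"
    by (intro nn_integral_cong) (simp only: slice)
  also have "\<dots> = emeasure (walk_law 0) (escapes ?v)"
    by (rule emeasure_walk_law[OF escapes_measurable, symmetric])
  finally have "emeasure (annealed_law P 0) (transience_event l) = emeasure (walk_law 0) (escapes ?v)" .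
  then have "measure (annealed_law P 0) (transience_event l) = measure (walk_law 0) (escapes ?v)"
    by (simp only: measure_def)
  with directional_zero_one_law[OF v] show ?thesis by simp
qed

end
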